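(* Let $\Sigma'$ be the branching semigroup of $A_2\subset G_2$ (the subalgebra $A_2$ generated by the long root vectors), defined using the ordering $\alpha_1,\dots,\alpha_6$ of positive roots of $G_2$ given in the context and any homogeneous monomial order on $\mathbb Z^6$. Then $\Sigma'$ is generated, as a commutative semigroup, by $$\begin{aligned}\sigma_1&=(\pi_1;0,0,0,0,0,1),&\sigma_2&=(\pi_1;0,0,0,0,0,0),&\sigma_3&=(\pi_1;0,0,1,0,0,0),\\ \sigma_4&=(\pi_2;0,0,0,0,0,0),&\sigma_5&=(\pi_2;0,0,1,0,0,0),&\sigma_6&=(\pi_2;0,0,0,1,0,0)\end{aligned}$$ with the one defining relation $\sigma_2+\sigma_5=\sigma_3+\sigma_4$.
   Context: Semigroups of signatures contain the zero signature. General definitions. Let $\mathfrak g$ be a simple complex Lie algebra with a triangular decomposition and positive roots $\{\alpha_1,\dots,\alpha_N\}$ in a fixed order, root vectors $e_{\pm\alpha}$; $V(\lambda)$ is the irreducible module with highest weight $\lambda$ and highest weight vector $v_\lambda$. A signature is $\sigma=(\lambda;p_1,\dots,p_N)$ with $\lambda$ dominant and exponents $p_i\in\mathbb Z_{\ge0}$; $v(\sigma)=e_{-\alpha_1}^{p_1}\cdots e_{-\alpha_N}^{p_N}v_\lambda$. Signatures are added componentwise. Fix a monomial order on exponent tuples (a total order compatible with addition, for which $0$ is the least element of $\mathbb Z_{\geq 0}^N$); it compares signatures of the same highest weight. The order is homogeneous if $\sum p_i<\sum q_i$ implies $(p_i)<(q_i)$. For $0\ne\omega\in V(\lambda)^*$,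 $\operatorname{sign}(\omega)$ is the least signature $\sigma$ of highest weight $\lambda$ with $\langle\omega,v(\sigma)\rangle\neq0$. For a subalgebra $\mathfrak h\subset\mathfrak g$ with $U'^-$ the maximal unipotent subgroup (of the connected subgroup $H$ with Lie algebra $\mathfrak h$) corresponding to the negative roots of $\mathfrak h$, the branching semigroup is $\Sigma'=\{\operatorname{sign}(\omega)\mid\lambda\text{ dominant},\ 0\neq\omega\in(V(\lambda)^* )^{U'^-}\}$. The case at hand. $\mathfrak g=G_2$ with short simple root $a$ and long simple root $b$. The positive roots are ordered as $\alpha_1=3a+2b$, $\alpha_2=3a+b$, $\alpha_3=2a+b$, $\alpha_4=a+b$, $\alpha_5=b$, $\alpha_6=a$. The fundamental weights are $\pi_1=2a+b$ ($\dim V(\pi_1)=7$) and $\pi_2=3a+2b$ ($\dim V(\pi_2)=14$). $\mathfrak h=A_2$ has the same Cartan subalgebra, positive roots $\alpha_1,\alpha_2,\alpha_5$, and fundamental weights $\omega_1=a+b$, $\omega_2=2a+b$. The generators $\sigma_1,\dots,\sigma_6$ correspond respectively to the $A_2$-highest weights $\omega_1,\ \omega_2,\ 0,\ \omega_1+\omega_2,\ \omega_1,\ \omega_2$. The numbering of exponents follows the numbering of positive roots. *)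

theory Defs
  imports Complex_Main "HOL-Library.Product_Plus" "HOL-Library.Multiset"
begin

section \<open>Lie algebras and their modules\<close>

locale lie_algebra = vector_space scale
  for scale :: "complex \<Rightarrow> 'g::ab_group_add \<Rightarrow> 'g" +
  fixes bracket :: "'g \<Rightarrow> 'g \<Rightarrow> 'g"
  assumes bracket_linear_left: "Vector_Spaces.linear scale scale (\<lambda>x. bracket x y)"
    and bracket_linear_right: "Vector_Spaces.linear scale scale (bracket x)"
    and bracket_self: "bracket x x = 0"
    and jacobi: "bracket x (bracket y z) + bracket y (bracket z x) + bracket z (bracket x y) = 0"
begin

definition subalgebra :: "'g set \<Rightarrow> bool" where
  "subalgebra W \<longleftrightarrow> subspace W \<and> (\<forall>x\<in>W. \<forall>y\<in>W. bracket x y \<in> W)"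

definition lie_ideal :: "'g set \<Rightarrow> bool" where
  "lie_ideal I \<longleftrightarrow> subspace I \<and> (\<forall>x. \<forall>y\<in>I. bracket x y \<in> I)"

definition simple_lie_algebra :: bool where
  "simple_lie_algebra \<longleftrightarrow>
     (\<exists>x y. bracket x y \<noteq> 0) \<and> (\<forall>I. lie_ideal I \<longrightarrow> I = {0} \<or> I = UNIV)"

end

text \<open>A finite-dimensional module is carried by a subspace \<open>M\<close> of an ambient complex vector
  space, so that modules of different dimensions can live in one type. The action is
  unconstrained outside \<open>M\<close>.\<close>

locale lie_module = lie_algebra scale bracket + V: vector_space scaleV
  for scale :: "complex \<Rightarrow> 'g::ab_group_add \<Rightarrow> 'g"
    and bracket :: "'g \<Rightarrow> 'g \<Rightarrow> 'g"
    and scaleV :: "complex \<Rightarrow> 'v::ab_group_add \<Rightarrow> 'v" +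
  fixes M :: "'v set" and act :: "'g \<Rightarrow> 'v \<Rightarrow> 'v"
  assumes finite_dimensional: "\<exists>B. finite B \<and> M = V.span B"
    and act_closed: "m \<in> M \<Longrightarrow> act x m \<in> M"
    and act_add: "m \<in> M \<Longrightarrow> n \<in> M \<Longrightarrow> act x (m + n) = act x m + act x n"
    and act_scale: "m \<in> M \<Longrightarrow> act x (scaleV c m) = scaleV c (act x m)"
    and add_act: "m \<in> M \<Longrightarrow> act (x + y) m = act x m + act y m"
    and scale_act: "m \<in> M \<Longrightarrow> act (scale c x) m = scaleV c (act x m)"
    and bracket_act: "m \<in> M \<Longrightarrow> act (bracket x y) m = act x (act y m) - act y (act x m)"
begin

definition irreducible_module :: bool where
  "irreducible_module \<longleftrightarrow> M \<noteq> {0} \<and>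
     (\<forall>W. V.subspace W \<and> W \<subseteq> M \<and> (\<forall>x. \<forall>w\<in>W. act x w \<in> W) \<longrightarrow> W = {0} \<or> W = M)"

end

section \<open>The root system of type $G_2$\<close>

text \<open>The weight lattice of $G_2$ coincides with its root lattice; the pair \<open>(m, n)\<close> stands for
  the weight $m a + n b$, with $a$ the short and $b$ the long simple root.\<close>

type_synonym weight = "int \<times> int"

datatype node = Short | Long

fun simple_root :: "node \<Rightarrow> weight" where
  "simple_root Short = (1, 0)"
| "simple_root Long = (0, 1)"

text \<open>\<open>coroot i \<mu>\<close> is the value of the weight \<open>\<mu>\<close> on the simple coroot of the node \<open>i\<close>; the Cartan
  integers are $\langle b, a^\vee\rangle = -3$ and $\langle a, b^\vee\rangle = -1$.\<close>

fun coroot :: "node \<Rightarrow> weight \<Rightarrow> int" where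
  "coroot Short (m, n) = 2 * m - 3 * n"
| "coroot Long (m, n) = 2 * n - m"

definition pos_roots :: "weight list" where
  "pos_roots = [(3, 2), (3, 1), (2, 1), (1, 1), (0, 1), (1, 0)]"

definition roots :: "weight set" where
  "roots = set pos_roots \<union> uminus ` set pos_roots"

definition long_roots :: "weight set" where
  "long_roots = {(3, 2), (3, 1), (0, 1)} \<union> uminus ` {(3, 2), (3, 1), (0, 1)}"

definition dominant :: "weight \<Rightarrow> bool" where
  "dominant \<mu> \<longleftrightarrow> (\<forall>i. 0 \<le> coroot i \<mu>)"

definition pi1 :: weight where "pi1 = (2, 1)"
definition pi2 :: weight where "pi2 = (3, 2)"

lemma fundamental_weights:
  "coroot Short pi1 = 1" "coroot Long pi1 = 0" "coroot Short pi2 = 0" "coroot Long pi2 = 1"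
  by (simp_all add: pi1_def pi2_def)

section \<open>The simple Lie algebra $G_2$\<close>

text \<open>$G_2$ is given by Chevalley generators subject to the Serre relations. By Serre's theorem
  these relations present the simple Lie algebra of type $G_2$, so the nonzero algebras
  satisfying the assumptions below are exactly its copies. The elements \<open>H i\<close> span the Cartan
  subalgebra, and \<open>e \<alpha>\<close> is an arbitrary root vector of the root \<open>\<alpha>\<close>.\<close>

locale g2 = lie_algebra scale bracket
  for scale :: "complex \<Rightarrow> 'g::ab_group_add \<Rightarrow> 'g"
    and bracket :: "'g \<Rightarrow> 'g \<Rightarrow> 'g" +
  fixes E F H :: "node \<Rightarrow> 'g"
    and e :: "weight \<Rightarrow> 'g"
  assumes simple: "simple_lie_algebra"
    and HH: "bracket (H i) (H j) = 0"
    and HE: "bracket (H i) (E j) = scale (of_int (coroot i (simple_root j))) (E j)"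
    and HF: "bracket (H i) (F j) = scale (- of_int (coroot i (simple_root j))) (F j)"
    and EF: "bracket (E i) (F j) = (if i = j then H i else 0)"
    and serre_E: "i \<noteq> j \<Longrightarrow>
      (bracket (E i) ^^ nat (1 - coroot i (simple_root j))) (E j) = 0"
    and serre_F: "i \<noteq> j \<Longrightarrow>
      (bracket (F i) ^^ nat (1 - coroot i (simple_root j))) (F j) = 0"
    and generated: "subalgebra hull (range E \<union> range F \<union> range H) = UNIV"
    and root_vector: "\<alpha> \<in> roots \<Longrightarrow>
      e \<alpha> \<noteq> 0 \<and> (\<forall>i. bracket (H i) (e \<alpha>) = scale (of_int (coroot i \<alpha>)) (e \<alpha>))"
begin

definition root_space :: "weight \<Rightarrow> 'g set" where
  "root_space \<alpha> = {x. \<forall>i. bracket (H i) x = scale (of_int (coroot i \<alpha>)) x}"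

definition A2 :: "'g set" where
  "A2 = subalgebra hull (e ` long_roots)"

end

section \<open>Signatures\<close>

type_synonym exponents = "nat \<times> nat \<times> nat \<times> nat \<times> nat \<times> nat"
type_synonym signature = "weight \<times> exponents"

fun degree :: "exponents \<Rightarrow> nat" where
  "degree (p1, p2, p3, p4, p5, p6) = p1 + p2 + p3 + p4 + p5 + p6"

text \<open>A monomial order on $\mathbb{Z}^6$ is determined by its restriction to
  $\mathbb{Z}_{\ge 0}^6$, and every order as below arises as such a restriction.\<close>

locale monomial_order = linorder le lt
  for le lt :: "exponents \<Rightarrow> exponents \<Rightarrow> bool" +
  assumes add_mono: "le p q \<Longrightarrow> le (p + r) (q + r)"
    and zero_least: "le 0 p"
begin

definition homogeneous :: bool where
  "homogeneous \<longleftrightarrow> (\<forall>p q. degree p < degree q \<longrightarrow> lt p q)"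

end

section \<open>The branching semigroup of $A_2 \subset G_2$\<close>

text \<open>For dominant \<open>\<mu>\<close>, the irreducible module with highest weight \<open>\<mu>\<close> has carrier \<open>V \<mu>\<close>, action
  \<open>act \<mu>\<close> and highest weight vector \<open>hv \<mu>\<close>.\<close>

locale g2_branching =
  g2 scale bracket E F H e + V: vector_space scaleV + monomial_order le lt
  for scale :: "complex \<Rightarrow> 'g::ab_group_add \<Rightarrow> 'g"
    and bracket :: "'g \<Rightarrow> 'g \<Rightarrow> 'g"
    and E F H :: "node \<Rightarrow> 'g"
    and e :: "weight \<Rightarrow> 'g"
    and scaleV :: "complex \<Rightarrow> 'v::ab_group_add \<Rightarrow> 'v"
    and le lt :: "exponents \<Rightarrow> exponents \<Rightarrow> bool" +
  fixes V :: "weight \<Rightarrow> 'v set"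
    and act :: "weight \<Rightarrow> 'g \<Rightarrow> 'v \<Rightarrow> 'v"
    and hv :: "weight \<Rightarrow> 'v"
  assumes module: "dominant \<mu> \<Longrightarrow> lie_module scale bracket scaleV (V \<mu>) (act \<mu>)"
    and irreducible: "dominant \<mu> \<Longrightarrow> lie_module.irreducible_module scaleV (V \<mu>) (act \<mu>)"
    and hv_nonzero: "dominant \<mu> \<Longrightarrow> hv \<mu> \<in> V \<mu> \<and> hv \<mu> \<noteq> 0"
    and hv_weight: "dominant \<mu> \<Longrightarrow> act \<mu> (H i) (hv \<mu>) = scaleV (of_int (coroot i \<mu>)) (hv \<mu>)"
    and hv_highest: "dominant \<mu> \<Longrightarrow> \<alpha> \<in> set pos_roots \<Longrightarrow> act \<mu> (e \<alpha>) (hv \<mu>) = 0"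
begin

fun vec :: "signature \<Rightarrow> 'v" where
  "vec (\<mu>, (p1, p2, p3, p4, p5, p6)) =
     (act \<mu> (e (- (3, 2))) ^^ p1)
    ((act \<mu> (e (- (3, 1))) ^^ p2)
    ((act \<mu> (e (- (2, 1))) ^^ p3)
    ((act \<mu> (e (- (1, 1))) ^^ p4)
    ((act \<mu> (e (- (0, 1))) ^^ p5)
    ((act \<mu> (e (- (1, 0))) ^^ p6) (hv \<mu>))))))"

text \<open>Functionals on \<open>V \<mu>\<close>; only their values on \<open>V \<mu>\<close> matter.\<close>

definition dual :: "weight \<Rightarrow> ('v \<Rightarrow> complex) set" where
  "dual \<mu> = {\<omega>. (\<forall>x\<in>V \<mu>. \<forall>y\<in>V \<mu>. \<omega> (x + y) = \<omega> x + \<omega> y) \<and>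
                (\<forall>c. \<forall>x\<in>V \<mu>. \<omega> (scaleV c x) = c * \<omega> x)}"

definition sign :: "weight \<Rightarrow> ('v \<Rightarrow> complex) \<Rightarrow> signature" where
  "sign \<mu> \<omega> = (\<mu>, Least (\<lambda>p. \<omega> (vec (\<mu>, p)) \<noteq> 0))"

text \<open>The exponential of an operator that is locally nilpotent on the vectors of interest, so
  that the sum below is over a finite set.\<close>

definition exp_nilpotent :: "('v \<Rightarrow> 'v) \<Rightarrow> 'v \<Rightarrow> 'v" where
  "exp_nilpotent X v = (\<Sum>k | (X ^^ k) v \<noteq> 0. scaleV (1 / fact k) ((X ^^ k) v))"

text \<open>The operators on \<open>V \<mu>\<close> by which the maximal unipotent subgroup of the connected group with
  Lie algebra \<open>A2\<close> acts: this subgroup is generated by the exponentials of the negative root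
  spaces of \<open>A2\<close>. Since each root space is closed under negation, products of exponentials are
  already closed under inverses on \<open>V \<mu>\<close>.\<close>

inductive_set unipotent :: "weight \<Rightarrow> ('v \<Rightarrow> 'v) set" for \<mu> :: weight where
  one: "id \<in> unipotent \<mu>"
| mult: "u \<in> unipotent \<mu> \<Longrightarrow> \<alpha> \<in> set pos_roots \<Longrightarrow> x \<in> A2 \<inter> root_space (- \<alpha>) \<Longrightarrow>
    exp_nilpotent (act \<mu> x) \<circ> u \<in> unipotent \<mu>"

definition invariants :: "weight \<Rightarrow> ('v \<Rightarrow> complex) set" where
  "invariants \<mu> = {\<omega> \<in> dual \<mu>. \<forall>u\<in>unipotent \<mu>. \<forall>x\<in>V \<mu>. \<omega> (u x) = \<omega> x}"

definition branching_semigroup :: "signature set" where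
  "branching_semigroup =
     {sign \<mu> \<omega> | \<mu> \<omega>. dominant \<mu> \<and> \<omega> \<in> invariants \<mu> \<and> (\<exists>x\<in>V \<mu>. \<omega> x \<noteq> 0)}"

end

section \<open>Presentations of commutative semigroups with zero\<close>

text \<open>Multisets form free commutative monoids.\<close>

inductive cong_generated :: "('s multiset \<times> 's multiset) set \<Rightarrow> 's multiset \<Rightarrow> 's multiset \<Rightarrow> bool"
  for R where
  base: "(M, N) \<in> R \<Longrightarrow> cong_generated R M N"
| refl: "cong_generated R M M"
| sym: "cong_generated R M N \<Longrightarrow> cong_generated R N M"
| trans: "cong_generated R M N \<Longrightarrow> cong_generated R N K \<Longrightarrow> cong_generated R M K"
| add: "cong_generated R M N \<Longrightarrow> cong_generated R (M + K) (N + K)"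

definition generated_by :: "'s::comm_monoid_add set \<Rightarrow> 's set \<Rightarrow> bool" where
  "generated_by S G \<longleftrightarrow> S = {\<Sum>\<^sub># M | M. set_mset M \<subseteq> G}"

definition defining_relations ::
  "'s::comm_monoid_add set \<Rightarrow> ('s multiset \<times> 's multiset) set \<Rightarrow> bool" where
  "defining_relations G R \<longleftrightarrow>
     (\<forall>M N. set_mset M \<subseteq> G \<longrightarrow> set_mset N \<subseteq> G \<longrightarrow>
        (\<Sum>\<^sub># M = \<Sum>\<^sub># N \<longleftrightarrow> cong_generated R M N))"

section \<open>The generators\<close>

definition sigma1 :: signature where "sigma1 = (pi1, (0, 0, 0, 0, 0, 1))"
definition sigma2 :: signature where "sigma2 = (pi1, (0, 0, 0, 0, 0, 0))"
definition sigma3 :: signature where "sigma3 = (pi1, (0, 0, 1, 0, 0, 0))"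
definition sigma4 :: signature where "sigma4 = (pi2, (0, 0, 0, 0, 0, 0))"
definition sigma5 :: signature where "sigma5 = (pi2, (0, 0, 1, 0, 0, 0))"
definition sigma6 :: signature where "sigma6 = (pi2, (0, 0, 0, 1, 0, 0))"

end

theory Submission
  imports Defs "HOL-Computational_Algebra.Polynomial" "HOL-Library.Function_Algebras"
begin

text \<open>Let the highest weight be \<open>k \<pi>\<^sub>1 + l \<pi>\<^sub>2\<close>, with highest weight vector \<open>v\<close>. An invariant
  functional \<open>\<omega>\<close> is determined by the polynomial with coefficients
  \<open>\<omega> (e\<^sub>-\<^sub>\<alpha>\<^sub>3 ^ i e\<^sub>-\<^sub>\<alpha>\<^sub>4 ^ j e\<^sub>-\<^sub>\<alpha>\<^sub>6 ^ m v) / (i! j! m!)\<close> in variables \<open>x, y, z\<close>; it is the function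
  \<open>u \<mapsto> \<omega> (u v)\<close> on the quotient of the maximal unipotent group of \<open>G\<^sub>2\<close> by that of \<open>A\<^sub>2\<close>. Exponents of the
  long roots in a signature vanish: the root vectors of \<open>\<alpha>\<^sub>1, \<alpha>\<^sub>2\<close> stand to the left, and that of
  \<open>\<alpha>\<^sub>5 = b\<close> commutes with those of \<open>\<alpha>\<^sub>3, \<alpha>\<^sub>4\<close>, so that it can be moved to the left. After a
  rescaling of \<open>x\<close>, the simple root vectors then act as \<open>\<partial>\<^sub>z\<close> and \<open>z (\<partial>\<^sub>y + z \<partial>\<^sub>x)\<close>
  (\<open>coord_fs\<close>, \<open>ncoord_fl\<close>).

  \<^bold>\<open>Upper bound.\<close> From \<open>e\<^sub>-\<^sub>a ^ (k + 1) v = 0\<close> and \<open>e\<^sub>-\<^sub>b ^ (l + 1) v = 0\<close> the polynomial has degree at most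
  \<open>k\<close> in \<open>z\<close> and is annihilated by \<open>(\<partial>\<^sub>y + z \<partial>\<^sub>x) ^ (l + 1)\<close>. A divisibility argument in one
  variable then shows that the exponents \<open>(p, q, s)\<close> of its lowest term satisfy \<open>s \<le> k\<close>, \<open>q \<le> l\<close> and
  \<open>p + q + s \<le> k + l\<close> (\<open>lowest_term_bound\<close>). These are exactly the exponents that occur in sums of
  the generators (\<open>generated_signatures\<close>).

  \<^bold>\<open>Existence.\<close> For \<open>\<pi>\<^sub>1\<close> the invariants are \<open>1, z, x - y z\<close>, and for \<open>\<pi>\<^sub>2\<close> they are \<open>1, x, y\<close>; products of
  them have every lowest term allowed by the bound. A product is a functional on a tensor product
  of representations, and it has to descend to the given irreducible module. This holds because
  every relation between products of lowering operators applied to \<open>v\<close> also holds for the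
  corresponding vector of the tensor product: the latter carries a positive definite contravariant
  form (\<open>relations_hold_in_tensors\<close>).

  The defining relation is combinatorial: the weight and the exponents of a sum determine the
  multiplicities of the generators up to exchanging \<open>\<sigma>\<^sub>2 + \<sigma>\<^sub>5\<close> for \<open>\<sigma>\<^sub>3 + \<sigma>\<^sub>4\<close>.\<close>

section \<open>Root vectors of $G_2$\<close>

context lie_algebra
begin

lemma bracket_add_left: "bracket (x + y) z = bracket x z + bracket y z"
  using bracket_linear_left[of z] by (simp add: Vector_Spaces.linear_iff)

lemma bracket_add_right: "bracket x (y + z) = bracket x y + bracket x z"
  using bracket_linear_right[of x] by (simp add: Vector_Spaces.linear_iff)

lemma bracket_scale_left: "bracket (scale c x) y = scale c (bracket x y)"
  using bracket_linear_left[of y] by (simp add: Vector_Spaces.linear_iff)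

lemma bracket_scale_right: "bracket x (scale c y) = scale c (bracket x y)"
  using bracket_linear_right[of x] by (simp add: Vector_Spaces.linear_iff)

lemma bracket_zero [simp]: "bracket x 0 = 0" "bracket 0 x = 0"
  using bracket_scale_right[of x 0 0] bracket_scale_left[of 0 0 x] by auto

lemma bracket_minus_right: "bracket x (- y) = - bracket x y"
  using bracket_scale_right[of x "-1" y] by simp

lemma bracket_minus_left: "bracket (- x) y = - bracket x y"
  using bracket_scale_left[of "-1" x y] by simp

lemma bracket_anti: "bracket x y = - bracket y x"
proof -
  have "bracket (x + y) (x + y) = bracket x y + bracket y x"
    unfolding bracket_add_left bracket_add_right by (simp add: bracket_self add.commute)
  then have "bracket x y + bracket y x = 0" by (metis bracket_self)
  then show ?thesis by (simp only: eq_neg_iff_add_eq_0)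
qed

lemma bracket_derivation: "bracket x (bracket y z) = bracket (bracket x y) z + bracket y (bracket x z)"
proof -
  have "bracket x (bracket y z) = - bracket y (bracket z x) - bracket z (bracket x y)"
    using jacobi[of x y z] by (simp add: algebra_simps eq_neg_iff_add_eq_0)
  moreover have "bracket y (bracket z x) = - bracket y (bracket x z)"
    using bracket_anti[of z x] by (simp add: bracket_minus_right)
  moreover have "bracket z (bracket x y) = - bracket (bracket x y) z" by (rule bracket_anti)
  ultimately show ?thesis by simp
qed

lemma subspace_bracket_stable: "subspace S \<Longrightarrow> subspace {x. bracket y x \<in> S}"
  by (auto simp: subspace_def bracket_add_right bracket_scale_right)

text \<open>Root vectors along the \<open>a\<close>-string \<open>b, a + b, 2a + b, 3a + b\<close> and for \<open>3a + 2b\<close>. The same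
  formula serves for \<open>X = E\<close> and for \<open>X = F\<close>.\<close>

definition nested :: "(node \<Rightarrow> 'g) \<Rightarrow> weight \<Rightarrow> 'g" where
  "nested X \<alpha> =
    (if \<alpha> = (1, 0) then X Short
     else if \<alpha> = (0, 1) then X Long
     else if \<alpha> = (1, 1) then bracket (X Short) (X Long)
     else if \<alpha> = (2, 1) then bracket (X Short) (bracket (X Short) (X Long))
     else if \<alpha> = (3, 1) then bracket (X Short) (bracket (X Short) (bracket (X Short) (X Long)))
     else bracket (X Long) (bracket (X Short) (bracket (X Short) (bracket (X Short) (X Long)))))"

end

lemma all_node: "(\<forall>i. P i) \<longleftrightarrow> P Short \<and> P Long"
  by (metis node.exhaust)

lemma coroot_add: "coroot i (\<mu> + \<nu>) = coroot i \<mu> + coroot i \<nu>"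
  by (cases i; cases \<mu>; cases \<nu>) (auto simp: algebra_simps)

lemma coroot_minus: "coroot i (- \<mu>) = - coroot i \<mu>"
  by (cases i; cases \<mu>) auto

lemma coroot_diff: "coroot i (\<mu> - \<nu>) = coroot i \<mu> - coroot i \<nu>"
  by (cases i; cases \<mu>; cases \<nu>) (auto simp: algebra_simps)

lemma coroot_eqI: "(\<And>i. coroot i \<mu> = coroot i \<nu>) \<Longrightarrow> \<mu> = \<nu>"
proof -
  assume *: "\<And>i. coroot i \<mu> = coroot i \<nu>"
  obtain m n m' n' where "\<mu> = (m, n)" "\<nu> = (m', n')" by (cases \<mu>; cases \<nu>) auto
  then show ?thesis using *[of Short] *[of Long] by auto
qed

text \<open>The relations between Chevalley generators are kept in a locale of their own because they
  are preserved by the Chevalley involution \<open>(E, F, H) \<mapsto> (F, E, - H)\<close>; this halves the work.\<close>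

locale chevalley = lie_algebra scale bracket
  for scale :: "complex \<Rightarrow> 'g::ab_group_add \<Rightarrow> 'g"
    and bracket :: "'g \<Rightarrow> 'g \<Rightarrow> 'g" +
  fixes E F H :: "node \<Rightarrow> 'g"
  assumes HF: "bracket (H i) (F j) = scale (- of_int (coroot i (simple_root j))) (F j)"
    and EF: "bracket (E i) (F j) = (if i = j then H i else 0)"
    and serre_F: "i \<noteq> j \<Longrightarrow>
      (bracket (F i) ^^ nat (1 - coroot i (simple_root j))) (F j) = 0"
begin

definition f :: "weight \<Rightarrow> 'g" where
  "f = nested F"

lemma f_simps:
  "f (1, 0) = F Short" "f (0, 1) = F Long" "f (1, 1) = bracket (F Short) (F Long)"
  "f (2, 1) = bracket (F Short) (f (1, 1))" "f (3, 1) = bracket (F Short) (f (2, 1))"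
  "f (3, 2) = bracket (F Long) (f (3, 1))"
  by (simp_all add: f_def nested_def)

lemma f_Short: "bracket (F Short) (f (3, 1)) = 0"
  using serre_F[of Short Long] by (simp add: f_simps numeral_eq_Suc)

lemma f_Long11: "bracket (F Long) (f (1, 1)) = 0"
proof -
  have "bracket (F Long) (bracket (F Long) (F Short)) = 0"
    using serre_F[of Long Short] by (simp add: numeral_eq_Suc)
  moreover have "bracket (F Long) (F Short) = - f (1, 1)"
    unfolding f_simps by (rule bracket_anti)
  ultimately show ?thesis by (simp add: bracket_minus_right)
qed

lemma f_Long21: "bracket (F Long) (f (2, 1)) = 0"
proof -
  have "bracket (F Long) (f (2, 1)) = bracket (bracket (F Long) (F Short)) (f (1, 1))"
    using bracket_derivation[of "F Long" "F Short" "f (1, 1)"]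
    by (simp add: f_simps(4) f_Long11)
  also have "bracket (F Long) (F Short) = - f (1, 1)"
    unfolding f_simps by (rule bracket_anti)
  finally show ?thesis by (simp add: bracket_minus_left bracket_self)
qed

lemma f_11_21: "bracket (f (1, 1)) (f (2, 1)) = - f (3, 2)"
proof -
  have "f (3, 2) = bracket (bracket (F Long) (F Short)) (f (2, 1))"
    using bracket_derivation[of "F Long" "F Short" "f (2, 1)"]
    by (simp add: f_simps(5,6) f_Long21)
  also have "bracket (F Long) (F Short) = - f (1, 1)"
    unfolding f_simps by (rule bracket_anti)
  finally show ?thesis by (simp add: bracket_minus_left)
qed

text \<open>The two ways of writing \<open>f (3, 2)\<close> as a bracket, \<open>[F Long, f (3, 1)]\<close> and
  \<open>- [f (1, 1), f (2, 1)]\<close>, give opposite values for its bracket with \<open>F Short\<close>. So \<open>4a + 2b\<close> is not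
  a root.\<close>

lemma f_11_31: "bracket (f (1, 1)) (f (3, 1)) = 0" and f_Short32: "bracket (F Short) (f (3, 2)) = 0"
proof -
  have 1: "bracket (F Short) (f (3, 2)) = bracket (f (1, 1)) (f (3, 1))"
    unfolding f_simps(6) bracket_derivation[of "F Short" "F Long" "f (3, 1)"] f_Short f_simps(3) by simp
  have "bracket (F Short) (bracket (f (1, 1)) (f (2, 1))) = bracket (f (1, 1)) (f (3, 1))"
    unfolding bracket_derivation[of "F Short" "f (1, 1)" "f (2, 1)"] f_simps(4)[symmetric]
      f_simps(5)[symmetric] by (simp add: bracket_self)
  then have "bracket (F Short) (f (3, 2)) = - bracket (f (1, 1)) (f (3, 1))"
    by (metis f_11_21 bracket_minus_right minus_minus)
  with 1 have "bracket (f (1, 1)) (f (3, 1)) + bracket (f (1, 1)) (f (3, 1)) = 0"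
    by (metis left_minus)
  then have "scale (1 + 1) (bracket (f (1, 1)) (f (3, 1))) = 0"
    by (simp only: scale_left_distrib scale_one)
  then show *: "bracket (f (1, 1)) (f (3, 1)) = 0" by simp
  with 1 show "bracket (F Short) (f (3, 2)) = 0" by simp
qed

lemma f_Long32: "bracket (F Long) (f (3, 2)) = 0"
proof -
  have "bracket (F Long) (bracket (f (1, 1)) (f (2, 1))) = 0"
    using bracket_derivation[of "F Long" "f (1, 1)" "f (2, 1)"] by (simp add: f_Long11 f_Long21)
  then show ?thesis by (simp add: f_11_21 bracket_minus_right)
qed

lemma f_21_31: "bracket (f (2, 1)) (f (3, 1)) = 0"
  using bracket_derivation[of "F Short" "f (1, 1)" "f (3, 1)"]
  by (simp add: f_11_31 f_Short f_simps(4)[symmetric])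

lemma f_32_central:
  assumes "\<alpha> \<in> set pos_roots"
  shows "bracket (f (3, 2)) (f \<alpha>) = 0"
proof -
  have step: "bracket (f (3, 2)) (bracket (F i) y) = 0" if "bracket (f (3, 2)) y = 0" for i y
    using that bracket_derivation[of "f (3, 2)" "F i" y] bracket_anti[of "f (3, 2)" "F i"]
      f_Short32 f_Long32 by (cases i) auto
  have 1: "bracket (f (3, 2)) (F i) = 0" for i
    using bracket_anti[of "f (3, 2)" "F i"] f_Short32 f_Long32 by (cases i) auto
  have "bracket (f (3, 2)) (f (1, 1)) = 0" unfolding f_simps(3) by (intro step 1)
  moreover from this have "bracket (f (3, 2)) (f (2, 1)) = 0" unfolding f_simps(4) by (intro step)
  ultimately show ?thesis
    using assms step[where y = "f (1, 1)"] step[where y = "f (2, 1)"] 1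
    by (auto simp: pos_roots_def f_simps(1,2) f_simps(5) bracket_self intro!: step 1)
qed

lemma bracket_H_bracket:
  assumes "bracket (H i) x = scale c x" "bracket (H i) y = scale d y"
  shows "bracket (H i) (bracket x y) = scale (c + d) (bracket x y)"
  using bracket_derivation[of "H i" x y] assms
  by (simp add: bracket_scale_left bracket_scale_right scale_left_distrib)

lemma bracket_H_f:
  assumes "\<alpha> \<in> set pos_roots"
  shows "bracket (H i) (f \<alpha>) = scale (- of_int (coroot i \<alpha>)) (f \<alpha>)"
proof -
  have S: "bracket (H i) (F Short) = scale (- of_int (coroot i (1, 0))) (F Short)"
   and L: "bracket (H i) (F Long) = scale (- of_int (coroot i (0, 1))) (F Long)"
    using HF[of i Short] HF[of i Long] by simp_all
  have 11: "bracket (H i) (f (1, 1)) = scale (- of_int (coroot i (1, 1))) (f (1, 1))"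
    unfolding f_simps using bracket_H_bracket[OF S L] by (cases i) auto
  have 21: "bracket (H i) (f (2, 1)) = scale (- of_int (coroot i (2, 1))) (f (2, 1))"
    unfolding f_simps(4) using bracket_H_bracket[OF S 11] by (cases i) auto
  have 31: "bracket (H i) (f (3, 1)) = scale (- of_int (coroot i (3, 1))) (f (3, 1))"
    unfolding f_simps(5) using bracket_H_bracket[OF S 21] by (cases i) auto
  have 32: "bracket (H i) (f (3, 2)) = scale (- of_int (coroot i (3, 2))) (f (3, 2))"
    unfolding f_simps(6) using bracket_H_bracket[OF L 31] by (cases i) auto
  show ?thesis using assms S L 11 21 31 32 by (auto simp: pos_roots_def f_simps(1,2))
qed

abbreviation borel_opp :: "'g set" where
  "borel_opp \<equiv> span (f ` set pos_roots \<union> range H)"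

lemma f_in: "\<alpha> \<in> set pos_roots \<Longrightarrow> f \<alpha> \<in> borel_opp" and H_in: "H i \<in> borel_opp"
  by (auto intro: span_base)

lemma bracket_F_f:
  assumes "\<alpha> \<in> set pos_roots"
  shows "bracket (F i) (f \<alpha>) \<in> borel_opp"
proof -
  have LS: "bracket (F Long) (F Short) = - f (1, 1)"
    unfolding f_simps by (rule bracket_anti)
  have "f (3, 2) \<in> borel_opp" "f (3, 1) \<in> borel_opp" "f (2, 1) \<in> borel_opp" "f (1, 1) \<in> borel_opp"
     "F Short \<in> borel_opp" "F Long \<in> borel_opp"
    using f_in[of "(1, 0)"] f_in[of "(0, 1)"] f_in[of "(1, 1)"] f_in[of "(2, 1)"] f_in[of "(3, 1)"]
      f_in[of "(3, 2)"]
    by (simp_all only: f_simps(1,2)) (simp_all add: pos_roots_def)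
  moreover have "\<alpha> = (3, 2) \<or> \<alpha> = (3, 1) \<or> \<alpha> = (2, 1) \<or> \<alpha> = (1, 1) \<or> \<alpha> = (0, 1) \<or> \<alpha> = (1, 0)"
    using assms by (simp add: pos_roots_def)
  ultimately show ?thesis
    by (cases i) (auto simp only: f_simps(1,2) f_simps(3-6)[symmetric] f_Short f_Short32
      f_Long11 f_Long21 f_Long32 bracket_self LS intro!: span_neg span_zero)
qed

text \<open>By induction along the strings that define \<open>f\<close>, from
  \<open>[E i, [F j, y]] = [[E i, F j], y] + [F j, [E i, y]]\<close>.\<close>

lemma bracket_E_f:
  assumes "\<alpha> \<in> set pos_roots"
  shows "bracket (E i) (f \<alpha>) \<in> borel_opp"
proof -
  have E_step: "bracket (E i) (bracket (F j) y) =
      (if i = j then bracket (H i) y else 0) + bracket (F j) (bracket (E i) y)" for i j y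
    using bracket_derivation[of "E i" "F j" y] by (simp add: EF)
  have FH: "bracket (F j) (H i) = scale (of_int (coroot i (simple_root j))) (F j)" for i j
    using HF[of i j] bracket_anti[of "F j" "H i"] by simp
  note Hf = bracket_H_f[unfolded pos_roots_def]
  have merge: "y + scale c y = scale (1 + c) y" "scale c y - y = scale (c - 1) y" for c y
    by (simp_all add: scale_left_distrib scale_left_diff_distrib)
  have S11: "bracket (E Short) (f (1, 1)) = scale 3 (F Long)"
    by (simp add: f_simps(3) E_step EF HF)
  have S21: "bracket (E Short) (f (2, 1)) = scale 4 (f (1, 1))"
    unfolding f_simps(4) E_step S11 bracket_scale_right f_simps(3)[symmetric]
    by (simp add: Hf merge)
  have S31: "bracket (E Short) (f (3, 1)) = scale 3 (f (2, 1))"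
    unfolding f_simps(5) E_step S21 bracket_scale_right f_simps(4)[symmetric]
    by (simp add: Hf merge)
  have S32: "bracket (E Short) (f (3, 2)) = 0"
    by (simp add: f_simps(6) E_step S31 bracket_scale_right f_Long21)
  have L11: "bracket (E Long) (f (1, 1)) = - F Short"
    by (simp add: f_simps(3) E_step EF FH)
  have L21: "bracket (E Long) (f (2, 1)) = 0"
    by (simp add: f_simps(4) E_step L11 bracket_minus_right bracket_self)
  have L31: "bracket (E Long) (f (3, 1)) = 0"
    by (simp add: f_simps(5) E_step L21)
  have L32: "bracket (E Long) (f (3, 2)) = f (3, 1)"
    by (simp add: f_simps(6) E_step L31 Hf)
  have "f (3, 1) \<in> borel_opp" "f (2, 1) \<in> borel_opp" "f (1, 1) \<in> borel_opp"
     "F Short \<in> borel_opp" "F Long \<in> borel_opp"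
    using f_in[of "(1, 0)"] f_in[of "(0, 1)"] f_in[of "(1, 1)"] f_in[of "(2, 1)"] f_in[of "(3, 1)"]
    by (simp_all only: f_simps(1,2)) (simp_all add: pos_roots_def)
  moreover have "\<alpha> = (3, 2) \<or> \<alpha> = (3, 1) \<or> \<alpha> = (2, 1) \<or> \<alpha> = (1, 1) \<or> \<alpha> = (0, 1) \<or> \<alpha> = (1, 0)"
    using assms by (simp add: pos_roots_def)
  moreover have "bracket (E i) (F j) \<in> borel_opp" for i j by (simp add: EF H_in span_zero)
  ultimately show ?thesis
    by (cases i) (auto simp only: f_simps(1,2) S11 S21 S31 S32 L11 L21 L31 L32
       intro!: span_neg span_zero span_scale)
qed

end

context g2
begin

sublocale neg: chevalley scale bracket E F H
  using HF EF serre_F by unfold_locales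

sublocale pos: chevalley scale bracket F E "\<lambda>i. - H i"
proof unfold_locales
  fix i j
  show "bracket (- H i) (E j) = scale (- of_int (coroot i (simple_root j))) (E j)"
    by (simp add: bracket_minus_left HE)
  show "bracket (F i) (E j) = (if i = j then - H i else 0)"
    using bracket_anti[of "F i" "E j"] by (simp add: EF)
qed (rule serre_E)

abbreviation root_basis :: "'g set" where
  "root_basis \<equiv> neg.f ` set pos_roots \<union> pos.f ` set pos_roots \<union> range H"

lemma neg_borel_sub: "neg.borel_opp \<subseteq> span root_basis"
  by (rule span_mono) auto

lemma pos_borel_sub: "pos.borel_opp \<subseteq> span root_basis"
proof -
  have "range (\<lambda>i. - H i) \<subseteq> span root_basis" by (intro image_subsetI span_neg span_base) blast
  moreover have "pos.f ` set pos_roots \<subseteq> span root_basis" by (auto intro: span_base)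
  ultimately show ?thesis by (intro span_minimal subspace_span) auto
qed

text \<open>The span of the root vectors and the Cartan subalgebra is stable under the Chevalley
  generators, hence under the algebra that they generate.\<close>

lemma span_root_basis: "span root_basis = UNIV"
proof -
  let ?S = "span root_basis"
  have stable: "bracket x s \<in> ?S" if "x \<in> range E \<union> range F \<union> range H" "s \<in> ?S" for x s
  proof -
    have "bracket x s \<in> ?S" if s: "s \<in> root_basis" for s
    proof -
      have "bracket (E i) s \<in> ?S" "bracket (F i) s \<in> ?S" "bracket (H i) s \<in> ?S" for i
      proof -
        consider \<alpha> where "\<alpha> \<in> set pos_roots" "s = neg.f \<alpha>" | \<alpha> where "\<alpha> \<in> set pos_roots" "s = pos.f \<alpha>"
          | j where "s = H j" using s by blast
        note c = this
        have EE: "E j \<in> ?S" "F j \<in> ?S" for j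
        proof -
          have "E j \<in> pos.f ` set pos_roots" "F j \<in> neg.f ` set pos_roots"
            using pos.f_simps(1,2) neg.f_simps(1,2)
            by (cases j; force simp: pos_roots_def)+
          then show "E j \<in> ?S" "F j \<in> ?S" by (auto intro: span_base)
        qed
        show "bracket (E i) s \<in> ?S"
          using c
        proof cases
          case 3
          then show ?thesis using bracket_anti[of "E i" "H j"] EE by (auto simp: HE intro!: span_neg span_scale)
        qed (use neg.bracket_E_f pos.bracket_F_f neg_borel_sub pos_borel_sub in blast)+
        show "bracket (F i) s \<in> ?S"
          using c
        proof cases
          case 3
          then show ?thesis using bracket_anti[of "F i" "H j"] EE by (auto simp: HF intro!: span_neg span_scale)
        qed (use neg.bracket_F_f pos.bracket_E_f neg_borel_sub pos_borel_sub in blast)+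
        show "bracket (H i) s \<in> ?S"
          using c
        proof cases
          case 1
          then show ?thesis unfolding \<open>s = neg.f \<alpha>\<close> neg.bracket_H_f[OF \<open>\<alpha> \<in> set pos_roots\<close>]
            by (intro span_scale span_base) blast
        next
          case 2
          have "bracket (H i) s = scale (of_int (coroot i \<alpha>)) s"
            using pos.bracket_H_f[OF 2(1), of i] 2 by (simp add: bracket_minus_left)
          then show ?thesis using s by (simp add: span_scale span_base)
        next
          case 3
          then show ?thesis by (simp add: HH span_zero)
        qed
      qed
      then show ?thesis using that \<open>x \<in> range E \<union> range F \<union> range H\<close> by auto
    qed
    then have "root_basis \<subseteq> {s. bracket x s \<in> ?S}" by auto
    then have "?S \<subseteq> {s. bracket x s \<in> ?S}"
      by (rule span_minimal) (rule subspace_bracket_stable[OF subspace_span])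
    with that show ?thesis by auto
  qed
  let ?N = "{x. x \<in> ?S \<and> (\<forall>s\<in>?S. bracket x s \<in> ?S)}"
  have "subalgebra ?N"
    unfolding subalgebra_def
  proof (intro conjI ballI)
    show "subspace ?N"
      unfolding subspace_def
      by (auto simp: bracket_add_left bracket_scale_left intro: span_add span_scale span_zero)
    fix x y assume "x \<in> ?N" "y \<in> ?N"
    moreover have "bracket (bracket x y) s = bracket x (bracket y s) - bracket y (bracket x s)" for s
      using bracket_derivation[of x y s] by simp
    ultimately show "bracket x y \<in> ?N" by (auto intro: span_diff)
  qed
  moreover have "range E \<union> range F \<union> range H \<subseteq> ?S"
  proof -
    have "E j \<in> pos.f ` set pos_roots" "F j \<in> neg.f ` set pos_roots" for j
      using pos.f_simps(1,2) neg.f_simps(1,2)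
      by (cases j; force simp: pos_roots_def)+
    then show ?thesis by (auto intro: span_base)
  qed
  then have "range E \<union> range F \<union> range H \<subseteq> ?N" using stable by auto
  ultimately have "subalgebra hull (range E \<union> range F \<union> range H) \<subseteq> ?N"
    by (intro hull_minimal)
  then show ?thesis using generated by auto
qed

lemma root_space_bracket:
  assumes "x \<in> root_space \<mu>" "y \<in> root_space \<nu>"
  shows "bracket x y \<in> root_space (\<mu> + \<nu>)"
  using assms neg.bracket_H_bracket
  by (simp add: root_space_def coroot_add)

lemma neg_f_root_space: "\<alpha> \<in> set pos_roots \<Longrightarrow> neg.f \<alpha> \<in> root_space (- \<alpha>)"
  by (simp add: root_space_def neg.bracket_H_f coroot_minus)

lemma pos_f_root_space: "\<alpha> \<in> set pos_roots \<Longrightarrow> pos.f \<alpha> \<in> root_space \<alpha>"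
  using pos.bracket_H_f[of \<alpha>] by (simp add: root_space_def bracket_minus_left)

lemma H_root_space: "H i \<in> root_space 0"
  by (auto simp: root_space_def HH zero_prod_def) (metis (full_types) coroot.simps diff_0_right mult_zero_right node.exhaust)

text \<open>The product of the operators \<open>ad (H i) - \<nu> (H i)\<close>, where \<open>i\<close> is chosen to separate \<open>\<nu>\<close>
  from \<open>\<mu>\<close> and \<open>\<nu>\<close> runs through the other weights, is a multiple of the projection to the
  weight space of \<open>\<mu>\<close>.\<close>

lemma root_space_span:
  assumes x: "x \<in> span B" "x \<in> root_space \<mu>"
    and B: "\<And>y. y \<in> B \<Longrightarrow> y \<in> root_space \<mu> \<or> (\<exists>\<nu>\<in>set L. y \<in> root_space \<nu>)"
    and L: "\<mu> \<notin> set L"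
  shows "x \<in> span (B \<inter> root_space \<mu>)"
proof -
  have "\<exists>i. coroot i \<nu> \<noteq> coroot i \<mu>" if "\<nu> \<in> set L" for \<nu>
    using that L coroot_eqI by metis
  then obtain s where s: "\<nu> \<in> set L \<Longrightarrow> coroot (s \<nu>) \<nu> \<noteq> coroot (s \<nu>) \<mu>" for \<nu> by metis
  define P where "P = (\<lambda>L y. foldr (\<lambda>\<nu> y. bracket (H (s \<nu>)) y - scale (of_int (coroot (s \<nu>) \<nu>)) y) L y)"
  have P_add: "P L (y + z) = P L y + P L z" for L y z
    by (induction L) (auto simp: P_def bracket_add_right scale_right_distrib)
  have P_scale: "P L (scale c y) = scale c (P L y)" for L y c
    by (induction L) (auto simp: P_def bracket_scale_right scale_right_diff_distrib mult.commute)
  define q where "q = (\<lambda>L \<xi>. \<Prod>\<nu>\<leftarrow>L. (of_int (coroot (s \<nu>) \<xi>) - of_int (coroot (s \<nu>) \<nu>) :: complex))"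
  have P_weight: "P L y = scale (q L \<xi>) y" if "y \<in> root_space \<xi>" for L y \<xi>
  proof (induction L)
    case (Cons \<nu> L)
    have "P (\<nu> # L) y = bracket (H (s \<nu>)) (P L y) - scale (of_int (coroot (s \<nu>) \<nu>)) (P L y)"
      by (simp add: P_def)
    then show ?case using that
      by (simp add: Cons q_def root_space_def bracket_scale_right mult.commute
          scale_left_diff_distrib algebra_simps)
  qed (simp add: P_def q_def)
  have "q L \<nu> = 0" if "\<nu> \<in> set L" for \<nu> using that by (auto simp: q_def prod_list_zero_iff)
  then have zero: "P L y = 0" if "\<nu> \<in> set L" "y \<in> root_space \<nu>" for \<nu> y using that P_weight by auto
  have nz: "q L \<mu> \<noteq> 0" using s by (fastforce simp: q_def prod_list_zero_iff)
  have "P L y \<in> span (B \<inter> root_space \<mu>)" if "y \<in> span B" for y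
    using that
  proof (induction rule: span_induct_alt)
    case base
    then show ?case using P_scale[of L 0 0] by (simp add: span_zero)
  next
    case (step c y z)
    have "P L y \<in> span (B \<inter> root_space \<mu>)"
      using B[OF step(1)]
    proof
      assume "y \<in> root_space \<mu>"
      then show ?thesis using step(1) by (simp add: P_weight span_scale span_base)
    next
      assume "\<exists>\<nu>\<in>set L. y \<in> root_space \<nu>"
      then show ?thesis using zero by (auto simp: span_zero)
    qed
    then show ?case using step by (simp add: P_add P_scale span_add span_scale)
  qed
  then have "scale (q L \<mu>) x \<in> span (B \<inter> root_space \<mu>)" using x P_weight by metis
  then have "scale (inverse (q L \<mu>)) (scale (q L \<mu>) x) \<in> span (B \<inter> root_space \<mu>)" by (rule span_scale)
  then show ?thesis using nz by simp
qed

lemma root_basis_weights: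
  assumes "y \<in> root_basis"
  shows "\<exists>\<nu>\<in>set (0 # pos_roots @ map uminus pos_roots). y \<in> root_space \<nu>"
proof -
  consider \<alpha> where "\<alpha> \<in> set pos_roots" "y = neg.f \<alpha>" | \<alpha> where "\<alpha> \<in> set pos_roots" "y = pos.f \<alpha>"
    | i where "y = H i" using assms by blast
  then show ?thesis
  proof cases
    case 1
    then show ?thesis using neg_f_root_space[OF 1(1)] by (intro bexI[of _ "- \<alpha>"]) auto
  next
    case 2
    then show ?thesis using pos_f_root_space[OF 2(1)] by (intro bexI[of _ \<alpha>]) auto
  next
    case 3
    then show ?thesis using H_root_space by (intro bexI[of _ 0]) auto
  qed
qed

lemma weight_vector_in_span:
  assumes "x \<in> root_space \<mu>"
  shows "x \<in> span (root_basis \<inter> root_space \<mu>)"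
proof (rule root_space_span)
  show "x \<in> span root_basis" using span_root_basis by simp
  show "\<mu> \<notin> set (filter (\<lambda>\<nu>. \<nu> \<noteq> \<mu>) (0 # pos_roots @ map uminus pos_roots))" by simp
  show "y \<in> root_space \<mu> \<or>
      (\<exists>\<nu>\<in>set (filter (\<lambda>\<nu>. \<nu> \<noteq> \<mu>) (0 # pos_roots @ map uminus pos_roots)). y \<in> root_space \<nu>)"
    if "y \<in> root_basis" for y
    using root_basis_weights[OF that] by auto
qed fact

lemma root_space_unique: "y \<in> root_space \<mu> \<Longrightarrow> y \<in> root_space \<nu> \<Longrightarrow> \<mu> \<noteq> \<nu> \<Longrightarrow> y = 0"
proof (rule ccontr)
  assume *: "y \<in> root_space \<mu>" "y \<in> root_space \<nu>" "\<mu> \<noteq> \<nu>" "y \<noteq> 0"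
  have "coroot i \<mu> = coroot i \<nu>" for i
    using * by (auto simp: root_space_def)
  then show False using * coroot_eqI by blast
qed

lemma neg_root_space_eq:
  assumes \<alpha>: "\<alpha> \<in> set pos_roots" and x: "x \<in> root_space (- \<alpha>)"
  shows "\<exists>c. x = scale c (neg.f \<alpha>)"
proof -
  have "y \<in> {0, neg.f \<alpha>}" if "y \<in> root_basis \<inter> root_space (- \<alpha>)" for y
  proof -
    have y: "y \<in> root_basis" "y \<in> root_space (- \<alpha>)" using that by blast+
    have "- \<alpha> \<notin> set (0 # pos_roots)" "\<alpha> \<noteq> 0" using \<alpha> by (auto simp: pos_roots_def zero_prod_def)
    then show ?thesis
    proof -
      consider \<beta> where "\<beta> \<in> set pos_roots" "y = neg.f \<beta>" | \<beta> where "\<beta> \<in> set pos_roots" "y = pos.f \<beta>"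
        | i where "y = H i" using y(1) by blast
      then show ?thesis
      proof cases
        case 1
        then show ?thesis
          using neg_f_root_space[OF 1(1)] y(2) root_space_unique[of y "- \<alpha>" "- \<beta>"] by (cases "\<alpha> = \<beta>") auto
      next
        case 2
        then have "- \<alpha> \<noteq> \<beta>" using \<open>- \<alpha> \<notin> set (0 # pos_roots)\<close> by auto
        then show ?thesis using pos_f_root_space[OF 2(1)] 2 y(2) root_space_unique[of y "- \<alpha>" \<beta>] by auto
      next
        case 3
        then show ?thesis using H_root_space y(2) \<open>\<alpha> \<noteq> 0\<close> root_space_unique[of y "- \<alpha>" 0] by auto
      qed
    qed
  qed
  then have "root_basis \<inter> root_space (- \<alpha>) \<subseteq> {0, neg.f \<alpha>}" by blast
  then have "span (root_basis \<inter> root_space (- \<alpha>)) \<subseteq> span {neg.f \<alpha>}"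
    using span_mono span_insert_0 by metis
  then show ?thesis using weight_vector_in_span[OF x] by (auto simp: span_singleton)
qed

lemma pos_root_space_eq:
  assumes \<alpha>: "\<alpha> \<in> set pos_roots" and x: "x \<in> root_space \<alpha>"
  shows "\<exists>c. x = scale c (pos.f \<alpha>)"
proof -
  have "y \<in> {0, pos.f \<alpha>}" if "y \<in> root_basis \<inter> root_space \<alpha>" for y
  proof -
    have y: "y \<in> root_basis" "y \<in> root_space (\<alpha>)" using that by blast+
    have "\<alpha> \<notin> uminus ` set pos_roots" "\<alpha> \<noteq> 0" using \<alpha> by (auto simp: pos_roots_def zero_prod_def)
    then show ?thesis
    proof -
      consider \<beta> where "\<beta> \<in> set pos_roots" "y = neg.f \<beta>" | \<beta> where "\<beta> \<in> set pos_roots" "y = pos.f \<beta>"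
        | i where "y = H i" using y(1) by blast
      then show ?thesis
      proof cases
        case 1
        then have "\<alpha> \<noteq> - \<beta>" using \<open>\<alpha> \<notin> uminus ` set pos_roots\<close> by auto
        then show ?thesis using neg_f_root_space[OF 1(1)] 1 y(2) root_space_unique[of y \<alpha> "- \<beta>"] by auto
      next
        case 2
        then show ?thesis
          using pos_f_root_space[OF 2(1)] y(2) root_space_unique[of y \<alpha> \<beta>] by (cases "\<alpha> = \<beta>") auto
      next
        case 3
        then show ?thesis using H_root_space y(2) \<open>\<alpha> \<noteq> 0\<close> root_space_unique[of y \<alpha> 0] by auto
      qed
    qed
  qed
  then have "root_basis \<inter> root_space \<alpha> \<subseteq> {0, pos.f \<alpha>}" by blast
  then have "span (root_basis \<inter> root_space \<alpha>) \<subseteq> span {pos.f \<alpha>}"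
    using span_mono span_insert_0 by metis
  then show ?thesis using weight_vector_in_span[OF x] by (auto simp: span_singleton)
qed

lemma e_root_space: "\<alpha> \<in> roots \<Longrightarrow> e \<alpha> \<in> root_space \<alpha>"
  using root_vector by (simp add: root_space_def)

lemma e_neg:
  assumes "\<alpha> \<in> set pos_roots"
  shows "\<exists>c. c \<noteq> 0 \<and> e (- \<alpha>) = scale c (neg.f \<alpha>)"
proof -
  have r: "- \<alpha> \<in> roots" using assms by (auto simp: roots_def)
  then obtain c where "e (- \<alpha>) = scale c (neg.f \<alpha>)"
    using neg_root_space_eq[OF assms e_root_space] by blast
  then show ?thesis using root_vector[OF r] by (intro exI[of _ c]) auto
qed

lemma E_multiple_e: "\<exists>c. E i = scale c (e (simple_root i))"
proof -
  have \<alpha>: "simple_root i \<in> set pos_roots" by (cases i) (auto simp: pos_roots_def)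
  then have r: "simple_root i \<in> roots" by (auto simp: roots_def)
  obtain c where c: "e (simple_root i) = scale c (pos.f (simple_root i))"
    using pos_root_space_eq[OF \<alpha> e_root_space[OF r]] by blast
  have "pos.f (simple_root i) = E i" by (cases i) (auto simp: pos.f_simps)
  moreover have "c \<noteq> 0" using root_vector[OF r] c by auto
  ultimately show ?thesis using c by (intro exI[of _ "inverse c"]) simp
qed

text \<open>The algebra is graded by the coefficient of \<open>a\<close> modulo 3, and the long roots are those of
  degree zero; hence the subalgebra that their root vectors generate contains no short root vector.\<close>

abbreviation long_basis :: "'g set" where
  "long_basis \<equiv> {y. \<exists>m n. 3 dvd m \<and> y \<in> root_basis \<inter> root_space (m, n)}"

lemma A2_subset: "A2 \<subseteq> span long_basis"
proof -
  have weight: "x \<in> span long_basis" if "x \<in> root_space (m, n)" "3 dvd m" for x m n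
  proof -
    have "root_basis \<inter> root_space (m, n) \<subseteq> long_basis" using that(2) by blast
    then show ?thesis using weight_vector_in_span[OF that(1)] span_mono by blast
  qed
  have br: "bracket x y \<in> span long_basis" if x: "x \<in> long_basis" and y: "y \<in> span long_basis" for x y
  proof -
    have "long_basis \<subseteq> {y. bracket x y \<in> span long_basis}"
    proof
      fix y assume "y \<in> long_basis"
      then obtain m n m' n' where "3 dvd m" "x \<in> root_space (m, n)" "3 dvd m'" "y \<in> root_space (m', n')"
        using x by blast
      then have "bracket x y \<in> root_space (m + m', n + n')" "3 dvd m + m'"
        using root_space_bracket[of x "(m, n)" y "(m', n')"] by auto
      then show "y \<in> {y. bracket x y \<in> span long_basis}" using weight by auto
    qed
    then have "span long_basis \<subseteq> {y. bracket x y \<in> span long_basis}"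
      by (rule span_minimal) (rule subspace_bracket_stable[OF subspace_span])
    then show ?thesis using y by blast
  qed
  have "subalgebra (span long_basis)"
    unfolding subalgebra_def
  proof (intro conjI ballI subspace_span)
    fix x y assume x: "x \<in> span long_basis" and y: "y \<in> span long_basis"
    have "subspace {x. bracket x y \<in> span long_basis}"
      unfolding subspace_def
      by (auto simp: bracket_add_left bracket_scale_left intro: span_add span_scale span_zero)
    then have "span long_basis \<subseteq> {x. bracket x y \<in> span long_basis}"
      using br[OF _ y] by (intro span_minimal subsetI CollectI)
    then show "bracket x y \<in> span long_basis" using x by blast
  qed
  moreover have "e ` long_roots \<subseteq> span long_basis"
  proof
    fix x assume "x \<in> e ` long_roots"
    then obtain \<alpha> where \<alpha>: "\<alpha> \<in> long_roots" "x = e \<alpha>" by blast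
    then have "\<alpha> \<in> roots" "3 dvd fst \<alpha>" by (auto simp: roots_def long_roots_def pos_roots_def)
    then show "x \<in> span long_basis" using weight[of x "fst \<alpha>" "snd \<alpha>"] e_root_space \<alpha> by auto
  qed
  ultimately show ?thesis unfolding A2_def by (intro hull_minimal)
qed

lemma A2_short:
  assumes "x \<in> A2" "x \<in> root_space (- \<alpha>)" "\<not> 3 dvd fst \<alpha>"
  shows "x = 0"
proof -
  let ?L = "filter (\<lambda>\<nu>. \<nu> \<noteq> - \<alpha>) (0 # pos_roots @ map uminus pos_roots)"
  have "x \<in> span (long_basis \<inter> root_space (- \<alpha>))"
  proof (rule root_space_span)
    show "x \<in> span long_basis" using assms A2_subset by blast
    show "- \<alpha> \<notin> set ?L" by simp
    show "y \<in> root_space (- \<alpha>) \<or> (\<exists>\<nu>\<in>set ?L. y \<in> root_space \<nu>)" if "y \<in> long_basis" for y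
    proof -
      have "y \<in> root_basis" using that by blast
      then show ?thesis using root_basis_weights[of y] by auto
    qed
  qed fact
  moreover have "long_basis \<inter> root_space (- \<alpha>) \<subseteq> {0}"
  proof
    fix y assume "y \<in> long_basis \<inter> root_space (- \<alpha>)"
    then obtain m n where *: "3 dvd m" "y \<in> root_space (m, n)" "y \<in> root_space (- \<alpha>)" by blast
    then have "(m, n) \<noteq> - \<alpha>" using assms(3) by (cases \<alpha>) auto
    then show "y \<in> {0}" using * root_space_unique by blast
  qed
  ultimately have "x \<in> span {0}" using span_mono by blast
  then show ?thesis by simp
qed

lemma e_in_A2: "\<alpha> \<in> long_roots \<Longrightarrow> e \<alpha> \<in> A2"
  unfolding A2_def by (rule hull_inc) blast

end

section \<open>Words in the lowering operators\<close>

context vector_space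
begin

text \<open>Eigenvectors for different eigenvalues are independent. Applying \<open>A - c a\<close> to a vanishing
  sum removes the summand of \<open>a\<close> and rescales the others.\<close>

lemma eigenvectors_sum_zero:
  assumes "finite I"
    and M: "subspace M"
    and A_add: "\<And>x y. x \<in> M \<Longrightarrow> y \<in> M \<Longrightarrow> A (x + y) = A x + A y"
    and A_scale: "\<And>x k. x \<in> M \<Longrightarrow> A (scale k x) = scale k (A x)"
    and "inj_on c I"
    and "\<And>n. n \<in> I \<Longrightarrow> u n \<in> M \<and> A (u n) = scale (c n) (u n)"
    and "(\<Sum>n\<in>I. u n) = 0"
    and "n \<in> I"
  shows "u n = 0"
  using assms(1,5-)
proof (induction I arbitrary: u n rule: finite_induct)
  case (insert a I)
  have A0: "A 0 = 0" using A_scale[of 0 0] M by (simp add: subspace_0)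
  have A_sum: "A (\<Sum>n\<in>J. u n) = (\<Sum>n\<in>J. A (u n))" if "finite J" "J \<subseteq> insert a I" for J
    using that
  proof (induction J rule: finite_induct)
    case (insert b J)
    then have "u b \<in> M" "(\<Sum>n\<in>J. u n) \<in> M" using insert.prems \<open>\<And>n. n \<in> insert _ _ \<Longrightarrow> u n \<in> M \<and> _\<close>
      by (auto intro!: subspace_sum M)
    then show ?case using insert by (simp add: A_add)
  qed (simp add: A0)
  have "(\<Sum>n\<in>I. scale (c n - c a) (u n)) = (\<Sum>n\<in>insert a I. scale (c n - c a) (u n))"
    using insert(1,2) by simp
  also have "\<dots> = (\<Sum>n\<in>insert a I. A (u n) - scale (c a) (u n))"
    by (rule sum.cong) (use insert.prems(2) in \<open>auto simp: scale_left_diff_distrib\<close>)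
  also have "\<dots> = A (\<Sum>n\<in>insert a I. u n) - scale (c a) (\<Sum>n\<in>insert a I. u n)"
    using insert(1) by (subst A_sum) (auto simp: sum_subtractf scale_sum_right)
  also have "\<dots> = 0" using insert.prems(3) A0 by simp
  finally have z: "(\<Sum>n\<in>I. scale (c n - c a) (u n)) = 0" .
  have "scale (c n - c a) (u n) = 0" if "n \<in> I" for n
  proof (rule insert.IH[where u = "\<lambda>n. scale (c n - c a) (u n)", OF _ _ z that])
    show "inj_on c I" using insert.prems(1) by simp
    show "scale (c m - c a) (u m) \<in> M \<and> A (scale (c m - c a) (u m)) = scale (c m) (scale (c m - c a) (u m))"
      if "m \<in> I" for m
      using insert.prems(2)[of m] that M by (simp add: subspace_scale A_scale mult.commute)
  qed
  moreover have "c n \<noteq> c a" if "n \<in> I" for n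
    using insert.prems(1) insert(2) that by (auto simp: inj_on_def)
  ultimately have I: "u n = 0" if "n \<in> I" for n using that by auto
  moreover have "u a = 0" using insert.prems(3) insert(1,2) I by simp
  ultimately show ?case using insert.prems(4) by auto
qed simp

text \<open>Otherwise the vectors would form an infinite independent family.\<close>

lemma eigenvector_sequence_vanishes:
  fixes u :: "nat \<Rightarrow> 'b"
  assumes B: "finite B" "M = span B"
    and A_add: "\<And>x y. x \<in> M \<Longrightarrow> y \<in> M \<Longrightarrow> A (x + y) = A x + A y"
    and A_scale: "\<And>x k. x \<in> M \<Longrightarrow> A (scale k x) = scale k (A x)"
    and "inj c"
    and u: "\<And>n. u n \<in> M \<and> A (u n) = scale (c n) (u n)"
  shows "\<exists>n. u n = 0"
proof (rule ccontr)
  assume nz: "\<nexists>n. u n = 0"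
  have "inj u"
  proof (rule injI)
    fix m n assume "u m = u n"
    then have "scale (c m) (u n) = scale (c n) (u n)" using u by metis
    then show "m = n" using nz \<open>inj c\<close> by (metis injD scale_right_imp_eq)
  qed
  have "independent (range u)"
    unfolding dependent_explicit
  proof clarify
    fix t k y
    assume t: "finite t" "t \<subseteq> range u" "(\<Sum>v\<in>t. scale (k v) v) = 0" "y \<in> t" "k y \<noteq> 0"
    have "scale (k y) y = 0"
    proof (rule eigenvectors_sum_zero[where I = t and u = "\<lambda>v. scale (k v) v" and c = "\<lambda>v. c (inv u v)"])
      show "subspace M" using B by simp
      show "inj_on (\<lambda>v. c (inv u v)) t"
        using t(2) \<open>inj u\<close> \<open>inj c\<close> by (auto simp: inj_on_def inj_def subset_iff image_iff) (metis inv_f_f \<open>inj u\<close>)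
      show "scale (k v) v \<in> M \<and> A (scale (k v) v) = scale (c (inv u v)) (scale (k v) v)" if "v \<in> t" for v
      proof -
        obtain j where "v = u j" using \<open>v \<in> t\<close> t(2) by auto
        then show ?thesis using u[of j] \<open>inj u\<close> B by (simp add: A_scale span_scale mult.commute)
      qed
    qed (use A_add A_scale t in auto)
    then show False using nz t(2,4,5) by auto
  qed
  moreover have "range u \<subseteq> span B" using u B by auto
  ultimately have "finite (range u)" using independent_span_bound[OF B(1)] by blast
  then show False using \<open>inj u\<close> by (simp add: finite_image_iff)
qed

end

definition weight_of :: "node list \<Rightarrow> weight" where
  "weight_of w = (\<Sum>i\<leftarrow>w. simple_root i)"

lemma weight_of_simps [simp]: "weight_of [] = 0" "weight_of (i # w) = simple_root i + weight_of w"
  by (simp_all add: weight_of_def)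

text \<open>Formal combinations of words are lists of pairs. The action of the raising operators on
  words applied to a vector of highest weight \<open>lam\<close> depends on \<open>lam\<close> alone, so it can be written
  down once for all modules.\<close>

type_synonym combination = "(complex \<times> node list) list"

fun contract :: "weight \<Rightarrow> node \<Rightarrow> node list \<Rightarrow> combination" where
  "contract lam i [] = []"
| "contract lam i (j # w) =
     (if i = j then [(of_int (coroot i (lam - weight_of w)), w)] else []) @
     map (\<lambda>(c, w'). (c, j # w')) (contract lam i w)"

definition raise :: "weight \<Rightarrow> node \<Rightarrow> combination \<Rightarrow> combination" where
  "raise lam i u = concat (map (\<lambda>(c, w). map (\<lambda>(c', w'). (c * c', w')) (contract lam i w)) u)"

definition vacuum :: "combination \<Rightarrow> complex" where
  "vacuum u = (\<Sum>(c, w)\<leftarrow>u. if w = [] then c else 0)"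

locale highest_weight_operators = vector_space sc
  for sc :: "complex \<Rightarrow> 'v::ab_group_add \<Rightarrow> 'v" +
  fixes M :: "'v set" and Eo Fo Ho :: "node \<Rightarrow> 'v \<Rightarrow> 'v" and v0 :: 'v and lam :: weight
  assumes M: "subspace M" and v0: "v0 \<in> M"
    and E_add: "x \<in> M \<Longrightarrow> y \<in> M \<Longrightarrow> Eo i (x + y) = Eo i x + Eo i y"
    and E_scale: "x \<in> M \<Longrightarrow> Eo i (sc c x) = sc c (Eo i x)"
    and F_closed: "x \<in> M \<Longrightarrow> Fo i x \<in> M"
    and F_add: "x \<in> M \<Longrightarrow> y \<in> M \<Longrightarrow> Fo i (x + y) = Fo i x + Fo i y"
    and F_scale: "x \<in> M \<Longrightarrow> Fo i (sc c x) = sc c (Fo i x)"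
    and H_add: "x \<in> M \<Longrightarrow> y \<in> M \<Longrightarrow> Ho i (x + y) = Ho i x + Ho i y"
    and H_scale: "x \<in> M \<Longrightarrow> Ho i (sc c x) = sc c (Ho i x)"
    and E_F: "x \<in> M \<Longrightarrow> Eo i (Fo j x) = Fo j (Eo i x) + (if i = j then Ho i x else 0)"
    and H_F: "x \<in> M \<Longrightarrow> Ho i (Fo j x) = Fo j (Ho i x) - sc (of_int (coroot i (simple_root j))) (Fo j x)"
    and E_v0: "Eo i v0 = 0"
    and H_v0: "Ho i v0 = sc (of_int (coroot i lam)) v0"
begin

definition word :: "node list \<Rightarrow> 'v" where
  "word w = foldr Fo w v0"

definition comb :: "combination \<Rightarrow> 'v" where
  "comb u = (\<Sum>(c, w)\<leftarrow>u. sc c (word w))"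

lemma word_simps [simp]: "word [] = v0" "word (i # w) = Fo i (word w)"
  by (simp_all add: word_def)

lemma comb_simps [simp]:
  "comb [] = 0" "comb ((c, w) # u) = sc c (word w) + comb u" "comb (u @ u') = comb u + comb u'"
  by (simp_all add: comb_def)

lemma word_in: "word w \<in> M"
  by (induction w) (auto simp: v0 F_closed)

lemma comb_in: "comb u \<in> M"
  by (induction u) (auto simp: subspace_0 subspace_add subspace_scale M word_in)

lemma op_zero: "Eo i 0 = 0" "Fo i 0 = 0" "Ho i 0 = 0"
  using E_scale[of 0 i 0] F_scale[of 0 i 0] H_scale[of 0 i 0] subspace_0[OF M] by auto

lemma H_word: "Ho i (word w) = sc (of_int (coroot i (lam - weight_of w))) (word w)"
proof (induction w)
  case (Cons j w)
  have "Fo j (Ho i (word w)) = sc (of_int (coroot i (lam - weight_of w))) (Fo j (word w))"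
    by (simp only: Cons F_scale word_in)
  then show ?case
    by (simp add: H_F word_in coroot_diff coroot_add scale_left_diff_distrib scale_left_distrib)
qed (simp add: H_v0)

lemma comb_scaled: "comb (map (\<lambda>(c, w). (k * c, w)) u) = sc k (comb u)"
  by (induction u) (auto simp: scale_right_distrib)

lemma F_comb: "Fo i (comb u) = comb (map (\<lambda>(c, w). (c, i # w)) u)"
  by (induction u) (auto simp: op_zero F_add F_scale comb_in word_in subspace_scale M)

lemma H_comb: "Ho i (comb u) = comb (map (\<lambda>(c, w). (c * of_int (coroot i (lam - weight_of w)), w)) u)"
  by (induction u) (auto simp: op_zero H_add H_scale H_word comb_in word_in subspace_scale M)

lemma E_word: "Eo i (word w) = comb (contract lam i w)"
proof (induction w)
  case (Cons j w)
  then show ?case by (simp add: E_F word_in F_comb H_word)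
qed (simp add: E_v0)

lemma E_comb: "Eo i (comb u) = comb (raise lam i u)"
  by (induction u)
     (auto simp: raise_def op_zero E_add E_scale comb_in word_in subspace_scale M E_word comb_scaled)

text \<open>The operator \<open>3 H Short + 5 H Long\<close> has eigenvalue \<open>m + n\<close> on the weight \<open>m a + n b\<close>;
  hence it separates words by their lengths.\<close>

abbreviation height :: "'v \<Rightarrow> 'v" where
  "height x \<equiv> sc 3 (Ho Short x) + sc 5 (Ho Long x)"

lemma fst_plus_snd: "3 * coroot Short \<mu> + 5 * coroot Long \<mu> = fst \<mu> + snd \<mu>"
  by (cases \<mu>) simp

lemma fst_plus_snd_weight_of: "fst (weight_of w) + snd (weight_of w) = int (length w)"
proof (induction w)
  case (Cons i w)
  then show ?case by (cases i) auto
qed simp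

lemma height_word:
  "height (word w) = sc (of_int (fst lam + snd lam) - of_nat (length w)) (word w)"
proof -
  have "height (word w) = sc (of_int (3 * coroot Short (lam - weight_of w) + 5 * coroot Long (lam - weight_of w))) (word w)"
    by (simp add: H_word scale_left_distrib)
  also have "3 * coroot Short (lam - weight_of w) + 5 * coroot Long (lam - weight_of w) = fst lam + snd lam - int (length w)"
    by (simp add: fst_plus_snd fst_plus_snd_weight_of[symmetric])
  finally show ?thesis by simp
qed

lemma height_add: "x \<in> M \<Longrightarrow> y \<in> M \<Longrightarrow> height (x + y) = height x + height y"
  by (simp add: H_add scale_right_distrib algebra_simps)

lemma height_scale: "x \<in> M \<Longrightarrow> height (sc k x) = sc k (height x)"
  by (simp add: H_scale scale_right_distrib mult.commute)

text \<open>The summand of the empty word is the component of \<open>comb u\<close> of greatest height, and components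
  of different heights are independent.\<close>

lemma vacuum_zero:
  assumes "v0 \<noteq> 0" "comb u = 0"
  shows "vacuum u = 0"
proof -
  define U where "U = (\<lambda>n. comb (filter (\<lambda>(c, w). length w = n) u))"
  have "comb u = (\<Sum>n\<in>insert 0 (length ` snd ` set u). U n)"
  proof -
    have "comb u = (\<Sum>n\<in>I. comb (filter (\<lambda>(c, w). length w = n) u))"
      if "length ` snd ` set u \<subseteq> I" "finite I" for I u
      using that
    proof (induction u)
      case (Cons p u)
      obtain c w where p: "p = (c, w)" by (cases p)
      have "(\<Sum>n\<in>I. comb (filter (\<lambda>(c, w). length w = n) (p # u))) =
          (\<Sum>n\<in>I. (if length w = n then sc c (word w) else 0) + comb (filter (\<lambda>(c, w). length w = n) u))"
        by (rule sum.cong) (auto simp: p)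
      also have "\<dots> = sc c (word w) + comb u"
        using Cons p by (subst sum.distrib) auto
      finally show ?case by (simp add: p)
    qed simp
    then show ?thesis unfolding U_def by (metis (no_types, lifting) finite_imageI finite_insert finite_set subset_insertI)
  qed
  then have "(\<Sum>n\<in>insert 0 (length ` snd ` set u). U n) = 0" using assms(2) by simp
  moreover have "height (U n) = sc (of_int (fst lam + snd lam) - of_nat n) (U n)" for n
    unfolding U_def
  proof (induction u)
    case (Cons p u)
    obtain c w where p: "p = (c, w)" by (cases p)
    show ?case
    proof (cases "length w = n")
      case True
      have "height (sc c (word w) + comb (filter (\<lambda>(c, w). length w = n) u)) =
        height (sc c (word w)) + height (comb (filter (\<lambda>(c, w). length w = n) u))"
        by (intro height_add subspace_scale M word_in comb_in)
      then show ?thesis using True Cons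
        by (simp add: p height_scale[OF word_in] height_word scale_right_distrib mult.commute)
    qed (use Cons p in simp)
  qed (simp add: op_zero)
  ultimately have "U 0 = 0"
    by (intro eigenvectors_sum_zero[where I = "insert 0 (length ` snd ` set u)" and M = M
          and A = height and c = "\<lambda>n. of_int (fst lam + snd lam) - of_nat n" and u = U])
       (auto simp: M height_add height_scale inj_on_def U_def comb_in)
  moreover have "U 0 = sc (vacuum u) v0"
    unfolding U_def vacuum_def by (induction u) (auto simp: scale_left_distrib)
  ultimately show ?thesis using assms(1) by simp
qed

end

section \<open>Irreducible highest weight modules\<close>

locale highest_weight_module =
  g2 scale bracket E F H e + lie_module scale bracket scaleV M act
  for scale :: "complex \<Rightarrow> 'g::ab_group_add \<Rightarrow> 'g"
    and bracket :: "'g \<Rightarrow> 'g \<Rightarrow> 'g"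
    and E F H :: "node \<Rightarrow> 'g"
    and e :: "weight \<Rightarrow> 'g"
    and scaleV :: "complex \<Rightarrow> 'v::ab_group_add \<Rightarrow> 'v"
    and M :: "'v set"
    and act :: "'g \<Rightarrow> 'v \<Rightarrow> 'v" +
  fixes v0 :: 'v and lam :: weight
  assumes irreducible: "irreducible_module"
    and v0_in: "v0 \<in> M" and v0_nonzero: "v0 \<noteq> 0"
    and H_act_v0: "act (H i) v0 = scaleV (of_int (coroot i lam)) v0"
    and E_act_v0: "act (E i) v0 = 0"
begin

lemma subspace_M: "V.subspace M"
  using finite_dimensional by auto

lemma minus_act: "m \<in> M \<Longrightarrow> act (- x) m = - act x m"
  using scale_act[of m "-1" x] by simp

sublocale ops: highest_weight_operators scaleV M "\<lambda>i. act (E i)" "\<lambda>i. act (F i)" "\<lambda>i. act (H i)" v0 lam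
proof unfold_locales
  fix x i j assume x: "x \<in> M"
  show "act (E i) (act (F j) x) = act (F j) (act (E i) x) + (if i = j then act (H i) x else 0)"
  proof -
    have "act 0 x = 0" using scale_act[OF x, of 0 0] by simp
    then show ?thesis using bracket_act[OF x, of "E i" "F j"] by (auto simp: EF algebra_simps)
  qed
  show "act (H i) (act (F j) x) =
      act (F j) (act (H i) x) - scaleV (of_int (coroot i (simple_root j))) (act (F j) x)"
    using bracket_act[OF x, of "H i" "F j"]
    by (simp add: HF minus_act scale_act x algebra_simps)
qed (auto simp: subspace_M v0_in act_add act_scale act_closed H_act_v0 E_act_v0)

lemma act_zero [simp]: "act x 0 = 0"
  using act_scale[OF v0_in, of x 0] by simp

lemma act_pow_closed: "m \<in> M \<Longrightarrow> (act x ^^ n) m \<in> M"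
  by (induction n) (auto simp: act_closed)

lemma act_pow_add: "m \<in> M \<Longrightarrow> m' \<in> M \<Longrightarrow> (act x ^^ n) (m + m') = (act x ^^ n) m + (act x ^^ n) m'"
  by (induction n) (auto simp: act_add act_pow_closed)

lemma act_pow_scale: "m \<in> M \<Longrightarrow> (act x ^^ n) (scaleV c m) = scaleV c ((act x ^^ n) m)"
  by (induction n) (auto simp: act_scale act_pow_closed)

lemma act_pow_zero [simp]: "(act x ^^ n) 0 = 0"
  by (induction n) auto

lemma act_stable_subalgebra:
  assumes "V.subspace W" "W \<subseteq> M"
  shows "subalgebra {x. \<forall>w\<in>W. act x w \<in> W}"
  unfolding subalgebra_def subspace_def
proof (intro conjI ballI allI)
  have "act 0 w = 0" if "w \<in> W" for w using scale_act[of w 0 0] assms that by auto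
  then show "0 \<in> {x. \<forall>w\<in>W. act x w \<in> W}" using assms by (auto simp: V.subspace_0)
next
  fix x y c assume x: "x \<in> {x. \<forall>w\<in>W. act x w \<in> W}" and y: "y \<in> {x. \<forall>w\<in>W. act x w \<in> W}"
  show "x + y \<in> {x. \<forall>w\<in>W. act x w \<in> W}"
  proof clarify
    fix w assume w: "w \<in> W"
    then have "w \<in> M" using assms by blast
    then show "act (x + y) w \<in> W" using x y w assms by (simp add: add_act V.subspace_add)
  qed
  show "bracket x y \<in> {x. \<forall>w\<in>W. act x w \<in> W}"
  proof clarify
    fix w assume w: "w \<in> W"
    then have "w \<in> M" using assms by blast
    then show "act (bracket x y) w \<in> W" using x y w assms by (simp add: bracket_act V.subspace_diff)
  qed
next
  fix x c assume x: "x \<in> {x. \<forall>w\<in>W. act x w \<in> W}"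
  show "scale c x \<in> {x. \<forall>w\<in>W. act x w \<in> W}"
  proof clarify
    fix w assume w: "w \<in> W"
    then have "w \<in> M" using assms by blast
    then show "act (scale c x) w \<in> W" using x w assms by (simp add: scale_act V.subspace_scale)
  qed
qed

text \<open>The combinations of words are stable under raising as well as lowering, hence form a nonzero
  submodule.\<close>

lemma spanned_by_words: "M = range ops.comb"
proof -
  let ?W = "range ops.comb"
  have sub: "?W \<subseteq> M" using ops.comb_in by auto
  have W: "V.subspace ?W"
    unfolding V.subspace_def
  proof (intro conjI ballI allI)
    show "0 \<in> ?W" by (rule range_eqI[of _ _ "[]"]) simp
    show "x + y \<in> ?W" if "x \<in> ?W" "y \<in> ?W" for x y
    proof -
      obtain u u' where "x = ops.comb u" "y = ops.comb u'" using \<open>x \<in> ?W\<close> \<open>y \<in> ?W\<close> by blast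
      then show ?thesis by (intro range_eqI[of _ _ "u @ u'"]) simp
    qed
    show "scaleV c x \<in> ?W" if "x \<in> ?W" for c x
    proof -
      obtain u where "x = ops.comb u" using \<open>x \<in> ?W\<close> by blast
      then show ?thesis by (intro range_eqI[of _ _ "map (\<lambda>(k, w). (c * k, w)) u"]) (simp add: ops.comb_scaled)
    qed
  qed
  have "range E \<union> range F \<union> range H \<subseteq> {x. \<forall>w\<in>?W. act x w \<in> ?W}"
    using ops.E_comb ops.F_comb ops.H_comb by auto
  then have "subalgebra hull (range E \<union> range F \<union> range H) \<subseteq> {x. \<forall>w\<in>?W. act x w \<in> ?W}"
    by (intro hull_minimal act_stable_subalgebra W sub)
  then have "\<forall>x. \<forall>w\<in>?W. act x w \<in> ?W" using generated by auto
  then have "?W = {0} \<or> ?W = M" using irreducible W sub unfolding irreducible_module_def by blast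
  moreover have "v0 \<in> ?W"
  proof -
    show ?thesis by (rule range_eqI[of _ _ "[(1, [])]"]) simp
  qed
  ultimately show ?thesis using v0_nonzero by auto
qed

lemma E_act_F_power:
  "act (E i) ((act (F i) ^^ Suc n) v0) =
    scaleV (of_nat (Suc n) * (of_int (coroot i lam) - of_nat n)) ((act (F i) ^^ n) v0)"
proof (induction n)
  case 0
  then show ?case using ops.E_F[OF v0_in, of i i] by (simp add: E_act_v0 H_act_v0)
next
  case (Suc n)
  have w: "ops.word (replicate k i) = (act (F i) ^^ k) v0" for k
    by (induction k) auto
  have c: "coroot i (weight_of (replicate k i)) = 2 * int k" for k
    by (induction k) (cases i; auto simp: coroot_add zero_prod_def)+
  have H: "act (H i) ((act (F i) ^^ Suc n) v0) =
      scaleV (of_int (coroot i lam) - 2 * of_nat (Suc n)) ((act (F i) ^^ Suc n) v0)"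
    using ops.H_word[of i "replicate (Suc n) i"] unfolding w coroot_diff c by simp
  have "act (E i) ((act (F i) ^^ Suc (Suc n)) v0) =
      act (F i) (act (E i) ((act (F i) ^^ Suc n) v0)) + act (H i) ((act (F i) ^^ Suc n) v0)"
    using ops.E_F[OF act_pow_closed[OF v0_in, where x = "F i" and n = "Suc n"], of i i] by simp
  also have "act (F i) (act (E i) ((act (F i) ^^ Suc n) v0)) =
      scaleV (of_nat (Suc n) * (of_int (coroot i lam) - of_nat n)) ((act (F i) ^^ Suc n) v0)"
    unfolding Suc by (simp add: act_scale act_pow_closed v0_in)
  finally show ?case unfolding H V.scale_left_distrib[symmetric] by (simp add: algebra_simps)
qed

text \<open>Otherwise no power of \<open>F i\<close> would kill the highest weight vector, giving infinitely many
  heights.\<close>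

lemma F_power_zero:
  assumes k: "coroot i lam = int k" and "k < n"
  shows "(act (F i) ^^ n) v0 = 0"
proof -
  have step: "(act (F i) ^^ n) v0 = 0" if "(act (F i) ^^ Suc n) v0 = 0" "n > k" for n
  proof -
    have "scaleV (of_nat (Suc n) * (of_int (coroot i lam) - of_nat n)) ((act (F i) ^^ n) v0) = 0"
      using E_act_F_power[of i n] that by simp
    moreover have "of_nat (Suc n) * (of_int (coroot i lam) - of_nat n) \<noteq> (0 :: complex)"
      using that(2) k by (simp del: of_nat_Suc)
    ultimately show ?thesis by simp
  qed
  obtain B where B: "finite B" "M = V.span B" using finite_dimensional by blast
  have w: "ops.word (replicate n i) = (act (F i) ^^ n) v0" for n
    by (induction n) auto
  have "\<exists>n. (act (F i) ^^ n) v0 = 0"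
  proof (rule V.eigenvector_sequence_vanishes[OF B, of ops.height "\<lambda>n. of_int (fst lam + snd lam) - of_nat n"])
    show "(act (F i) ^^ n) v0 \<in> M \<and> ops.height ((act (F i) ^^ n) v0) =
       scaleV (of_int (fst lam + snd lam) - of_nat n) ((act (F i) ^^ n) v0)" for n
      using ops.height_word[of "replicate n i"] ops.word_in[of "replicate n i"] unfolding w by simp
  qed (auto simp: ops.height_add ops.height_scale inj_def)
  then obtain m where "(act (F i) ^^ m) v0 = 0" by blast
  then have "(act (F i) ^^ (m + n)) v0 = 0" unfolding add.commute[of m n] funpow_add by simp
  moreover have "(act (F i) ^^ n) v0 = 0" if "(act (F i) ^^ (j + n)) v0 = 0" for j
    using that by (induction j) (use step \<open>k < n\<close> in auto)
  ultimately show ?thesis by blast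
qed

text \<open>A negative root vector lowers the height, and on each word only finitely many heights occur.\<close>

lemma negative_root_nilpotent:
  assumes \<alpha>: "\<alpha> \<in> set pos_roots" and x: "x \<in> root_space (- \<alpha>)" and "m \<in> M"
  shows "\<exists>N. \<forall>n\<ge>N. (act x ^^ n) m = 0"
proof -
  have le: "\<forall>n\<ge>N. (act x ^^ n) y = 0" if "(act x ^^ N) y = 0" for N y
  proof clarify
    fix n :: nat assume "N \<le> n"
    then have "(act x ^^ n) y = (act x ^^ (n - N)) ((act x ^^ N) y)"
      by (metis comp_apply funpow_add le_add_diff_inverse2)
    then show "(act x ^^ n) y = 0" using that by simp
  qed
  obtain B where B: "finite B" "M = V.span B" using finite_dimensional by blast
  define h where "h = fst \<alpha> + snd \<alpha>"
  have "h > 0" using \<alpha> by (auto simp: pos_roots_def h_def)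
  have shift: "ops.height (act x y) = act x (ops.height y) - scaleV (of_int h) (act x y)" if "y \<in> M" for y
  proof -
    have H: "act (H i) (act x y) = act x (act (H i) y) - scaleV (of_int (coroot i \<alpha>)) (act x y)" for i
    proof -
      have "bracket (H i) x = scale (- of_int (coroot i \<alpha>)) x"
        using x by (simp add: root_space_def coroot_minus)
      then show ?thesis using bracket_act[OF that, of "H i" x]
        by (simp add: minus_act scale_act that algebra_simps)
    qed
    have "(of_int h :: complex) = 3 * of_int (coroot Short \<alpha>) + 5 * of_int (coroot Long \<alpha>)"
      unfolding h_def using ops.fst_plus_snd[of \<alpha>] by (metis of_int_add of_int_mult of_int_numeral)
    then show ?thesis unfolding H
      by (simp add: act_add act_scale act_closed that subspace_M V.subspace_scale V.scale_right_diff_distrib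
         V.scale_left_distrib)
  qed
  have word: "\<exists>N. (act x ^^ N) (ops.word w) = 0" for w
  proof (rule V.eigenvector_sequence_vanishes[OF B, of ops.height
        "\<lambda>n. of_int (fst lam + snd lam) - of_nat (length w) - of_nat n * of_int h"])
    fix n
    show "(act x ^^ n) (ops.word w) \<in> M \<and> ops.height ((act x ^^ n) (ops.word w)) =
      scaleV (of_int (fst lam + snd lam) - of_nat (length w) - of_nat n * of_int h) ((act x ^^ n) (ops.word w))"
    proof (induction n)
      case 0
      then show ?case using ops.height_word ops.word_in by simp
    next
      case (Suc n)
      let ?y = "(act x ^^ n) (ops.word w)"
      have y: "?y \<in> M" using Suc by blast
      have "ops.height (act x ?y) = act x (ops.height ?y) - scaleV (of_int h) (act x ?y)"
        by (rule shift[OF y])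
      also have "act x (ops.height ?y) =
         scaleV (of_int (fst lam + snd lam) - of_nat (length w) - of_nat n * of_int h) (act x ?y)"
        using Suc y by (metis act_scale)
      finally show ?case using y
        by (simp add: act_closed V.scale_left_diff_distrib[symmetric] algebra_simps)
    qed
  qed (use \<open>h > 0\<close> in \<open>auto simp: ops.height_add ops.height_scale inj_def\<close>)
  obtain u where "m = ops.comb u" using \<open>m \<in> M\<close> spanned_by_words by auto
  moreover have "\<exists>N. \<forall>n\<ge>N. (act x ^^ n) (ops.comb u) = 0" for u
  proof (induction u)
    case (Cons p u)
    obtain c w where p: "p = (c, w)" by (cases p)
    obtain N where N: "\<forall>n\<ge>N. (act x ^^ n) (ops.comb u) = 0" using Cons by blast
    obtain N' where N': "\<forall>n\<ge>N'. (act x ^^ n) (ops.word w) = 0" using word le by metis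
    show ?case
    proof (intro exI allI impI)
      fix n assume "max N N' \<le> n"
      then show "(act x ^^ n) (ops.comb (p # u)) = 0"
        using N N' by (simp add: p act_pow_add act_pow_scale ops.word_in ops.comb_in subspace_M V.subspace_scale)
    qed
  qed simp
  ultimately show ?thesis by blast
qed

end

section \<open>Functionals invariant under the long negative roots\<close>

locale invariant_functional = highest_weight_module +
  fixes \<omega> :: "'b \<Rightarrow> complex"
  assumes \<omega>_add: "x \<in> M \<Longrightarrow> y \<in> M \<Longrightarrow> \<omega> (x + y) = \<omega> x + \<omega> y"
    and \<omega>_scale: "x \<in> M \<Longrightarrow> \<omega> (scaleV c x) = c * \<omega> x"
    and \<omega>_long: "\<alpha> \<in> {(3, 2), (3, 1), (0, 1)} \<Longrightarrow> x \<in> M \<Longrightarrow> \<omega> (act (neg.f \<alpha>) x) = 0"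
begin

abbreviation "fs \<equiv> act (F Short)"
abbreviation "fl \<equiv> act (F Long)"
abbreviation "f11 \<equiv> act (neg.f (1, 1))"
abbreviation "f21 \<equiv> act (neg.f (2, 1))"
abbreviation "f31 \<equiv> act (neg.f (3, 1))"
abbreviation "f32 \<equiv> act (neg.f (3, 2))"

lemma \<omega>_kill [simp]:
  "x \<in> M \<Longrightarrow> \<omega> (fl x) = 0" "x \<in> M \<Longrightarrow> \<omega> (f31 x) = 0" "x \<in> M \<Longrightarrow> \<omega> (f32 x) = 0"
  using \<omega>_long[of "(0, 1)" x] by (simp_all add: \<omega>_long neg.f_simps(2))

lemma commute:
  assumes "bracket x y = z" "m \<in> M"
  shows "act x (act y m) = act y (act x m) + act z m"
  using bracket_act[OF assms(2), of x y] assms by (simp add: algebra_simps)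

lemma commute0:
  assumes "bracket x y = 0" "m \<in> M"
  shows "act x (act y m) = act y (act x m)"
proof -
  have "act 0 m = 0" using scale_act[OF assms(2), of 0 0] by simp
  then show ?thesis using commute[OF assms] by simp
qed

lemma commute_pow:
  assumes "bracket x y = 0" "m \<in> M"
  shows "(act x ^^ n) (act y m) = act y ((act x ^^ n) m)"
  by (induction n) (auto simp: commute0[OF assms(1)] act_pow_closed assms(2))

lemma central:
  assumes "bracket (neg.f (2, 1)) y = 0" "bracket (neg.f (1, 1)) y = 0" "m \<in> M"
  shows "(f21 ^^ i) ((f11 ^^ j) (act y m)) = act y ((f21 ^^ i) ((f11 ^^ j) m))"
  using assms by (simp add: commute_pow act_pow_closed)

lemma bracket_zero_sym: "bracket x y = 0 \<Longrightarrow> bracket y x = 0"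
  using bracket_anti[of y x] by simp

lemma \<omega>_long_inside:
  assumes "m \<in> M"
  shows "\<omega> ((f21 ^^ i) ((f11 ^^ j) (fl m))) = 0"
    and "\<omega> ((f21 ^^ i) ((f11 ^^ j) (f31 m))) = 0"
    and "\<omega> ((f21 ^^ i) ((f11 ^^ j) (f32 m))) = 0"
  using assms neg.f_21_31 neg.f_11_31 bracket_zero_sym neg.f_Long11 neg.f_Long21
    neg.f_32_central[of "(2, 1)"] neg.f_32_central[of "(1, 1)"]
  by (simp_all add: central act_pow_closed pos_roots_def)

text \<open>The operators \<open>f21\<close> and \<open>f11\<close> commute up to \<open>f32\<close>, which is central and killed by \<open>\<omega>\<close>.\<close>

lemma f21_inside:
  assumes "m \<in> M"
  shows "\<omega> ((f21 ^^ i) ((f11 ^^ j) (f21 m))) = \<omega> ((f21 ^^ Suc i) ((f11 ^^ j) m))"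
proof -
  have "\<exists>y\<in>M. (f11 ^^ j) (f21 m) = f21 ((f11 ^^ j) m) + f32 y"
  proof (induction j)
    case 0
    then show ?case using subspace_M V.subspace_0 by (intro bexI[of _ 0]) auto
  next
    case (Suc j)
    then obtain y where y: "y \<in> M" "(f11 ^^ j) (f21 m) = f21 ((f11 ^^ j) m) + f32 y" by blast
    let ?w = "(f11 ^^ j) m"
    have w: "?w \<in> M" using assms by (rule act_pow_closed)
    have "f11 (f21 ?w) = f21 (f11 ?w) - f32 ?w"
      using commute[OF neg.f_11_21 w] by (simp add: minus_act w)
    moreover have "f11 (f32 y) = f32 (f11 y)"
      using commute0[OF neg.f_32_central[of "(1, 1)"] y(1)] by (simp add: pos_roots_def)
    ultimately have "(f11 ^^ Suc j) (f21 m) = f21 (f11 ?w) + (f32 (f11 y) - f32 ?w)"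
      using y w by (simp add: act_add act_closed)
    also have "f32 (f11 y) - f32 ?w = f32 (f11 y - ?w)"
      using y w act_add[of "f11 y - ?w" ?w "neg.f (3, 2)"] subspace_M
      by (simp add: act_closed V.subspace_diff)
    finally show ?case using y w subspace_M by (intro bexI[of _ "f11 y - ?w"]) (auto simp: act_closed V.subspace_diff)
  qed
  then obtain y where y: "y \<in> M" "(f11 ^^ j) (f21 m) = f21 ((f11 ^^ j) m) + f32 y" by blast
  have "\<omega> ((f21 ^^ i) (f32 y)) = 0" using \<omega>_long_inside(3)[OF y(1), of i 0] by simp
  moreover have "(f21 ^^ i) ((f11 ^^ j) (f21 m)) = (f21 ^^ Suc i) ((f11 ^^ j) m) + (f21 ^^ i) (f32 y)"
    using y assms by (simp add: act_pow_add act_closed act_pow_closed funpow_swap1)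
  ultimately show ?thesis using y assms by (simp add: \<omega>_add act_closed act_pow_closed)
qed

text \<open>The powers of \<open>ad (F Short)\<close> run through the \<open>a\<close>-string of \<open>b\<close>, with binomial coefficients. The
  last term of the string is recorded only as a value of \<open>f31\<close>, since \<open>\<omega>\<close> kills it.\<close>

lemma fs_pow_fl:
  assumes "m \<in> M"
  shows "\<exists>y\<in>M. (fs ^^ k) (fl m) = fl ((fs ^^ k) m) + scaleV (of_nat k) (f11 ((fs ^^ (k - 1)) m))
    + scaleV (of_nat (k choose 2)) (f21 ((fs ^^ (k - 2)) m)) + f31 y"
proof (induction k)
  case 0
  then show ?case using subspace_M V.subspace_0 by (intro bexI[of _ 0]) (auto simp: binomial_eq_0)
next
  case (Suc k)
  then obtain y where y: "y \<in> M" and eq: "(fs ^^ k) (fl m) = fl ((fs ^^ k) m)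
      + scaleV (of_nat k) (f11 ((fs ^^ (k - 1)) m))
      + scaleV (of_nat (k choose 2)) (f21 ((fs ^^ (k - 2)) m)) + f31 y" by blast
  let ?m = "\<lambda>i. (fs ^^ i) m"
  have m: "?m i \<in> M" for i using assms by (rule act_pow_closed)
  have 1: "fs (fl x) = fl (fs x) + f11 x" "fs (f11 x) = f11 (fs x) + f21 x"
    "fs (f21 x) = f21 (fs x) + f31 x" "fs (f31 x) = f31 (fs x)" if "x \<in> M" for x
    using that commute commute0 neg.f_Short neg.f_simps by metis+
  have k1: "scaleV (of_nat k) (f11 (fs (?m (k - Suc 0)))) = scaleV (of_nat k) (f11 (?m k))"
    by (cases k) auto
  have k2: "scaleV (of_nat (k choose 2)) (f21 (fs (?m (k - 2)))) = scaleV (of_nat (k choose 2)) (f21 (?m (k - Suc 0)))"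
  proof (cases "k \<ge> 2")
    case True
    then have "k - 1 = Suc (k - 2)" by simp
    then show ?thesis by simp
  qed (simp add: binomial_eq_0)
  let ?y = "scaleV (of_nat (k choose 2)) (?m (k - 2)) + fs y"
  have "(fs ^^ Suc k) (fl m) = fs (fl (?m k)) + scaleV (of_nat k) (fs (f11 (?m (k - 1))))
      + scaleV (of_nat (k choose 2)) (fs (f21 (?m (k - 2)))) + fs (f31 y)"
    using m y subspace_M by (simp add: eq act_add act_scale act_closed V.subspace_add V.subspace_scale)
  also have "\<dots> = fl (?m (Suc k)) + (f11 (?m k) + scaleV (of_nat k) (f11 (?m k)))
      + (scaleV (of_nat k) (f21 (?m (k - 1))) + scaleV (of_nat (k choose 2)) (f21 (?m (k - 1))))
      + f31 ?y"
    using m y subspace_M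
    by (simp add: 1 V.scale_right_distrib act_add act_scale act_closed V.subspace_scale) (simp only: k1 k2)
  also have "f11 (?m k) + scaleV (of_nat k) (f11 (?m k)) = scaleV (of_nat (Suc k)) (f11 (?m k))"
    by (simp add: V.scale_left_distrib)
  also have "scaleV (of_nat k) (f21 (?m (k - 1))) + scaleV (of_nat (k choose 2)) (f21 (?m (k - 1)))
      = scaleV (of_nat (Suc k choose 2)) (f21 (?m (k - 1)))"
    by (simp add: V.scale_left_distrib[symmetric] numeral_2_eq_2)
  finally show ?case using y m subspace_M
    by (intro bexI[of _ ?y]) (auto simp: act_closed V.subspace_add V.subspace_scale)
qed

text \<open>Up to factorials, these are the coefficients of the polynomial
  \<open>\<omega> (exp (x f21) exp (y f11) exp (z fs) u)\<close>.\<close>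

definition coord :: "'b \<Rightarrow> nat \<Rightarrow> nat \<Rightarrow> nat \<Rightarrow> complex" where
  "coord u i j k = \<omega> ((f21 ^^ i) ((f11 ^^ j) ((fs ^^ k) u)))"

lemma coord_fs: "coord (fs u) i j k = coord u i j (Suc k)"
  by (simp add: coord_def funpow_swap1)

lemma coord_fl:
  assumes "u \<in> M"
  shows "coord (fl u) i j k =
    of_nat k * coord u i (Suc j) (k - 1) + of_nat (k choose 2) * coord u (Suc i) j (k - 2)"
proof -
  let ?W = "\<lambda>x. (f21 ^^ i) ((f11 ^^ j) x)"
  have W: "?W x \<in> M" "?W (x + y) = ?W x + ?W y" "?W (scaleV c x) = scaleV c (?W x)" if "x \<in> M" "y \<in> M" for x y c
    using that by (auto simp: act_pow_closed act_pow_add act_pow_scale)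
  have u: "(fs ^^ k) u \<in> M" for k using assms by (rule act_pow_closed)
  obtain y where y: "y \<in> M" and eq: "(fs ^^ k) (fl u) = fl ((fs ^^ k) u)
      + scaleV (of_nat k) (f11 ((fs ^^ (k - 1)) u))
      + scaleV (of_nat (k choose 2)) (f21 ((fs ^^ (k - 2)) u)) + f31 y"
    using fs_pow_fl[OF assms] by blast
  have "coord (fl u) i j k = \<omega> (?W (fl ((fs ^^ k) u))) + of_nat k * \<omega> (?W (f11 ((fs ^^ (k - 1)) u)))
      + of_nat (k choose 2) * \<omega> (?W (f21 ((fs ^^ (k - 2)) u))) + \<omega> (?W (f31 y))"
    unfolding coord_def eq using u y subspace_M
    by (simp add: W \<omega>_add \<omega>_scale act_closed V.subspace_add V.subspace_scale)
  also have "\<omega> (?W (f11 ((fs ^^ (k - 1)) u))) = coord u i (Suc j) (k - 1)"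
    by (simp add: coord_def funpow_swap1)
  also have "\<omega> (?W (f21 ((fs ^^ (k - 2)) u))) = coord u (Suc i) j (k - 2)"
    unfolding coord_def by (rule f21_inside[OF u])
  finally show ?thesis using u y by (simp add: \<omega>_long_inside)
qed

text \<open>Since a highest weight module is generated by lowering, an invariant functional is determined
  by its values on the monomials in the short root vectors.\<close>

lemma coord_determines:
  assumes "\<And>i j k. coord v0 i j k = 0" "x \<in> M"
  shows "\<omega> x = 0"
proof -
  have *: "coord (ops.word w) i j k = 0" for w i j k
  proof (induction w arbitrary: i j k)
    case (Cons n w)
    then show ?case by (cases n) (simp_all add: coord_fs coord_fl ops.word_in)
  qed (simp add: assms(1))
  have "\<omega> (ops.word w) = 0" for w using *[of w 0 0 0] by (simp add: coord_def)
  moreover obtain u where "x = ops.comb u" using assms(2) spanned_by_words by auto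
  moreover have "\<omega> 0 = 0" using \<omega>_scale[OF v0_in, of 0] by simp
  then have "\<omega> (ops.comb u) = 0" if "\<And>w. \<omega> (ops.word w) = 0" for u
    by (induction u) (auto simp: \<omega>_add \<omega>_scale ops.word_in ops.comb_in subspace_M V.subspace_scale that)
  ultimately show ?thesis by simp
qed

text \<open>In this normalisation \<open>coord (fl u)\<close> is obtained from \<open>coord u\<close> by the sum of two shifts; an
  exponent in \<open>\<int>\<close> makes the boundary cases uniform.\<close>

definition ncoord :: "'b \<Rightarrow> nat \<Rightarrow> nat \<Rightarrow> int \<Rightarrow> complex" where
  "ncoord u i j k = (if k < 0 then 0 else coord u i j (nat k) / (fact (nat k) * 2 ^ i))"

lemma ncoord_fl:
  assumes "u \<in> M"
  shows "ncoord (fl u) i j k = ncoord u i (Suc j) (k - 1) + ncoord u (Suc i) j (k - 2)"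
proof -
  consider "k < 0" | "k = 0" | "k = 1" | n where "k = int (Suc (Suc n))"
    by (metis int_ops(1) nonneg_int_cases not_less old.nat.exhaust One_nat_def of_nat_1)
  then show ?thesis
  proof cases
    case 4
    have c: "of_nat (Suc (Suc n) choose 2) = of_nat (Suc (Suc n)) * of_nat (Suc n) / (2 :: complex)"
      by (subst binomial_fact) (auto simp: field_simps)
    have nat: "ncoord v i j (int m) = coord v i j m / (fact m * 2 ^ i)" for v i j m
      by (simp add: ncoord_def)
    have k: "k - 1 = int (Suc n)" "k - 2 = int n" using 4 by auto
    show ?thesis
      unfolding k unfolding 4 nat coord_fl[OF assms] c
      by (simp add: field_simps del: of_nat_Suc)
  qed (simp_all add: ncoord_def coord_fl[OF assms] binomial_eq_0)
qed

lemma ncoord_fl_pow: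
  assumes "u \<in> M"
  shows "ncoord ((fl ^^ n) u) i j k =
    (\<Sum>r\<le>n. of_nat (n choose r) * ncoord u (i + r) (j + n - r) (k - int n - int r))"
proof (induction n arbitrary: i j k)
  case (Suc n)
  let ?t = "\<lambda>r. ncoord u (i + r) (j + Suc n - r) (k - int (Suc n) - int r)"
  have pascal: "(\<Sum>r\<le>Suc n. of_nat (Suc n choose r) * t r) =
      (\<Sum>r\<le>n. of_nat (n choose r) * t r) + (\<Sum>r\<le>n. of_nat (n choose r) * t (Suc r))" for t :: "nat \<Rightarrow> complex"
  proof -
    have "(\<Sum>r\<le>Suc n. of_nat (Suc n choose r) * t r) =
        t 0 + (\<Sum>r\<le>n. of_nat (n choose Suc r) * t (Suc r)) + (\<Sum>r\<le>n. of_nat (n choose r) * t (Suc r))"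
      unfolding sum.atMost_Suc_shift by (simp add: distrib_right sum.distrib)
    also have "t 0 + (\<Sum>r\<le>n. of_nat (n choose Suc r) * t (Suc r)) = (\<Sum>r\<le>Suc n. of_nat (n choose r) * t r)"
      unfolding sum.atMost_Suc_shift by simp
    also have "\<dots> = (\<Sum>r\<le>n. of_nat (n choose r) * t r)" by simp
    finally show ?thesis .
  qed
  have "ncoord ((fl ^^ Suc n) u) i j k =
      ncoord ((fl ^^ n) u) i (Suc j) (k - 1) + ncoord ((fl ^^ n) u) (Suc i) j (k - 2)"
    using ncoord_fl[OF act_pow_closed[OF assms]] by simp
  also have "\<dots> = (\<Sum>r\<le>n. of_nat (n choose r) * ?t r) + (\<Sum>r\<le>n. of_nat (n choose r) * ?t (Suc r))"
    unfolding Suc by (intro arg_cong2[where f = "(+)"] sum.cong) (auto simp: algebra_simps)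
  finally show ?case by (simp only: pascal[of ?t])
qed simp

end

section \<open>Bounding the lowest term\<close>

text \<open>For the polynomial \<open>P\<close> with coefficients \<open>h i j m / (i! j!)\<close> at \<open>x ^ i y ^ j z ^ m\<close>, the
  assumption \<open>rel\<close> says that \<open>(\<partial>\<^sub>y + z \<partial>\<^sub>x) ^ n P = 0\<close>, and \<open>top\<close> bounds the degree in \<open>z\<close>. On the part of
  lowest degree only \<open>\<partial>\<^sub>y ^ n\<close> matters, whence \<open>q \<le> l\<close>. For the last bound, consider the terms of the same
  weight as the lowest term: they form \<open>y ^ q z ^ s g(x, y z)\<close> with \<open>g(x, u)\<close> homogeneous of degree
  \<open>p\<close>. The degree of \<open>g\<close> in \<open>u\<close> is at most \<open>K = k - s\<close>; in the coordinates \<open>w = x - u\<close> and \<open>u\<close> the operator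
  \<open>\<partial>\<^sub>y + z \<partial>\<^sub>x\<close> becomes the derivative in \<open>y\<close>, so the degree in \<open>u\<close> is at most \<open>L = l - q\<close>. Hence \<open>g(x, 1)\<close>
  is divisible by \<open>x ^ (p - K)\<close> and by \<open>(x - 1) ^ (p - L)\<close>, and if \<open>p > K + L\<close>, it vanishes.\<close>

lemma lowest_term_bound:
  fixes h :: "nat \<Rightarrow> nat \<Rightarrow> int \<Rightarrow> complex"
  assumes rel: "\<And>n i j m. l < n \<Longrightarrow>
      (\<Sum>r\<le>n. of_nat (n choose r) * h (i + r) (j + n - r) (m - int n - int r)) = 0"
    and top: "\<And>i j m. int k < m \<Longrightarrow> h i j m = 0"
    and neg: "\<And>i j m. m < 0 \<Longrightarrow> h i j m = 0"
    and low: "\<And>i j m. i + j + m < p + q + s \<Longrightarrow> h i j (int m) = 0"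
    and nz: "h p q (int s) \<noteq> 0"
  shows "s \<le> k" "q \<le> l" "p + q + s \<le> k + l"
proof -
  have low': "h i j m = 0" if "int i + int j + m < int (p + q + s)" for i j m
    using that low[of i j "nat m"] neg[of m i j] by (cases "m < 0") auto
  show s: "s \<le> k" using top[of "int s" p q] nz by force
  show q: "q \<le> l"
  proof (rule ccontr)
    assume "\<not> q \<le> l"
    then have q: "q = (q - Suc l) + Suc l" by simp
    have "0 = (\<Sum>r\<le>Suc l. of_nat (Suc l choose r) *
        h (p + r) ((q - Suc l) + Suc l - r) ((int s + int (Suc l)) - int (Suc l) - int r))"
      using rel[of "Suc l" p "q - Suc l" "int s + int (Suc l)"] by simp
    also have "\<dots> = (\<Sum>r\<le>Suc l. if r = 0 then h p q (int s) else 0)"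
      unfolding q[symmetric]
      by (rule sum.cong) (use q in \<open>auto intro!: low'\<close>)
    finally show False using nz by simp
  qed
  show "p + q + s \<le> k + l"
  proof (rule ccontr)
    assume "\<not> p + q + s \<le> k + l"
    define K where "K = k - s"
    define L where "L = l - q"
    have KL: "K + L < p" using \<open>\<not> p + q + s \<le> k + l\<close> s q by (simp add: K_def L_def)
    define a where "a = (\<lambda>t. h (p - t) (q + t) (int (s + t)))"
    have a0: "a t = 0" if "t > K" for t using that top s by (simp add: a_def K_def)
    \<comment> \<open>The factorials turn this relation, up to a scalar, into the vanishing of the coefficient of
      \<open>w ^ (p - m) u ^ m\<close> in \<open>g(w + u, u)\<close>.\<close>
    have rel_a: "(\<Sum>t\<le>m. of_nat ((q + m) choose (m - t)) * a t) = 0" if "L < m" "m \<le> p" for m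
    proof -
      have "0 = (\<Sum>r\<le>q + m. of_nat ((q + m) choose r) * h (p - m + r) (0 + (q + m) - r)
          ((int (s + m) + int (q + m)) - int (q + m) - int r))"
        using that q rel[of "q + m" "p - m" 0 "int (s + m) + int (q + m)"] by (simp add: L_def)
      also have "\<dots> = (\<Sum>r\<le>m. of_nat ((q + m) choose r) * h (p - m + r) (0 + (q + m) - r)
          ((int (s + m) + int (q + m)) - int (q + m) - int r))"
        by (rule sum.mono_neutral_right) (use that in \<open>auto intro!: low'\<close>)
      also have "\<dots> = (\<Sum>t\<le>m. of_nat ((q + m) choose (m - t)) * a t)"
        by (rule sum.reindex_bij_witness[of _ "\<lambda>t. m - t" "\<lambda>r. m - r"]) (use that in \<open>auto simp: a_def of_nat_diff algebra_simps\<close>)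
      finally show ?thesis by simp
    qed
    define g where "g = (\<lambda>t. a t / (fact (p - t) * fact (q + t)))"
    have lin: "Polynomial.coeff ([:1, 1:] ^ n) i = (of_nat (n choose i) :: complex)" for n i
    proof (cases "i \<le> n")
      case False
      have "Polynomial.degree ([:1, 1:] ^ n :: complex poly) \<le> n" by (rule order_trans[OF degree_power_le]) simp
      then show ?thesis using False by (simp add: coeff_eq_0 binomial_eq_0)
    qed (simp add: coeff_linear_poly_power)
    \<comment> \<open>With \<open>u = 1\<close> and \<open>x = 1 + w\<close>, the polynomial \<open>g\<close> is \<open>(1 + w) ^ (p - K) \<delta>(w)\<close>.\<close>
    define \<delta> where "\<delta> = (\<Sum>t\<le>K. smult (g t) ([:1, 1:] ^ (K - t)))"
    have deg: "Polynomial.degree \<delta> \<le> K"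
      unfolding \<delta>_def by (rule degree_sum_le) (auto intro!: order_trans[OF degree_smult_le] order_trans[OF degree_power_le])
    have expand: "[:1, 1:] ^ (p - K) * \<delta> = (\<Sum>t\<le>K. smult (g t) ([:1, 1:] ^ (p - t)))"
      unfolding \<delta>_def sum_distrib_left
      by (rule sum.cong) (use KL in \<open>auto simp: mult_smult_right power_add[symmetric]\<close>)
    have coeff: "Polynomial.coeff ([:1, 1:] ^ (p - K) * \<delta>) (p - m) = 0" if "L < m" "m \<le> p" for m
    proof -
      have "Polynomial.coeff ([:1, 1:] ^ (p - K) * \<delta>) (p - m) = (\<Sum>t\<le>K. g t * of_nat ((p - t) choose (p - m)))"
        unfolding expand by (simp add: coeff_sum lin)
      also have "\<dots> = (\<Sum>t\<le>m. g t * of_nat ((p - t) choose (p - m)))"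
        by (rule sum.mono_neutral_cong) (use that KL a0 in \<open>auto simp: g_def binomial_eq_0\<close>)
      also have "\<dots> = (\<Sum>t\<le>m. of_nat ((q + m) choose (m - t)) * a t) / (fact (p - m) * fact (q + m))"
        unfolding sum_divide_distrib
      proof (rule sum.cong)
        fix t assume t: "t \<in> {..m}"
        have 1: "of_nat ((p - t) choose (p - m)) = fact (p - t) / (fact (p - m) * fact (m - t) :: complex)"
          using t that by (subst binomial_fact) auto
        have 2: "of_nat ((q + m) choose (m - t)) = fact (q + m) / (fact (m - t) * fact (q + t) :: complex)"
          using t by (subst binomial_fact) auto
        show "g t * of_nat ((p - t) choose (p - m)) = of_nat ((q + m) choose (m - t)) * a t / (fact (p - m) * fact (q + m))"
          unfolding 1 2 g_def by (simp add: field_simps)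
      qed simp
      finally show ?thesis using rel_a[OF that] by simp
    qed
    have "g 0 \<noteq> 0" using nz by (simp add: g_def a_def)
    moreover have "Polynomial.coeff \<delta> K = g 0"
    proof -
      have "Polynomial.coeff \<delta> K = (\<Sum>t\<le>K. if t = 0 then g 0 else 0)"
        unfolding \<delta>_def coeff_sum by (rule sum.cong) (auto simp: lin binomial_eq_0)
      then show ?thesis by simp
    qed
    ultimately have "\<delta> \<noteq> 0" by auto
    let ?\<gamma> = "[:1, 1:] ^ (p - K) * \<delta>"
    have "?\<gamma> \<noteq> 0" using \<open>\<delta> \<noteq> 0\<close> by simp
    have "p - L \<le> order 0 ?\<gamma>"
    proof -
      have "monom 1 (p - L) dvd ?\<gamma>"
        unfolding monom_1_dvd_iff'
      proof clarify
        fix n assume "n < p - L"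
        then show "Polynomial.coeff ?\<gamma> n = 0" using coeff[of "p - n"] by simp
      qed
      then have "[:- 0, 1:] ^ (p - L) dvd ?\<gamma>" by (simp add: monom_altdef)
      then show ?thesis using order_divides \<open>?\<gamma> \<noteq> 0\<close> by blast
    qed
    also have "order 0 ?\<gamma> = order 0 \<delta>"
    proof -
      have "order 0 ([:1, 1:] ^ (p - K) :: complex poly) = 0" by (simp add: order_0I)
      then show ?thesis using order_mult[OF \<open>?\<gamma> \<noteq> 0\<close>] by simp
    qed
    also have "\<dots> \<le> K" using order_degree[OF \<open>\<delta> \<noteq> 0\<close>] deg by (rule order_trans)
    finally show False using KL by simp
  qed
qed

context invariant_functional
begin

lemma lowest_exponents:
  assumes lam: "coroot Short lam = int k" "coroot Long lam = int l"
    and nz: "coord v0 p q s \<noteq> 0"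
    and low: "\<And>i j m. i + j + m < p + q + s \<Longrightarrow> coord v0 i j m = 0"
  shows "s \<le> k" "q \<le> l" "p + q + s \<le> k + l"
proof -
  have \<omega>0: "\<omega> 0 = 0" using \<omega>_scale[OF v0_in, of 0] by simp
  note bound = lowest_term_bound[of l "ncoord v0" k p q s]
  have rel: "(\<Sum>r\<le>n. of_nat (n choose r) * ncoord v0 (i + r) (j + n - r) (m - int n - int r)) = 0" if "l < n" for n i j m
  proof -
    have "coord 0 i j k = 0" for i j k by (simp add: coord_def \<omega>0)
    then have "ncoord 0 i j m = 0" by (auto simp: ncoord_def)
    then show ?thesis
      using ncoord_fl_pow[OF v0_in, of n i j m] F_power_zero[OF lam(2) that] by simp
  qed
  have top: "ncoord v0 i j m = 0" if "int k < m" for i j m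
    using F_power_zero[OF lam(1), of "nat m"] that by (simp add: ncoord_def coord_def \<omega>0)
  have low': "ncoord v0 i j (int m) = 0" if "i + j + m < p + q + s" for i j m
    using low that by (simp add: ncoord_def)
  have nz': "ncoord v0 p q (int s) \<noteq> 0" using nz by (simp add: ncoord_def)
  have neg: "ncoord v0 i j m = 0" if "m < 0" for i j m using that by (simp add: ncoord_def)
  show "s \<le> k" "q \<le> l" "p + q + s \<le> k + l"
    using bound[OF rel top neg low' nz'] by blast+
qed

end

section \<open>Signatures of invariant functionals\<close>

context monomial_order
begin

text \<open>Homogeneity makes the order well-founded, since each degree contains finitely many exponents.\<close>

lemma homogeneous_Least:
  assumes homogeneous and "P p"
  shows "P (Least P)" and "P q \<Longrightarrow> le (Least P) q"
proof -
  define d where "d = (LEAST d. \<exists>q. P q \<and> Defs.degree q = d)"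
  have "\<exists>q. P q \<and> Defs.degree q = d" unfolding d_def by (rule LeastI_ex) (use assms in blast)
  moreover have d: "d \<le> Defs.degree q" if "P q" for q unfolding d_def using that by (intro Least_le) blast
  have "finite {q. Defs.degree q = d}"
  proof (rule finite_subset)
    show "{q. Defs.degree q = d} \<subseteq> {..d} \<times> {..d} \<times> {..d} \<times> {..d} \<times> {..d} \<times> {..d}" by auto
  qed auto
  then have "finite {q. P q \<and> Defs.degree q = d}" by (rule rev_finite_subset) auto
  moreover have "{q. P q \<and> Defs.degree q = d} \<noteq> {}" using \<open>\<exists>q. P q \<and> Defs.degree q = d\<close> by blast
  ultimately have "\<exists>r\<in>{q. P q \<and> Defs.degree q = d}. \<forall>q\<in>{q. P q \<and> Defs.degree q = d}. le q r \<longrightarrow> r = q"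
    by (intro finite_has_minimal)
  then obtain r where r: "P r" "Defs.degree r = d" "\<And>q. P q \<Longrightarrow> Defs.degree q = d \<Longrightarrow> le q r \<Longrightarrow> q = r"
    by blast
  have least: "le r q" if "P q" for q
  proof (cases "Defs.degree q = d")
    case True
    then show ?thesis using r(3)[OF that] linear[of q r] by auto
  next
    case False
    then have "Defs.degree r < Defs.degree q" using d[OF that] r(2) by simp
    then show ?thesis using assms(1) unfolding homogeneous_def by (blast intro: less_imp_le)
  qed
  have "Least P = r" by (rule Least_equality) (use r least in auto)
  then show "P (Least P)" "P q \<Longrightarrow> le (Least P) q" using r least by auto
qed

end

context g2_branching
begin

lemma highest_weight_module:
  assumes "dominant \<mu>"
  shows "highest_weight_module scale bracket E F H e scaleV (V \<mu>) (act \<mu>) (hv \<mu>) \<mu>"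
proof -
  interpret lie_module scale bracket scaleV "V \<mu>" "act \<mu>" using assms by (rule module)
  show ?thesis
  proof unfold_locales
    fix i
    obtain c where c: "E i = scale c (e (simple_root i))" using E_multiple_e by blast
    have "simple_root i \<in> set pos_roots" by (cases i) (auto simp: pos_roots_def)
    then have "act \<mu> (e (simple_root i)) (hv \<mu>) = 0" using hv_highest assms by blast
    then show "act \<mu> (E i) (hv \<mu>) = 0" using hv_nonzero assms by (simp add: c scale_act)
  qed (use assms irreducible hv_nonzero hv_weight in auto)
qed

abbreviation invariant_functional_on :: "weight \<Rightarrow> ('v \<Rightarrow> complex) \<Rightarrow> bool" where
  "invariant_functional_on \<mu> \<equiv>
     invariant_functional scale bracket E F H e scaleV (V \<mu>) (act \<mu>) (hv \<mu>) \<mu>"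

lemma A2_scale: "x \<in> A2 \<Longrightarrow> scale c x \<in> A2"
  unfolding A2_def hull_def subalgebra_def by (auto intro: subspace_scale)

lemma exp_nilpotent_eq:
  assumes "\<And>k. k \<ge> N \<Longrightarrow> (X ^^ k) v = 0"
  shows "exp_nilpotent X v = (\<Sum>k<N. scaleV (1 / fact k) ((X ^^ k) v))"
  unfolding exp_nilpotent_def
proof (rule sum.mono_neutral_left)
  show "{k. (X ^^ k) v \<noteq> 0} \<subseteq> {..<N}"
  proof
    fix k assume "k \<in> {k. (X ^^ k) v \<noteq> 0}"
    then show "k \<in> {..<N}" using assms[of k] by (cases "N \<le> k") auto
  qed
qed auto

text \<open>Comparing coefficients of \<open>t\<close> in \<open>\<omega> (exp (t x) v) = \<omega> v\<close>.\<close>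

lemma invariants_kill:
  assumes \<mu>: "dominant \<mu>" and \<omega>: "\<omega> \<in> invariants \<mu>"
    and \<alpha>: "\<alpha> \<in> {(3, 2), (3, 1), (0, 1)}" and m: "m \<in> V \<mu>"
  shows "\<omega> (act \<mu> (neg.f \<alpha>) m) = 0"
proof -
  interpret M: highest_weight_module scale bracket E F H e scaleV "V \<mu>" "act \<mu>" "hv \<mu>" \<mu>
    using \<mu> by (rule highest_weight_module)
  have dual: "\<And>x y. x \<in> V \<mu> \<Longrightarrow> y \<in> V \<mu> \<Longrightarrow> \<omega> (x + y) = \<omega> x + \<omega> y"
    "\<And>x c. x \<in> V \<mu> \<Longrightarrow> \<omega> (scaleV c x) = c * \<omega> x"
    using \<omega> by (auto simp: invariants_def dual_def)
  have \<omega>0: "\<omega> 0 = 0" using dual(2)[OF m, of 0] by simp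
  have \<omega>_sum: "\<omega> (\<Sum>k\<in>I. g k) = (\<Sum>k\<in>I. \<omega> (g k))" if "finite I" "\<And>k. g k \<in> V \<mu>" for I :: "nat set" and g
    using that(1) by (induction I rule: finite_induct) (auto simp: \<omega>0 dual that M.subspace_M V.subspace_sum)
  have pos: "\<alpha> \<in> set pos_roots" and long: "- \<alpha> \<in> long_roots"
    using \<alpha> by (auto simp: pos_roots_def long_roots_def)
  obtain c where c: "c \<noteq> 0" "e (- \<alpha>) = scale c (neg.f \<alpha>)" using e_neg[OF pos] by blast
  have root: "e (- \<alpha>) \<in> root_space (- \<alpha>)"
    using pos by (intro e_root_space) (auto simp: roots_def)
  let ?y = "act \<mu> (e (- \<alpha>))"
  obtain N' where N': "\<And>n. n \<ge> N' \<Longrightarrow> (?y ^^ n) m = 0"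
    using M.negative_root_nilpotent[OF pos root m] by blast
  define N where "N = N' + 2"
  have N: "(?y ^^ n) m = 0" if "n \<ge> N" for n using N' that by (simp add: N_def)
  have scaled: "(act \<mu> (scale t (e (- \<alpha>))) ^^ k) m = scaleV (t ^ k) ((?y ^^ k) m)" for t k
    by (induction k) (auto simp: M.scale_act M.act_scale M.act_pow_closed M.act_closed m M.subspace_M V.subspace_scale)
  define P where "P = (\<Sum>k<N. monom (\<omega> ((?y ^^ k) m) / fact k) k)"
  have "poly P t = \<omega> m" for t
  proof -
    let ?x = "scale t (e (- \<alpha>))"
    have "?x \<in> A2 \<inter> root_space (- \<alpha>)"
      using A2_scale[OF e_in_A2[OF long]] root by (auto simp: root_space_def bracket_scale_right mult.commute)
    then have "exp_nilpotent (act \<mu> ?x) \<circ> id \<in> unipotent \<mu>"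
      using pos unipotent.one by (intro unipotent.mult) 
    then have "\<omega> ((exp_nilpotent (act \<mu> ?x) \<circ> id) m) = \<omega> m" using \<omega> m unfolding invariants_def by blast
    moreover have "exp_nilpotent (act \<mu> ?x) m = (\<Sum>k<N. scaleV (1 / fact k) (scaleV (t ^ k) ((?y ^^ k) m)))"
      using exp_nilpotent_eq[of N "act \<mu> ?x" m] N unfolding scaled by simp
    moreover have "\<omega> \<dots> = (\<Sum>k<N. 1 / fact k * (t ^ k * \<omega> ((?y ^^ k) m)))"
      using M.act_pow_closed[OF m] M.subspace_M
      by (subst \<omega>_sum) (auto simp: dual V.subspace_scale simp del: V.scale_scale)
    ultimately show ?thesis
      by (simp add: P_def poly_sum poly_monom algebra_simps)
  qed
  then have "poly P = poly [:\<omega> m:]" by auto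
  then have "P = [:\<omega> m:]" by (simp only: poly_eq_poly_eq_iff)
  then have "Polynomial.coeff P 1 = 0" by simp
  moreover have "Polynomial.coeff P 1 = \<omega> (?y m)"
  proof -
    have "Polynomial.coeff P 1 = (\<Sum>k<N. if k = 1 then \<omega> (?y m) else 0)"
      unfolding P_def coeff_sum by (rule sum.cong) auto
    then show ?thesis by (simp add: N_def)
  qed
  ultimately have "c * \<omega> (act \<mu> (neg.f \<alpha>) m) = 0"
    by (simp add: c M.scale_act m dual M.act_closed)
  then show ?thesis using c by simp
qed

lemma invariants_iff:
  assumes \<mu>: "dominant \<mu>"
  shows "\<omega> \<in> invariants \<mu> \<longleftrightarrow> invariant_functional_on \<mu> \<omega>"
proof
  interpret M: highest_weight_module scale bracket E F H e scaleV "V \<mu>" "act \<mu>" "hv \<mu>" \<mu>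
    using \<mu> by (rule highest_weight_module)
  {
    assume \<omega>: "\<omega> \<in> invariants \<mu>"
    show "invariant_functional_on \<mu> \<omega>"
      by unfold_locales (use \<omega> invariants_kill[OF \<mu> \<omega>] in \<open>auto simp: invariants_def dual_def\<close>)
  next
    assume "invariant_functional_on \<mu> \<omega>"
    then interpret I: invariant_functional scale bracket E F H e scaleV "V \<mu>" "act \<mu>" "hv \<mu>" \<mu> \<omega> .
    have \<omega>0: "\<omega> 0 = 0" using I.\<omega>_scale[OF M.v0_in, of 0] by simp
    have exp: "exp_nilpotent (act \<mu> x) m \<in> V \<mu> \<and> \<omega> (exp_nilpotent (act \<mu> x) m) = \<omega> m"
      if \<alpha>: "\<alpha> \<in> set pos_roots" and x: "x \<in> A2" "x \<in> root_space (- \<alpha>)" and m: "m \<in> V \<mu>" for \<alpha> x m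
    proof -
      have kill: "\<omega> (act \<mu> x y) = 0" if y: "y \<in> V \<mu>" for y
      proof (cases "\<alpha> \<in> {(3, 2), (3, 1), (0, 1)}")
        case True
        obtain c where "x = scale c (neg.f \<alpha>)" using neg_root_space_eq[OF \<alpha> x(2)] by blast
        then show ?thesis using I.\<omega>_long[OF True y] y by (simp add: M.scale_act I.\<omega>_scale M.act_closed)
      next
        case False
        then have "\<not> 3 dvd fst \<alpha>" using \<alpha> by (auto simp: pos_roots_def)
        then have "x = 0" by (rule A2_short[OF x])
        then show ?thesis using M.scale_act[OF y, of 0 0] \<omega>0 by simp
      qed
      obtain N' where N': "\<And>n. n \<ge> N' \<Longrightarrow> (act \<mu> x ^^ n) m = 0"
        using M.negative_root_nilpotent[OF \<alpha> x(2) m] by blast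
      have N: "\<And>n. n \<ge> Suc N' \<Longrightarrow> (act \<mu> x ^^ n) m = 0" using N' by simp
      let ?t = "\<lambda>k. scaleV (1 / fact k) ((act \<mu> x ^^ k) m)"
      have t: "?t k \<in> V \<mu>" for k using m by (simp add: M.act_pow_closed M.subspace_M V.subspace_scale)
      have "exp_nilpotent (act \<mu> x) m = (\<Sum>k<Suc N'. ?t k)" by (rule exp_nilpotent_eq) (rule N)
      then have eq: "exp_nilpotent (act \<mu> x) m = m + (\<Sum>k<N'. ?t (Suc k))"
        unfolding sum.lessThan_Suc_shift by (simp del: fact_Suc)
      have "\<omega> (\<Sum>k<n. ?t (Suc k)) = 0 \<and> (\<Sum>k<n. ?t (Suc k)) \<in> V \<mu>" for n
      proof (induction n)
        case (Suc n)
        have "\<omega> (?t (Suc n)) = 0"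
          using kill[OF M.act_pow_closed[OF m]] m by (simp add: I.\<omega>_scale M.act_closed M.act_pow_closed)
        then show ?case using Suc t by (simp add: I.\<omega>_add V.subspace_add M.subspace_M del: funpow.simps fact_Suc)
      qed (simp add: \<omega>0 V.subspace_0 M.subspace_M)
      then show ?thesis unfolding eq using m by (simp add: I.\<omega>_add V.subspace_add M.subspace_M)
    qed
    have "\<forall>m\<in>V \<mu>. u m \<in> V \<mu> \<and> \<omega> (u m) = \<omega> m" if "u \<in> unipotent \<mu>" for u
      using that by (induction rule: unipotent.induct) (use exp in auto)
    then show "\<omega> \<in> invariants \<mu>"
      using I.\<omega>_add I.\<omega>_scale by (auto simp: invariants_def dual_def)
  }
qed

text \<open>The vectors \<open>e (- \<alpha>)\<close> are multiples of the nested brackets. Those of \<open>3a + 2b\<close> and \<open>3a + b\<close> stand on the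
  left, where \<open>\<omega>\<close> kills them, and that of \<open>b\<close> can be moved there.\<close>

lemma vec_nonzero_iff:
  assumes \<mu>: "dominant \<mu>" and \<omega>: "invariant_functional_on \<mu> \<omega>"
  shows "\<omega> (vec (\<mu>, (p1, p2, p3, p4, p5, p6))) \<noteq> 0 \<longleftrightarrow>
    p1 = 0 \<and> p2 = 0 \<and> p5 = 0 \<and>
    invariant_functional.coord bracket F (act \<mu>) \<omega> (hv \<mu>) p3 p4 p6 \<noteq> 0"
proof -
  interpret M: invariant_functional scale bracket E F H e scaleV "V \<mu>" "act \<mu>" "hv \<mu>" \<mu> \<omega> by (rule \<omega>)
  have e: "\<exists>c. c \<noteq> 0 \<and> (\<forall>m\<in>V \<mu>. \<forall>n. (act \<mu> (e (- \<alpha>)) ^^ n) m = scaleV (c ^ n) ((act \<mu> (neg.f \<alpha>) ^^ n) m))"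
    if "\<alpha> \<in> set pos_roots" for \<alpha>
  proof -
    obtain c where c: "c \<noteq> 0" "e (- \<alpha>) = scale c (neg.f \<alpha>)" using e_neg[OF \<open>\<alpha> \<in> set pos_roots\<close>] by blast
    have "(act \<mu> (e (- \<alpha>)) ^^ n) m = scaleV (c ^ n) ((act \<mu> (neg.f \<alpha>) ^^ n) m)" if "m \<in> V \<mu>" for m n
      by (induction n)
         (auto simp: c M.scale_act M.act_scale M.act_pow_closed M.act_closed that M.subspace_M V.subspace_scale)
    then show ?thesis using c by blast
  qed
  obtain c1 where c1: "c1 \<noteq> 0" "\<And>m n. m \<in> V \<mu> \<Longrightarrow> (act \<mu> (e (- (3, 2))) ^^ n) m = scaleV (c1 ^ n) ((M.f32 ^^ n) m)"
    using e[of "(3, 2)"] by (auto simp: pos_roots_def)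
  obtain c2 where c2: "c2 \<noteq> 0" "\<And>m n. m \<in> V \<mu> \<Longrightarrow> (act \<mu> (e (- (3, 1))) ^^ n) m = scaleV (c2 ^ n) ((M.f31 ^^ n) m)"
    using e[of "(3, 1)"] by (auto simp: pos_roots_def)
  obtain c3 where c3: "c3 \<noteq> 0" "\<And>m n. m \<in> V \<mu> \<Longrightarrow> (act \<mu> (e (- (2, 1))) ^^ n) m = scaleV (c3 ^ n) ((M.f21 ^^ n) m)"
    using e[of "(2, 1)"] by (auto simp: pos_roots_def)
  obtain c4 where c4: "c4 \<noteq> 0" "\<And>m n. m \<in> V \<mu> \<Longrightarrow> (act \<mu> (e (- (1, 1))) ^^ n) m = scaleV (c4 ^ n) ((M.f11 ^^ n) m)"
    using e[of "(1, 1)"] by (auto simp: pos_roots_def)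
  obtain c5 where c5: "c5 \<noteq> 0" "\<And>m n. m \<in> V \<mu> \<Longrightarrow> (act \<mu> (e (- (0, 1))) ^^ n) m = scaleV (c5 ^ n) ((M.fl ^^ n) m)"
    using e[of "(0, 1)"] by (auto simp: pos_roots_def neg.f_simps(2))
  obtain c6 where c6: "c6 \<noteq> 0" "\<And>m n. m \<in> V \<mu> \<Longrightarrow> (act \<mu> (e (- (1, 0))) ^^ n) m = scaleV (c6 ^ n) ((M.fs ^^ n) m)"
    using e[of "(1, 0)"] by (auto simp: pos_roots_def neg.f_simps(1))
  have pc: "(act \<mu> x ^^ n) m \<in> V \<mu>" if "m \<in> V \<mu>" for x n m using that by (rule M.act_pow_closed)
  have sc: "scaleV c m \<in> V \<mu>" if "m \<in> V \<mu>" for c m using that M.subspace_M by (simp add: V.subspace_scale)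
  let ?m6 = "(M.fs ^^ p6) (hv \<mu>)"
  let ?m = "(M.f32 ^^ p1) ((M.f31 ^^ p2) ((M.f21 ^^ p3) ((M.f11 ^^ p4) ((M.fl ^^ p5) ?m6))))"
  have vec: "vec (\<mu>, (p1, p2, p3, p4, p5, p6)) =
     scaleV (c6 ^ p6 * c5 ^ p5 * c4 ^ p4 * c3 ^ p3 * c2 ^ p2 * c1 ^ p1) ?m"
    using M.v0_in by (simp add: c1 c2 c3 c4 c5 c6 pc sc M.act_pow_scale mult_ac del: uminus_Pair)
  have in6: "?m6 \<in> V \<mu>" using M.v0_in by (rule pc)
  have "\<omega> ?m \<noteq> 0 \<longleftrightarrow> p1 = 0 \<and> p2 = 0 \<and> p5 = 0 \<and> M.coord (hv \<mu>) p3 p4 p6 \<noteq> 0"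
  proof -
    have 1: "\<omega> ?m = 0" if "p1 \<noteq> 0" using that pc in6 by (cases p1) auto
    have 2: "\<omega> ?m = 0" if "p1 = 0" "p2 \<noteq> 0" using that pc in6 by (cases p2) auto
    have 5: "\<omega> ?m = 0" if "p1 = 0" "p2 = 0" "p5 \<noteq> 0"
      using that pc in6 by (cases p5) (auto simp: M.\<omega>_long_inside)
    show ?thesis
    proof (cases "p1 = 0 \<and> p2 = 0 \<and> p5 = 0")
      case False
      then have "\<omega> ?m = 0" using 1 2 5 by blast
      then show ?thesis using False by blast
    qed (simp add: M.coord_def)
  qed
  moreover have "?m \<in> V \<mu>" by (intro pc in6)
  ultimately show ?thesis unfolding vec using c1(1) c2(1) c3(1) c4(1) c5(1) c6(1)
    by (simp add: M.\<omega>_scale)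
qed

lemma branching_semigroup_bound:
  assumes homogeneous and "\<sigma> \<in> branching_semigroup"
  shows "\<exists>k l p q s. \<sigma> = ((2 * int k + 3 * int l, int k + 2 * int l), (0, 0, p, q, 0, s)) \<and>
    s \<le> k \<and> q \<le> l \<and> p + q + s \<le> k + l"
proof -
  obtain \<mu> \<omega> x where \<sigma>: "\<sigma> = sign \<mu> \<omega>" and \<mu>: "dominant \<mu>" and "\<omega> \<in> invariants \<mu>"
    and x: "x \<in> V \<mu>" "\<omega> x \<noteq> 0"
    using assms(2) unfolding branching_semigroup_def by blast
  then have \<omega>: "invariant_functional_on \<mu> \<omega>" using invariants_iff by blast
  then interpret M: invariant_functional scale bracket E F H e scaleV "V \<mu>" "act \<mu>" "hv \<mu>" \<mu> \<omega> .
  note iff = vec_nonzero_iff[OF \<mu> \<omega>]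
  let ?P = "\<lambda>p. \<omega> (vec (\<mu>, p)) \<noteq> 0"
  obtain i j k where "M.coord (hv \<mu>) i j k \<noteq> 0" using M.coord_determines x by blast
  then have ex: "?P (0, 0, i, j, 0, k)" unfolding iff by simp
  obtain p1 p2 p q p5 s where L: "Least ?P = (p1, p2, p, q, p5, s)" by (cases "Least ?P") auto
  have "?P (p1, p2, p, q, p5, s)" using homogeneous_Least(1)[OF assms(1), of ?P, OF ex] unfolding L .
  then have zero: "p1 = 0" "p2 = 0" "p5 = 0" and nz: "M.coord (hv \<mu>) p q s \<noteq> 0" unfolding iff by auto
  have low: "M.coord (hv \<mu>) i j m = 0" if "i + j + m < p + q + s" for i j m
  proof (rule ccontr)
    assume "M.coord (hv \<mu>) i j m \<noteq> 0"
    then have "?P (0, 0, i, j, 0, m)" unfolding iff by simp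
    then have "le (Least ?P) (0, 0, i, j, 0, m)" using homogeneous_Least(2)[OF assms(1), of ?P] by blast
    moreover have "lt (0, 0, i, j, 0, m) (Least ?P)"
      using assms(1) that unfolding L homogeneous_def zero by simp
    ultimately show False by (simp add: less_le_not_le)
  qed
  obtain k l where kl: "coroot Short \<mu> = int k" "coroot Long \<mu> = int l"
    using \<mu> unfolding dominant_def by (metis nonneg_int_cases)
  then have "\<mu> = (2 * int k + 3 * int l, int k + 2 * int l)" by (cases \<mu>) auto
  then show ?thesis using M.lowest_exponents[OF kl nz low] L zero \<sigma> by (auto simp: sign_def)
qed

text \<open>The assumption \<open>low\<close> covers the degree of \<open>(p, q, s)\<close> itself, so the conclusion holds for every
  choice of the order among exponents of equal degree.\<close>

lemma in_branching_semigroup: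
  assumes homogeneous and \<mu>: "dominant \<mu>" and \<omega>: "invariant_functional_on \<mu> \<omega>"
    and nz: "invariant_functional.coord bracket F (act \<mu>) \<omega> (hv \<mu>) p q s \<noteq> 0"
    and low: "\<And>i j m. i + j + m \<le> p + q + s \<Longrightarrow> (i, j, m) \<noteq> (p, q, s) \<Longrightarrow>
      invariant_functional.coord bracket F (act \<mu>) \<omega> (hv \<mu>) i j m = 0"
  shows "(\<mu>, (0, 0, p, q, 0, s)) \<in> branching_semigroup"
proof -
  interpret M: invariant_functional scale bracket E F H e scaleV "V \<mu>" "act \<mu>" "hv \<mu>" \<mu> \<omega> by (rule \<omega>)
  note iff = vec_nonzero_iff[OF \<mu> \<omega>]
  let ?P = "\<lambda>p. \<omega> (vec (\<mu>, p)) \<noteq> 0"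
  have P: "?P (0, 0, p, q, 0, s)" unfolding iff using nz by simp
  have "Least ?P = (0, 0, p, q, 0, s)"
  proof (rule Least_equality)
    fix r assume r: "?P r"
    obtain p1 p2 i j p5 m where r_eq: "r = (p1, p2, i, j, p5, m)" by (cases r) auto
    have z: "p1 = 0" "p2 = 0" "p5 = 0" and "M.coord (hv \<mu>) i j m \<noteq> 0" using r unfolding r_eq iff by auto
    then have "(i, j, m) = (p, q, s) \<or> p + q + s < i + j + m" using low[of i j m]
      by (cases "i + j + m \<le> p + q + s") auto
    then show "le (0, 0, p, q, 0, s) r"
    proof
      assume "p + q + s < i + j + m"
      then have "lt (0, 0, p, q, 0, s) r" using assms(1) unfolding homogeneous_def r_eq z by simp
      then show ?thesis by (rule less_imp_le)
    qed (simp add: r_eq z)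
  qed (rule P)
  then have "sign \<mu> \<omega> = (\<mu>, (0, 0, p, q, 0, s))" by (simp add: sign_def)
  moreover have "\<omega> ((M.f21 ^^ p) ((M.f11 ^^ q) ((M.fs ^^ s) (hv \<mu>)))) \<noteq> 0"
    using nz by (simp add: M.coord_def)
  moreover have "(M.f21 ^^ p) ((M.f11 ^^ q) ((M.fs ^^ s) (hv \<mu>))) \<in> V \<mu>"
    using M.v0_in by (intro M.act_pow_closed)
  moreover have "\<omega> \<in> invariants \<mu>" using \<mu> \<omega> invariants_iff by blast
  ultimately show ?thesis
    using \<mu> unfolding branching_semigroup_def mem_Collect_eq by metis
qed

end

section \<open>Tensors over the seven-dimensional representation\<close>

text \<open>A tensor is given by its coordinates, indexed by lists over \<open>{0..<7}\<close>; \<open>derivation M\<close> is the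
  extension of the matrix \<open>M\<close> to tensors by the Leibniz rule.\<close>

type_synonym tensor = "nat list \<Rightarrow> complex"
type_synonym matrix = "nat \<Rightarrow> nat \<Rightarrow> complex"

fun derivation :: "matrix \<Rightarrow> tensor \<Rightarrow> tensor" where
  "derivation M T [] = 0"
| "derivation M T (i # l) = (\<Sum>j<7. M i j * T (j # l)) + derivation M (\<lambda>l'. T (i # l')) l"

definition commutator :: "matrix \<Rightarrow> matrix \<Rightarrow> matrix" where
  "commutator M N i j = (\<Sum>m<7. M i m * N m j) - (\<Sum>m<7. N i m * M m j)"

lemma derivation_add: "derivation M (\<lambda>l. S l + T l) l = derivation M S l + derivation M T l"
  by (induction l arbitrary: S T) (auto simp: sum.distrib algebra_simps)

lemma derivation_scale: "derivation M (\<lambda>l. c * T l) l = c * derivation M T l"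
  by (induction l arbitrary: T) (auto simp: sum_distrib_left algebra_simps)

lemma derivation_sum: "derivation M (\<lambda>l. \<Sum>x\<in>I. T x l) l = (\<Sum>x\<in>I. derivation M (T x) l)"
proof (induction I rule: infinite_finite_induct)
  case empty
  then show ?case using derivation_scale[of M 0 "\<lambda>_. 0" l] by simp
next
  case (infinite I)
  then show ?case using derivation_scale[of M 0 "\<lambda>_. 0" l] by simp
qed (simp add: derivation_add)

lemma derivation_commute:
  "derivation M (derivation N T) l = derivation N (derivation M T) l + derivation (commutator M N) T l"
proof (induction l arbitrary: T)
  case (Cons i l)
  have *: "derivation M (derivation N T) (i # l) =
      (\<Sum>j<7. \<Sum>m<7. M i j * N j m * T (m # l)) + (\<Sum>j<7. M i j * derivation N (\<lambda>l'. T (j # l')) l) +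
      (\<Sum>j<7. N i j * derivation M (\<lambda>l'. T (j # l')) l) + derivation M (derivation N (\<lambda>l'. T (i # l'))) l"
    for M N
    by (simp add: derivation_add derivation_sum derivation_scale distrib_left sum.distrib
        sum_distrib_left mult.assoc)
  have "(\<Sum>j<7. commutator M N i j * T (j # l)) =
    (\<Sum>j<7. \<Sum>m<7. M i j * N j m * T (m # l)) - (\<Sum>j<7. \<Sum>m<7. N i j * M j m * T (m # l))"
    unfolding sum.swap[of "\<lambda>j m. M i j * N j m * T (m # l)"]
      sum.swap[of "\<lambda>j m. N i j * M j m * T (m # l)"]
    by (simp add: commutator_def left_diff_distrib sum_distrib_right sum_subtractf)
  then have "derivation (commutator M N) T (i # l) =
      (\<Sum>j<7. \<Sum>m<7. M i j * N j m * T (m # l)) - (\<Sum>j<7. \<Sum>m<7. N i j * M j m * T (m # l)) +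
      derivation (commutator M N) (\<lambda>l'. T (i # l')) l" by simp
  then show ?case unfolding *[of M N] *[of N M] Cons by simp
qed simp

lemma derivation_rows_zero:
  assumes "\<And>i j. i \<in> set l \<Longrightarrow> M i j = 0"
  shows "derivation M T l = 0"
  using assms by (induction l arbitrary: T) auto

fun tensor_product :: "nat \<Rightarrow> tensor \<Rightarrow> tensor \<Rightarrow> tensor" where
  "tensor_product 0 A B l = A [] * B l"
| "tensor_product (Suc n) A B [] = 0"
| "tensor_product (Suc n) A B (i # l) = tensor_product n (\<lambda>l'. A (i # l')) B l"

lemma tensor_product_append: "tensor_product (length l) A B (l @ l') = A l * B l'"
  by (induction l arbitrary: A) auto

lemma tensor_product_add_left:
  "tensor_product n (\<lambda>l. A l + A' l) B l = tensor_product n A B l + tensor_product n A' B l"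
  by (induction n A B l arbitrary: A' rule: tensor_product.induct) (auto simp: distrib_right)

lemma tensor_product_scale_left:
  "tensor_product n (\<lambda>l. c * A l) B l = c * tensor_product n A B l"
  by (induction n A B l rule: tensor_product.induct) auto

lemma tensor_product_scale_right:
  "tensor_product n A (\<lambda>l. c * B l) l = c * tensor_product n A B l"
  by (induction n A B l rule: tensor_product.induct) auto

lemma tensor_product_sum_left:
  "tensor_product n (\<lambda>l. \<Sum>x\<in>I. A x l) B l = (\<Sum>x\<in>I. tensor_product n (A x) B l)"
proof (induction I rule: infinite_finite_induct)
  case empty
  then show ?case using tensor_product_scale_left[of n 0 "\<lambda>_. 0" B l] by simp
next
  case (infinite I)
  then show ?case using tensor_product_scale_left[of n 0 "\<lambda>_. 0" B l] by simp
qed (simp add: tensor_product_add_left)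

lemma derivation_tensor_product:
  "derivation M (tensor_product n A B) l =
    tensor_product n (derivation M A) B l + tensor_product n A (derivation M B) l"
proof (induction n A B l rule: tensor_product.induct)
  case (1 A B l)
  have "tensor_product 0 A B = (\<lambda>l. A [] * B l)" by auto
  then show ?case by (simp add: derivation_scale)
next
  case (3 n A B i l)
  have "tensor_product n (\<lambda>l'. derivation M A (i # l')) B l =
      (\<Sum>j<7. M i j * tensor_product n (\<lambda>l'. A (j # l')) B l) + tensor_product n (derivation M (\<lambda>l'. A (i # l'))) B l"
    by (simp add: tensor_product_add_left tensor_product_sum_left tensor_product_scale_left)
  then show ?case by (simp add: 3)
qed simp

lemma derivation_pow_sum:
  "(derivation M ^^ n) (\<lambda>l. \<Sum>x\<in>I. c x * T x l) = (\<lambda>l. \<Sum>x\<in>I. c x * (derivation M ^^ n) (T x) l)"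
proof (induction n)
  case (Suc n)
  show ?case
    by (rule ext) (simp add: Suc derivation_sum derivation_scale)
qed simp

lemma derivation_pow_tensor_product:
  "(derivation M ^^ n) (tensor_product m A B) =
    (\<lambda>l. \<Sum>t\<le>n. of_nat (n choose t) * tensor_product m ((derivation M ^^ t) A) ((derivation M ^^ (n - t)) B) l)"
proof (induction n)
  case (Suc n)
  let ?p = "\<lambda>s t. tensor_product m ((derivation M ^^ s) A) ((derivation M ^^ t) B)"
  show ?case
  proof
    fix l
    have "(derivation M ^^ Suc n) (tensor_product m A B) l =
        (\<Sum>t\<le>n. of_nat (n choose t) * (?p (Suc t) (n - t) l + ?p t (Suc (n - t)) l))"
      by (simp add: Suc derivation_sum derivation_scale derivation_tensor_product)
    also have "\<dots> = (\<Sum>t\<le>n. of_nat (n choose t) * ?p (Suc t) (n - t) l) +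
        (\<Sum>t\<le>n. of_nat (n choose t) * ?p t (Suc n - t) l)"
      unfolding distrib_left sum.distrib by (intro arg_cong2[where f = "(+)"] refl sum.cong) (auto simp: Suc_diff_le)
    also have "(\<Sum>t\<le>n. of_nat (n choose t) * ?p t (Suc n - t) l) = (\<Sum>t\<le>Suc n. of_nat (n choose t) * ?p t (Suc n - t) l)"
      by simp
    also have "\<dots> = ?p 0 (Suc n) l + (\<Sum>t\<le>n. of_nat (n choose Suc t) * ?p (Suc t) (n - t) l)"
      unfolding sum.atMost_Suc_shift by simp
    also have "(\<Sum>t\<le>n. of_nat (n choose t) * ?p (Suc t) (n - t) l) +
          (?p 0 (Suc n) l + (\<Sum>t\<le>n. of_nat (n choose Suc t) * ?p (Suc t) (n - t) l)) =
        (\<Sum>t\<le>Suc n. of_nat (Suc n choose t) * ?p t (Suc n - t) l)"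
      unfolding sum.atMost_Suc_shift by (simp add: distrib_right sum.distrib)
    finally show "(derivation M ^^ Suc n) (tensor_product m A B) l =
      (\<Sum>t\<le>Suc n. of_nat (Suc n choose t) * ?p t (Suc n - t) l)" .
  qed
qed simp

text \<open>The basis vectors \<open>0, \<dots>, 6\<close> have the weights \<open>2a + b, a + b, a, 0, - a, - a - b, - 2a - b\<close>,
  and they are orthogonal for the contravariant form, with the square lengths \<open>square_length\<close>. An
  orthonormal basis would bring in square roots of 2.\<close>

definition weight7 :: "nat \<Rightarrow> weight" where
  "weight7 j = [(2, 1), (1, 1), (1, 0), (0, 0), (-1, 0), (-1, -1), (-2, -1)] ! j"

definition square_length :: "nat \<Rightarrow> complex" where
  "square_length j = (if j = 3 then 2 else 1)"

fun F7 :: "node \<Rightarrow> matrix" where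
  "F7 Short i j = (if (i, j) \<in> {(1, 0), (3, 2), (6, 5)} then 1 else if (i, j) = (4, 3) then 2 else 0)"
| "F7 Long i j = (if (i, j) \<in> {(2, 1), (5, 4)} then 1 else 0)"

fun E7 :: "node \<Rightarrow> matrix" where
  "E7 Short i j = (if (i, j) \<in> {(0, 1), (3, 4), (5, 6)} then 1 else if (i, j) = (2, 3) then 2 else 0)"
| "E7 Long i j = (if (i, j) \<in> {(1, 2), (4, 5)} then 1 else 0)"

definition H7 :: "node \<Rightarrow> matrix" where
  "H7 n i j = (if i = j \<and> i < 7 then of_int (coroot n (weight7 i)) else 0)"

lemma lessThan_7: "{..<7::nat} = {0, 1, 2, 3, 4, 5, 6}"
  by auto

lemma less_7: "(i::nat) < 7 \<longleftrightarrow> i \<in> {0, 1, 2, 3, 4, 5, 6}"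
  by auto

lemma sparse_sum: "(\<Sum>m<7::nat. g m) = g 0 + g 1 + g 2 + g 3 + g 4 + g 5 + (g 6 :: complex)"
  by (simp add: lessThan_7)

lemma E7_F7: "commutator (E7 n) (F7 n') = (if n = n' then H7 n else (\<lambda>i j. 0))"
proof (intro ext)
  fix i j
  show "commutator (E7 n) (F7 n') i j = (if n = n' then H7 n else (\<lambda>i j. 0)) i j"
    by (cases n; cases n'; cases "i \<in> {0, 1, 2, 3, 4, 5, 6}")
       (auto simp: commutator_def sparse_sum H7_def less_7 weight7_def)
qed

lemma H7_F7: "commutator (H7 n) (F7 n') = (\<lambda>i j. - of_int (coroot n (simple_root n')) * F7 n' i j)"
proof (intro ext)
  fix i j
  show "commutator (H7 n) (F7 n') i j = - of_int (coroot n (simple_root n')) * F7 n' i j"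
    by (cases n; cases n'; cases "i \<in> {0, 1, 2, 3, 4, 5, 6}")
       (auto simp: commutator_def sparse_sum H7_def less_7 weight7_def)
qed

definition F11 :: matrix where
  "F11 i j = (if (i, j) = (2, 0) then -1 else if (i, j) \<in> {(3, 1), (6, 4)} then 1
     else if (i, j) = (5, 3) then -2 else 0)"

definition F21 :: matrix where
  "F21 i j = (if (i, j) = (3, 0) then -2 else if (i, j) \<in> {(4, 1), (5, 2)} then 2
     else if (i, j) = (6, 3) then -4 else 0)"

definition F31 :: matrix where
  "F31 i j = (if (i, j) = (4, 0) then -6 else if (i, j) = (6, 2) then 6 else 0)"

definition F32 :: matrix where
  "F32 i j = (if (i, j) \<in> {(5, 0), (6, 1)} then -6 else 0)"

lemma commutators7:
  "commutator (F7 Short) (F7 Long) = F11" "commutator (F7 Short) F11 = F21"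
  "commutator (F7 Short) F21 = F31" "commutator (F7 Long) F31 = F32"
proof -
  have "commutator (F7 Short) (F7 Long) i j = F11 i j" "commutator (F7 Short) F11 i j = F21 i j"
    "commutator (F7 Short) F21 i j = F31 i j" "commutator (F7 Long) F31 i j = F32 i j" for i j
    by (cases "i \<in> {0, 1, 2, 3, 4, 5, 6}"; cases "j \<in> {0, 1, 2, 3, 4, 5, 6}";
        auto simp: commutator_def sparse_sum F11_def F21_def F31_def F32_def)+
  then show "commutator (F7 Short) (F7 Long) = F11" "commutator (F7 Short) F11 = F21"
    "commutator (F7 Short) F21 = F31" "commutator (F7 Long) F31 = F32" by (auto intro!: ext)
qed

subsection \<open>The contravariant form\<close>

fun form :: "nat \<Rightarrow> tensor \<Rightarrow> tensor \<Rightarrow> complex" where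
  "form 0 S T = cnj (S []) * T []"
| "form (Suc n) S T = (\<Sum>i<7. square_length i * form n (\<lambda>l. S (i # l)) (\<lambda>l. T (i # l)))"

lemma form_add_left: "form n (\<lambda>l. S l + S' l) T = form n S T + form n S' T"
  by (induction n arbitrary: S S' T) (auto simp: algebra_simps sum.distrib)

lemma form_add_right: "form n S (\<lambda>l. T l + T' l) = form n S T + form n S T'"
  by (induction n arbitrary: S T T') (auto simp: algebra_simps sum.distrib)

lemma form_scale_left: "form n (\<lambda>l. c * S l) T = cnj c * form n S T"
  by (induction n arbitrary: S T) (auto simp: algebra_simps sum_distrib_left)

lemma form_scale_right: "form n S (\<lambda>l. c * T l) = c * form n S T"
  by (induction n arbitrary: S T) (auto simp: algebra_simps sum_distrib_left)

lemma form_sum_left: "finite I \<Longrightarrow> form n (\<lambda>l. \<Sum>x\<in>I. S x l) T = (\<Sum>x\<in>I. form n (S x) T)"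
  by (induction I rule: finite_induct) (use form_scale_left[of n 0 "\<lambda>_. 0" T] in \<open>auto simp: form_add_left\<close>)

lemma form_sum_right: "finite I \<Longrightarrow> form n S (\<lambda>l. \<Sum>x\<in>I. T x l) = (\<Sum>x\<in>I. form n S (T x))"
  by (induction I rule: finite_induct) (use form_scale_right[of n S 0 "\<lambda>_. 0"] in \<open>auto simp: form_add_right\<close>)

lemma form_adjoint:
  assumes "\<And>i j. square_length i * cnj (M i j) = square_length j * M' j i"
  shows "form n (derivation M S) T = form n S (derivation M' T)"
proof (induction n arbitrary: S T)
  case (Suc n)
  let ?f = "\<lambda>i j. form n (\<lambda>l. S (i # l)) (\<lambda>l. T (j # l))"
  have "form (Suc n) (derivation M S) T =
    (\<Sum>i<7. \<Sum>j<7. square_length i * cnj (M i j) * ?f j i) +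
    (\<Sum>i<7. square_length i * form n (derivation M (\<lambda>l. S (i # l))) (\<lambda>l. T (i # l)))"
    by (simp add: form_add_left form_sum_left form_scale_left distrib_left sum.distrib sum_distrib_left mult.assoc)
  also have "(\<Sum>i<7. \<Sum>j<7. square_length i * cnj (M i j) * ?f j i) =
      (\<Sum>j<7. \<Sum>i<7. square_length j * M' j i * ?f j i)"
    unfolding assms by (rule sum.swap)
  also have "\<dots> + (\<Sum>i<7. square_length i * form n (derivation M (\<lambda>l. S (i # l))) (\<lambda>l. T (i # l))) =
      form (Suc n) S (derivation M' T)"
    by (simp add: Suc form_add_right form_sum_right form_scale_right distrib_left sum.distrib
        sum_distrib_left mult.assoc)
  finally show ?case .
qed simp

lemma form_F7: "form n (derivation (F7 i) S) T = form n S (derivation (E7 i) T)"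
  by (rule form_adjoint) (cases i; auto simp: square_length_def)

lemma form_E7: "form n (derivation (E7 i) S) T = form n S (derivation (F7 i) T)"
  by (rule form_adjoint) (cases i; auto simp: square_length_def)

text \<open>The form is a sum of squares with positive weights.\<close>

lemma form_definite:
  "\<exists>r. form n T T = of_real r \<and> 0 \<le> r \<and> (r = 0 \<longrightarrow> (\<forall>l. length l = n \<and> set l \<subseteq> {..<7} \<longrightarrow> T l = 0))"
proof (induction n arbitrary: T)
  case 0
  show ?case by (rule exI[of _ "(cmod (T []))\<^sup>2"]) (simp add: complex_norm_square mult.commute del: of_real_power)
next
  case (Suc n)
  obtain r where r: "\<And>i. form n (\<lambda>l. T (i # l)) (\<lambda>l. T (i # l)) = of_real (r i)" "\<And>i. 0 \<le> r i"
    "\<And>i l. r i = 0 \<Longrightarrow> length l = n \<Longrightarrow> set l \<subseteq> {..<7} \<Longrightarrow> T (i # l) = 0"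
  proof -
    have "\<exists>r. form n (\<lambda>l. T (i # l)) (\<lambda>l. T (i # l)) = of_real r \<and> 0 \<le> r \<and>
        (r = 0 \<longrightarrow> (\<forall>l. length l = n \<and> set l \<subseteq> {..<7} \<longrightarrow> T (i # l) = 0))" for i
      using Suc[of "\<lambda>l. T (i # l)"] .
    then show ?thesis using that by metis
  qed
  define d :: "nat \<Rightarrow> real" where "d = (\<lambda>i. if i = 3 then 2 else 1)"
  have d: "square_length i = of_real (d i)" "0 < d i" for i by (auto simp: square_length_def d_def)
  show ?case
  proof (intro exI conjI impI allI)
    show "form (Suc n) T T = of_real (\<Sum>i<7. d i * r i)" by (simp add: r d)
    show "0 \<le> (\<Sum>i<7. d i * r i)" using r d by (intro sum_nonneg) (simp add: less_imp_le)
    fix l :: "nat list" assume "(\<Sum>i<7. d i * r i) = 0" and l: "length l = Suc n \<and> set l \<subseteq> {..<7}"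
    then have "d i * r i = 0" if "i < 7" for i
      using that r d by (subst (asm) sum_nonneg_eq_0_iff) (auto simp: less_imp_le)
    then have "r i = 0" if "i < 7" for i using that d(2)[of i] by force
    then show "T l = 0" using l r(3) by (cases l) auto
  qed
qed

subsection \<open>Highest weight vectors\<close>

definition single :: tensor where
  "single l = (if l = [0] then 1 else 0)"

text \<open>The highest weight vector of \<open>\<pi>\<^sub>2 = (2a + b) + (a + b)\<close> is taken in the second exterior power.\<close>

definition wedge :: tensor where
  "wedge l = (if l = [0, 1] then 1 else if l = [1, 0] then -1 else 0)"

fun highest :: "nat \<Rightarrow> nat \<Rightarrow> tensor" where
  "highest 0 0 = (\<lambda>l. if l = [] then 1 else 0)"
| "highest 0 (Suc l) = tensor_product 2 wedge (highest 0 l)"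
| "highest (Suc k) l = tensor_product 1 single (highest k l)"

lemma derivation_zero: "derivation M (\<lambda>_. 0) l = 0"
  using derivation_scale[of M 0 "\<lambda>_. 0" l] by simp

lemma derivation_unit: "derivation M (\<lambda>l. if l = [] then c else 0) l = 0"
  by (cases l) (auto simp: derivation_zero)

lemma derivation_single:
  "derivation M single l = (case l of [i] \<Rightarrow> M i 0 | _ \<Rightarrow> 0)"
proof (cases l)
  case (Cons i l')
  have "derivation M (\<lambda>l'. single (i # l')) l' = 0"
  proof (cases "i = 0")
    case True
    then have "(\<lambda>l'. single (i # l')) = (\<lambda>l. if l = [] then 1 else 0)" by (auto simp: single_def)
    then show ?thesis by (simp only: derivation_unit)
  next
    case False
    then have "(\<lambda>l'. single (i # l')) = (\<lambda>_. 0)" by (auto simp: single_def)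
    then show ?thesis by (simp only: derivation_zero)
  qed
  then show ?thesis by (auto simp: Cons sparse_sum single_def split: list.split)
qed simp

lemma derivation_basis1:
  assumes "c < 7"
  shows "derivation M (\<lambda>l. if l = [c] then d else 0) l = (case l of [i] \<Rightarrow> M i c * d | _ \<Rightarrow> 0)"
proof (cases l)
  case (Cons i l')
  have "derivation M (\<lambda>l'. if i # l' = [c] then d else 0) l' = 0"
    using derivation_unit[of M d l'] derivation_zero[of M l'] by (cases "i = c") auto
  moreover have "(\<Sum>j<7. M i j * (if j = c then d else 0)) = M i c * d"
    using assms by (simp add: if_distrib sum.delta cong: if_cong)
  ultimately show ?thesis by (auto simp: Cons split: list.split)
qed simp

lemma derivation_wedge:
  "derivation M wedge l = (case l of [i, j] \<Rightarrow>
     (if j = 1 then M i 0 else 0) - (if j = 0 then M i 1 else 0) +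
     (if i = 0 then M j 1 else 0) - (if i = 1 then M j 0 else 0) | _ \<Rightarrow> 0)"
proof (cases l)
  case (Cons i l')
  have 0: "(\<lambda>l'. wedge (0 # l')) = (\<lambda>l. if l = [1] then 1 else 0)"
    and 1: "(\<lambda>l'. wedge (1 # l')) = (\<lambda>l. if l = [0] then -1 else 0)"
    by (auto simp: wedge_def)
  have "derivation M (\<lambda>l'. wedge (i # l')) l' =
     (case l' of [j] \<Rightarrow> (if i = 0 then M j 1 else 0) - (if i = 1 then M j 0 else 0) | _ \<Rightarrow> 0)"
  proof -
    consider "i = 0" | "i = 1" | "i \<noteq> 0" "i \<noteq> 1" by blast
    then show ?thesis
    proof cases
      case 1
      show ?thesis unfolding 1 0 by (subst derivation_basis1) (auto split: list.split)
    next
      case 2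
      show ?thesis unfolding 2 \<open>(\<lambda>l'. wedge (1 # l')) = _\<close>
        by (subst derivation_basis1) (auto split: list.split)
    next
      case 3
      then have "(\<lambda>l'. wedge (i # l')) = (\<lambda>_. 0)" by (auto simp: wedge_def)
      then show ?thesis using 3 by (auto simp: derivation_zero split: list.split)
    qed
  qed
  then show ?thesis unfolding Cons
    by (auto simp: sparse_sum wedge_def split: list.split)
qed simp

lemma derivation_highest_zero:
  assumes "\<And>l. derivation M single l = 0" "\<And>l. derivation M wedge l = 0"
  shows "derivation M (highest k m) l = 0"
proof -
  have z: "tensor_product n (\<lambda>_. 0) B l = 0" "tensor_product n A (\<lambda>_. 0) l = 0" for n A B l
    using tensor_product_scale_left[of n 0 "\<lambda>_. 0" B l] tensor_product_scale_right[of n A 0 "\<lambda>_. 0" l] by auto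
  have s: "derivation M single = (\<lambda>_. 0)" "derivation M wedge = (\<lambda>_. 0)" using assms by auto
  have "derivation M (highest k m) = (\<lambda>_. 0)"
    by (induction k m rule: highest.induct)
       (auto simp: derivation_unit derivation_tensor_product s z)
  then show ?thesis by simp
qed

lemma E7_highest: "derivation (E7 n) (highest k m) l = 0"
proof (rule derivation_highest_zero)
  have c: "E7 n i 0 = 0" "E7 n i 1 = (if n = Short \<and> i = 0 then 1 else 0)" for i by (cases n; simp)+
  show "derivation (E7 n) single l = 0" for l
    unfolding derivation_single c by (simp split: list.split)
  show "derivation (E7 n) wedge l = 0" for l
    unfolding derivation_wedge c by (simp split: list.split)
qed

lemma H7_highest:
  "derivation (H7 n) (highest k m) l =
    of_int (coroot n (2 * int k + 3 * int m, int k + 2 * int m)) * highest k m l"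
proof -
  have c: "H7 n i 0 = (if i = 0 then of_int (coroot n (2, 1)) else 0)"
    "H7 n i 1 = (if i = 1 then of_int (coroot n (1, 1)) else 0)" for i
    by (auto simp: H7_def weight7_def)
  have c01: "of_int (coroot n (2, 1)) + of_int (coroot n (1, 1)) = (of_int (coroot n (3, 2)) :: complex)"
    by (cases n) auto
  have s: "derivation (H7 n) single = (\<lambda>l. of_int (coroot n (2, 1)) * single l)"
    unfolding derivation_single c by (auto simp: single_def fun_eq_iff split: list.split)
  have w: "derivation (H7 n) wedge = (\<lambda>l. of_int (coroot n (3, 2)) * wedge l)"
    unfolding derivation_wedge c c01[symmetric] by (auto simp: wedge_def fun_eq_iff split: list.split)
  show ?thesis
  proof (induction k m arbitrary: l rule: highest.induct)
    case 1
    then show ?case by (cases n) (auto simp: derivation_unit)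
  next
    case (2 m)
    have "derivation (H7 n) (highest 0 m) = (\<lambda>l. of_int (coroot n (3 * int m, 2 * int m)) * highest 0 m l)"
      using 2 by auto
    moreover have "coroot n (2 * int 0 + 3 * int (Suc m), int 0 + 2 * int (Suc m)) =
        coroot n (3, 2) + coroot n (3 * int m, 2 * int m)"
      by (cases n) auto
    ultimately show ?case
      by (simp add: derivation_tensor_product w tensor_product_scale_left tensor_product_scale_right distrib_right)
  next
    case (3 k m)
    have "derivation (H7 n) (highest k m) = (\<lambda>l. of_int (coroot n (2 * int k + 3 * int m, int k + 2 * int m)) * highest k m l)"
      using 3 by auto
    moreover have "coroot n (2 * int (Suc k) + 3 * int m, int (Suc k) + 2 * int m) =
        coroot n (2, 1) + coroot n (2 * int k + 3 * int m, int k + 2 * int m)"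
      by (cases n) auto
    ultimately show ?case
      by (simp add: derivation_tensor_product s tensor_product_scale_left tensor_product_scale_right distrib_right)
  qed
qed

lemma derivation_scale_matrix: "derivation (\<lambda>i j. c * M i j) T l = c * derivation M T l"
  by (induction l arbitrary: T) (auto simp: sum_distrib_left algebra_simps)

interpretation tensors: highest_weight_operators "\<lambda>c (T :: tensor) l. c * T l" UNIV
  "\<lambda>i. derivation (E7 i)" "\<lambda>i. derivation (F7 i)" "\<lambda>i. derivation (H7 i)"
  "highest k m" "(2 * int k + 3 * int m, int k + 2 * int m)" for k m
proof -
  interpret vector_space "\<lambda>c (T :: tensor) l. c * T l"
    by unfold_locales (auto simp: algebra_simps)
  show "highest_weight_operators (\<lambda>c (T :: tensor) l. c * T l) UNIV
    (\<lambda>i. derivation (E7 i)) (\<lambda>i. derivation (F7 i)) (\<lambda>i. derivation (H7 i))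
    (highest k m) (2 * int k + 3 * int m, int k + 2 * int m)"
  proof unfold_locales
    show "subspace UNIV" by simp
    fix i j :: node and c :: complex and x y :: tensor
    have add: "derivation M (x + y) = derivation M x + derivation M y" for M x y
      by (auto simp: plus_fun_def derivation_add)
    have scale: "derivation M (\<lambda>l. c * x l) = (\<lambda>l. c * derivation M x l)" for M
      by (auto simp: derivation_scale)
    show "derivation (E7 i) (x + y) = derivation (E7 i) x + derivation (E7 i) y"
      "derivation (F7 i) (x + y) = derivation (F7 i) x + derivation (F7 i) y"
      "derivation (H7 i) (x + y) = derivation (H7 i) x + derivation (H7 i) y" by (rule add)+
    show "derivation (E7 i) (\<lambda>l. c * x l) = (\<lambda>l. c * derivation (E7 i) x l)"
      "derivation (F7 i) (\<lambda>l. c * x l) = (\<lambda>l. c * derivation (F7 i) x l)"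
      "derivation (H7 i) (\<lambda>l. c * x l) = (\<lambda>l. c * derivation (H7 i) x l)" by (rule scale)+
    have zero: "derivation (\<lambda>i j. 0) x l = 0" for l
      using derivation_scale_matrix[of 0 "\<lambda>i j. 0" x l] by simp
    show "derivation (E7 i) (derivation (F7 j) x) =
       derivation (F7 j) (derivation (E7 i) x) + (if i = j then derivation (H7 i) x else 0)"
      by (rule ext) (simp add: derivation_commute[of "E7 i"] E7_F7 zero)
    show "derivation (H7 i) (derivation (F7 j) x) = derivation (F7 j) (derivation (H7 i) x) -
        (\<lambda>l. of_int (coroot i (simple_root j)) * derivation (F7 j) x l)"
      by (rule ext) (simp add: derivation_commute[of "H7 i"] H7_F7
          derivation_scale_matrix[of "- of_int (coroot i (simple_root j))" "F7 j", simplified])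
    show "derivation (E7 i) (highest k m) = 0" by (rule ext) (simp add: E7_highest)
    show "derivation (H7 i) (highest k m) =
        (\<lambda>l. of_int (coroot i (2 * int k + 3 * int m, int k + 2 * int m)) * highest k m l)"
      by (rule ext) (rule H7_highest)
  qed auto
qed

lemma form_zero_left: "form n (\<lambda>_. 0) T = 0"
  using form_scale_left[of n 0 "\<lambda>_. 0" T] by simp

text \<open>Lowering produces vectors orthogonal to the highest weight vector, which raising kills.\<close>

lemma form_highest_comb:
  "form n (highest k m) (tensors.comb k m u) = vacuum u * form n (highest k m) (highest k m)"
proof -
  have word: "form n (highest k m) (tensors.word k m (i # w)) = 0" for i w
  proof -
    have "derivation (E7 i) (highest k m) = (\<lambda>_. 0)" by (rule ext) (rule E7_highest)
    then show ?thesis by (simp add: form_E7[symmetric] form_zero_left)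
  qed
  show ?thesis
  proof (induction u)
    case Nil
    then show ?case using form_scale_right[of n "highest k m" 0 "\<lambda>_. 0"]
      by (simp add: vacuum_def zero_fun_def)
  next
    case (Cons p u)
    obtain c w where p: "p = (c, w)" by (cases p)
    have *: "form n (highest k m) (tensors.comb k m (p # u)) =
        c * form n (highest k m) (tensors.word k m w) + form n (highest k m) (tensors.comb k m u)"
      by (simp add: p plus_fun_def form_add_right form_scale_right)
    show ?case unfolding * Cons
      using word by (cases w) (simp_all add: p vacuum_def distrib_right del: tensors.word_simps(2))
  qed
qed

context highest_weight_module
begin

text \<open>If \<open>comb u = 0\<close> in the irreducible module, then raising \<open>u\<close> never yields a nonzero multiple of the
  highest weight vector. By contravariance the tensor of \<open>u\<close> is then orthogonal to everything that
  lowering produces, in particular to itself, and the form is definite.\<close>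

lemma relations_hold_in_tensors:
  assumes lam: "lam = (2 * int k + 3 * int m, int k + 2 * int m)"
    and u: "ops.comb u = 0" and cs: "set cs \<subseteq> {..<7}"
  shows "tensors.comb k m u cs = 0"
proof -
  have word: "form n (tensors.word k m w) (tensors.comb k m u) = 0" if "ops.comb u = 0" for n w u
    using that
  proof (induction w arbitrary: u)
    case Nil
    then have "vacuum u = 0" by (rule ops.vacuum_zero[OF v0_nonzero])
    then show ?case by (simp add: form_highest_comb)
  next
    case (Cons i w)
    have "ops.comb (raise lam i u) = 0"
      using ops.E_comb[of i u] Cons.prems by simp
    then have "form n (tensors.word k m w) (tensors.comb k m (raise lam i u)) = 0" by (rule Cons.IH)
    then show ?case by (simp add: form_F7 tensors.E_comb lam)
  qed
  have "form n (tensors.comb k m u') (tensors.comb k m u) = 0" for n u'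
    by (induction u') (auto simp: plus_fun_def zero_fun_def form_add_left form_scale_left form_zero_left word[OF u])
  then have "form (length cs) (tensors.comb k m u) (tensors.comb k m u) = 0" .
  then show ?thesis using form_definite[of "length cs" "tensors.comb k m u"] cs by auto
qed

text \<open>The functional does not depend on the choice of \<open>u\<close>, by \<open>relations_hold_in_tensors\<close>.\<close>

definition transfer :: "nat \<Rightarrow> nat \<Rightarrow> nat list \<Rightarrow> 'v \<Rightarrow> complex" where
  "transfer k m cs x = tensors.comb k m (SOME u. ops.comb u = x) cs"

lemma transfer_comb:
  assumes lam: "lam = (2 * int k + 3 * int m, int k + 2 * int m)" and cs: "set cs \<subseteq> {..<7}"
  shows "transfer k m cs (ops.comb u) = tensors.comb k m u cs"
proof -
  define u' where "u' = (SOME u'. ops.comb u' = ops.comb u)"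
  have "ops.comb u' = ops.comb u" unfolding u'_def by (rule someI) simp
  then have "ops.comb (u' @ map (\<lambda>(c, w). (-1 * c, w)) u) = 0"
    by (simp only: ops.comb_simps ops.comb_scaled) simp
  then have "tensors.comb k m (u' @ map (\<lambda>(c, w). (-1 * c, w)) u) cs = 0"
    by (rule relations_hold_in_tensors[OF lam _ cs])
  then have "tensors.comb k m u' cs = tensors.comb k m u cs"
    by (simp only: tensors.comb_simps tensors.comb_scaled) simp
  then show ?thesis by (simp add: transfer_def u'_def)
qed

text \<open>The operators \<open>F i\<close> of the module and of the tensors correspond to each other, and then so do all
  commutators formed from them; in this way the nested root vectors act on the tensors.\<close>

definition intertwined :: "nat \<Rightarrow> nat \<Rightarrow> ('v \<Rightarrow> 'v) \<Rightarrow> (tensor \<Rightarrow> tensor) \<Rightarrow> bool" where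
  "intertwined k m X D \<longleftrightarrow>
    (\<forall>u. \<exists>u'. X (ops.comb u) = ops.comb u' \<and> D (tensors.comb k m u) = tensors.comb k m u')"

lemma intertwined_F: "intertwined k m (act (F i)) (derivation (F7 i))"
  unfolding intertwined_def using ops.F_comb tensors.F_comb by blast

lemma intertwined_comp:
  "intertwined k m X D \<Longrightarrow> intertwined k m Y D' \<Longrightarrow> intertwined k m (\<lambda>x. X (Y x)) (\<lambda>T. D (D' T))"
  unfolding intertwined_def by metis

lemma intertwined_pow: "intertwined k m X D \<Longrightarrow> intertwined k m (X ^^ n) (D ^^ n)"
proof (induction n)
  case (Suc n)
  then show ?case using intertwined_comp[of k m X D "X ^^ n" "D ^^ n"] by (simp add: comp_def)
qed (auto simp: intertwined_def)

lemma intertwined_bracket: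
  assumes "intertwined k m (act x) (derivation A)" "intertwined k m (act y) (derivation B)"
  shows "intertwined k m (act (bracket x y)) (derivation (commutator A B))"
  unfolding intertwined_def
proof
  fix u
  obtain a where a: "act x (act y (ops.comb u)) = ops.comb a"
      "derivation A (derivation B (tensors.comb k m u)) = tensors.comb k m a"
    using intertwined_comp[OF assms] unfolding intertwined_def by blast
  obtain b where b: "act y (act x (ops.comb u)) = ops.comb b"
      "derivation B (derivation A (tensors.comb k m u)) = tensors.comb k m b"
    using intertwined_comp[OF assms(2,1)] unfolding intertwined_def by blast
  have "derivation (commutator A B) (tensors.comb k m u) = tensors.comb k m a - tensors.comb k m b"
    unfolding a(2)[symmetric] b(2)[symmetric] by (rule ext) (simp add: derivation_commute[of A B])
  moreover have "act (bracket x y) (ops.comb u) = ops.comb a - ops.comb b"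
    using bracket_act[OF ops.comb_in] a b by simp
  moreover have "ops.comb a - ops.comb b = ops.comb (a @ map (\<lambda>(c, w). (-1 * c, w)) b)"
    by (simp only: ops.comb_simps ops.comb_scaled) simp
  moreover have "tensors.comb k m a - tensors.comb k m b = tensors.comb k m (a @ map (\<lambda>(c, w). (-1 * c, w)) b)"
    by (simp only: tensors.comb_simps tensors.comb_scaled) (auto simp: fun_eq_iff)
  ultimately show "\<exists>u'. act (bracket x y) (ops.comb u) = ops.comb u' \<and>
      derivation (commutator A B) (tensors.comb k m u) = tensors.comb k m u'" by metis
qed

lemma intertwined_f:
  "intertwined k m (act (neg.f (1, 1))) (derivation F11)"
  "intertwined k m (act (neg.f (2, 1))) (derivation F21)"
  "intertwined k m (act (neg.f (3, 1))) (derivation F31)"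
  "intertwined k m (act (neg.f (3, 2))) (derivation F32)"
proof -
  show 11: "intertwined k m (act (neg.f (1, 1))) (derivation F11)"
    unfolding neg.f_simps(3) commutators7[symmetric] by (intro intertwined_bracket intertwined_F)
  show 21: "intertwined k m (act (neg.f (2, 1))) (derivation F21)"
    unfolding neg.f_simps(4) commutators7(2)[symmetric] by (intro intertwined_bracket intertwined_F 11)
  show 31: "intertwined k m (act (neg.f (3, 1))) (derivation F31)"
    unfolding neg.f_simps(5) commutators7(3)[symmetric] by (intro intertwined_bracket intertwined_F 21)
  show "intertwined k m (act (neg.f (3, 2))) (derivation F32)"
    unfolding neg.f_simps(6) commutators7(4)[symmetric] by (intro intertwined_bracket intertwined_F 31)
qed

text \<open>The rows \<open>0, 1, 3\<close> of the long negative root vectors vanish, so the coordinates at lists over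
  \<open>{0, 1, 3}\<close> are invariant functionals.\<close>

lemma transfer_invariant:
  assumes lam: "lam = (2 * int k + 3 * int m, int k + 2 * int m)" and cs: "set cs \<subseteq> {0, 1, 3}"
  shows "invariant_functional scale bracket E F H e scaleV M act v0 lam (transfer k m cs)"
proof unfold_locales
  have cs7: "set cs \<subseteq> {..<7}" using cs by auto
  note t = transfer_comb[OF lam cs7]
  fix x y assume "x \<in> M"
  then obtain u where u: "x = ops.comb u" using spanned_by_words by auto
  show "transfer k m cs (scaleV c x) = c * transfer k m cs x" for c
    using t[of "map (\<lambda>(c', w). (c * c', w)) u"] t[of u] by (simp add: u ops.comb_scaled tensors.comb_scaled)
  show "transfer k m cs (x + y) = transfer k m cs x + transfer k m cs y" if y: "y \<in> M"
  proof -
    obtain u' where u': "y = ops.comb u'" using spanned_by_words y by auto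
    show ?thesis using t[of "u @ u'"] by (simp add: u u' t)
  qed
  show "transfer k m cs (act (neg.f \<alpha>) x) = 0" if \<alpha>: "\<alpha> \<in> {(3, 2), (3, 1), (0, 1)}" for \<alpha>
  proof -
    have "\<exists>N. intertwined k m (act (neg.f \<alpha>)) (derivation N) \<and> (\<forall>i\<in>{0, 1, 3}. \<forall>j. N i j = 0)"
    proof -
      consider "\<alpha> = (3, 2)" | "\<alpha> = (3, 1)" | "\<alpha> = (0, 1)" using \<alpha> by blast
      then show ?thesis
      proof cases
        case 1
        then show ?thesis using intertwined_f(4) by (intro exI[of _ F32]) (auto simp: F32_def)
      next
        case 2
        then show ?thesis using intertwined_f(3) by (intro exI[of _ F31]) (auto simp: F31_def)
      next
        case 3
        then show ?thesis using intertwined_F by (intro exI[of _ "F7 Long"]) (auto simp: neg.f_simps(2))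
      qed
    qed
    then obtain N where N: "intertwined k m (act (neg.f \<alpha>)) (derivation N)" "\<And>i j. i \<in> {0, 1, 3} \<Longrightarrow> N i j = 0"
      by blast
    then obtain u' where u': "act (neg.f \<alpha>) x = ops.comb u'" "derivation N (tensors.comb k m u) = tensors.comb k m u'"
      unfolding intertwined_def u by blast
    have "tensors.comb k m u' cs = 0"
      unfolding u'(2)[symmetric] by (rule derivation_rows_zero) (use cs N(2) in blast)
    then show ?thesis by (simp add: u' t)
  qed
qed

end

definition tensor_coord :: "tensor \<Rightarrow> nat list \<Rightarrow> nat \<Rightarrow> nat \<Rightarrow> nat \<Rightarrow> complex" where
  "tensor_coord T cs i j k =
    ((derivation F21 ^^ i) ((derivation F11 ^^ j) ((derivation (F7 Short) ^^ k) T))) cs"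

lemma (in highest_weight_module) coord_transfer:
  assumes lam: "lam = (2 * int k + 3 * int m, int k + 2 * int m)" and cs: "set cs \<subseteq> {0, 1, 3}"
  shows "invariant_functional.coord bracket F act (transfer k m cs) v0 p q s =
    tensor_coord (highest k m) cs p q s"
proof -
  interpret invariant_functional scale bracket E F H e scaleV M act v0 lam "transfer k m cs"
    using assms by (rule transfer_invariant)
  have "intertwined k m (\<lambda>x. (f21 ^^ p) ((f11 ^^ q) ((fs ^^ s) x)))
      (\<lambda>T. (derivation F21 ^^ p) ((derivation F11 ^^ q) ((derivation (F7 Short) ^^ s) T)))"
    by (rule intertwined_comp[OF intertwined_pow[OF intertwined_f(2)]
          intertwined_comp[OF intertwined_pow[OF intertwined_f(1)] intertwined_pow[OF intertwined_F]]])
  then obtain u where u: "(f21 ^^ p) ((f11 ^^ q) ((fs ^^ s) (ops.comb [(1, [])]))) = ops.comb u"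
    "(derivation F21 ^^ p) ((derivation F11 ^^ q) ((derivation (F7 Short) ^^ s) (tensors.comb k m [(1, [])]))) =
      tensors.comb k m u"
    unfolding intertwined_def by blast
  have "set cs \<subseteq> {..<7}" using cs by auto
  then have "transfer k m cs (ops.comb u) = tensors.comb k m u cs" by (rule transfer_comb[OF lam])
  then show ?thesis unfolding u[symmetric] by (simp add: coord_def tensor_coord_def)
qed

section \<open>Leading terms of tensor products\<close>

text \<open>The monomial \<open>(p, q, s)\<close> is the only one of degree at most \<open>p + q + s\<close>, so it is the lowest term for
  every homogeneous order.\<close>

definition leads :: "tensor \<Rightarrow> nat list \<Rightarrow> nat \<Rightarrow> nat \<Rightarrow> nat \<Rightarrow> bool" where
  "leads T cs p q s \<longleftrightarrow> tensor_coord T cs p q s \<noteq> 0 \<and>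
    (\<forall>i j k. i + j + k \<le> p + q + s \<longrightarrow> (i, j, k) \<noteq> (p, q, s) \<longrightarrow> tensor_coord T cs i j k = 0)"

lemma tensor_coord_product:
  "tensor_coord (tensor_product (length cs) A B) (cs @ cs') i j k =
    (\<Sum>c\<le>k. \<Sum>b\<le>j. \<Sum>a\<le>i. of_nat (k choose c) * of_nat (j choose b) * of_nat (i choose a) *
      (tensor_coord A cs a b c * tensor_coord B cs' (i - a) (j - b) (k - c)))"
proof -
  let ?D = "\<lambda>a b c T. (derivation F21 ^^ a) ((derivation F11 ^^ b) ((derivation (F7 Short) ^^ c) T))"
  let ?n = "length cs"
  have "(derivation F11 ^^ j) ((derivation (F7 Short) ^^ k) (tensor_product ?n A B)) =
    (\<lambda>l. \<Sum>c\<le>k. of_nat (k choose c) * (\<Sum>b\<le>j. of_nat (j choose b) *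
      tensor_product ?n (?D 0 b c A) (?D 0 (j - b) (k - c) B) l))"
    unfolding derivation_pow_tensor_product[where n = k] derivation_pow_sum derivation_pow_tensor_product[where n = j] by simp
  then have "?D i j k (tensor_product ?n A B) (cs @ cs') =
    (\<Sum>c\<le>k. of_nat (k choose c) * (\<Sum>b\<le>j. of_nat (j choose b) * (\<Sum>a\<le>i. of_nat (i choose a) *
      tensor_product ?n (?D a b c A) (?D (i - a) (j - b) (k - c) B) (cs @ cs'))))"
    by (simp only: derivation_pow_sum derivation_pow_tensor_product[where n = i] funpow.simps(1) id_apply)
  then show ?thesis
    by (simp only: tensor_coord_def tensor_product_append sum_distrib_left mult.assoc)
qed

text \<open>By the Leibniz rule the coordinates of a tensor product are, up to binomial coefficients, those of
  a product of polynomials; and the lowest term of a product is the product of the lowest terms.\<close>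

lemma leads_tensor_product:
  assumes A: "leads A cs p q s" and B: "leads B cs' p' q' s'"
  shows "leads (tensor_product (length cs) A B) (cs @ cs') (p + p') (q + q') (s + s')"
proof -
  have key: "a = p \<and> b = q \<and> c = s \<and> i = p' \<and> j = q' \<and> k = s'"
    if "tensor_coord A cs a b c * tensor_coord B cs' i j k \<noteq> 0"
      "(a + i) + (b + j) + (c + k) \<le> (p + p') + (q + q') + (s + s')" for a b c i j k
  proof -
    have 1: "p + q + s < a + b + c \<or> a = p \<and> b = q \<and> c = s"
      using A that(1) unfolding leads_def by (cases "a + b + c \<le> p + q + s") auto
    have 2: "p' + q' + s' < i + j + k \<or> i = p' \<and> j = q' \<and> k = s'"
      using B that(1) unfolding leads_def by (cases "i + j + k \<le> p' + q' + s'") auto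
    show ?thesis using that(2) 1 2 by linarith
  qed
  have vanish: "tensor_coord A cs a b c * tensor_coord B cs' (i - a) (j - b) (k - c) = 0"
    if "i + j + k \<le> (p + p') + (q + q') + (s + s')" "c \<in> {..k}" "b \<in> {..j}" "a \<in> {..i}"
      "(i, j, k) \<noteq> (p + p', q + q', s + s') \<or> (a, b, c) \<noteq> (p, q, s)" for a b c i j k
  proof (rule ccontr)
    assume nz: "\<not> ?thesis"
    have "a + (i - a) = i" "b + (j - b) = j" "c + (k - c) = k" using that(2-4) by auto
    moreover from this have "(a + (i - a)) + (b + (j - b)) + (c + (k - c)) \<le> (p + p') + (q + q') + (s + s')"
      using that(1) by simp
    then have "a = p \<and> b = q \<and> c = s \<and> i - a = p' \<and> j - b = q' \<and> k - c = s'"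
      by (rule key[OF nz])
    ultimately show False using that(5) by metis
  qed
  have low: "tensor_coord (tensor_product (length cs) A B) (cs @ cs') i j k = 0"
    if "i + j + k \<le> (p + p') + (q + q') + (s + s')" "(i, j, k) \<noteq> (p + p', q + q', s + s')" for i j k
    unfolding tensor_coord_product
  proof (intro sum.neutral ballI)
    fix a b c assume *: "c \<in> {..k}" "b \<in> {..j}" "a \<in> {..i}"
    then have "tensor_coord A cs a b c * tensor_coord B cs' (i - a) (j - b) (k - c) = 0"
      using vanish that by blast
    then show "of_nat (k choose c) * of_nat (j choose b) * of_nat (i choose a) *
      (tensor_coord A cs a b c * tensor_coord B cs' (i - a) (j - b) (k - c)) = 0" by simp
  qed
  let ?i = "p + p'" and ?j = "q + q'" and ?k = "s + s'"
  let ?X = "of_nat (?k choose s) * of_nat (?j choose q) * of_nat (?i choose p) *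
      (tensor_coord A cs p q s * tensor_coord B cs' p' q' s')"
  have "tensor_coord (tensor_product (length cs) A B) (cs @ cs') ?i ?j ?k =
     (\<Sum>c\<le>?k. \<Sum>b\<le>?j. \<Sum>a\<le>?i. if c = s then if b = q then if a = p then ?X else 0 else 0 else 0)"
    unfolding tensor_coord_product
  proof (rule sum.cong[OF HOL.refl], rule sum.cong[OF HOL.refl], rule sum.cong[OF HOL.refl])
    fix c b a assume *: "c \<in> {..?k}" "b \<in> {..?j}" "a \<in> {..?i}"
    show "of_nat (?k choose c) * of_nat (?j choose b) * of_nat (?i choose a) *
      (tensor_coord A cs a b c * tensor_coord B cs' (?i - a) (?j - b) (?k - c)) =
      (if c = s then if b = q then if a = p then ?X else 0 else 0 else 0)"
    proof (cases "c = s \<and> b = q \<and> a = p")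
      case False
      then have "tensor_coord A cs a b c * tensor_coord B cs' (?i - a) (?j - b) (?k - c) = 0"
        by (intro vanish) (use * in auto)
      then show ?thesis using False by auto
    qed (simp add: add_diff_cancel_left')
  qed
  also have "\<dots> = (\<Sum>c\<le>?k. \<Sum>b\<le>?j. if c = s then if b = q then ?X else 0 else 0)"
    by (rule sum.cong[OF HOL.refl], rule sum.cong[OF HOL.refl]) simp
  also have "\<dots> = (\<Sum>c\<le>?k. if c = s then ?X else 0)"
    by (rule sum.cong[OF HOL.refl]) simp
  also have "\<dots> = ?X" by simp
  also have "?X \<noteq> 0"
  proof -
    have "?k choose s \<noteq> 0" "?j choose q \<noteq> 0" "?i choose p \<noteq> 0" by (auto simp: binomial_eq_0_iff)
    then show ?thesis using A B by (auto simp: leads_def)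
  qed
  finally show ?thesis using low unfolding leads_def by blast
qed

lemma leads_small:
  assumes "p + q + s \<le> 1"
    and "tensor_coord T cs p q s \<noteq> 0"
    and "(0, 0, 0) \<noteq> (p, q, s) \<Longrightarrow> T cs = 0"
    and "(1, 0, 0) \<noteq> (p, q, s) \<Longrightarrow> p + q + s = 1 \<Longrightarrow> derivation F21 T cs = 0"
    and "(0, 1, 0) \<noteq> (p, q, s) \<Longrightarrow> p + q + s = 1 \<Longrightarrow> derivation F11 T cs = 0"
    and "(0, 0, 1) \<noteq> (p, q, s) \<Longrightarrow> p + q + s = 1 \<Longrightarrow> derivation (F7 Short) T cs = 0"
  shows "leads T cs p q s"
  unfolding leads_def
proof (intro conjI allI impI)
  fix i j k assume "i + j + k \<le> p + q + s" and ne: "(i, j, k) \<noteq> (p, q, s)"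
  then have "(i, j, k) = (0, 0, 0) \<or> p + q + s = 1 \<and> ((i, j, k) = (1, 0, 0) \<or> (i, j, k) = (0, 1, 0) \<or> (i, j, k) = (0, 0, 1))"
    using assms(1) by auto
  then show "tensor_coord T cs i j k = 0" using assms(3-) ne by (auto simp: tensor_coord_def)
qed fact

text \<open>These six functionals give the generators: up to scalars, their polynomials are \<open>1, z, x - y z\<close> for
  \<open>single\<close> and \<open>1, y, x\<close> for \<open>wedge\<close>.\<close>

lemma leads_single:
  "leads single [0] 0 0 0" "leads single [1] 0 0 1" "leads single [3] 1 0 0"
  by (rule leads_small; simp add: tensor_coord_def sparse_sum F11_def F21_def single_def)+

lemma leads_wedge:
  "leads wedge [0, 1] 0 0 0" "leads wedge [0, 3] 0 1 0" "leads wedge [1, 3] 1 0 0"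
  by (rule leads_small; simp add: tensor_coord_def sparse_sum F11_def F21_def wedge_def)+

lemma leads_exists:
  assumes "s \<le> k" "q \<le> m" "p + q + s \<le> k + m"
  shows "\<exists>cs. set cs \<subseteq> {0, 1, 3} \<and> leads (highest k m) cs p q s"
  using assms
proof (induction k m arbitrary: p q s rule: highest.induct)
  case 1
  then have "leads (highest 0 0) [] p q s" by (intro leads_small) (auto simp: tensor_coord_def)
  then show ?case by (intro exI[of _ "[]"]) simp
next
  case (2 m)
  have step: ?case if h: "p' \<le> p" "q' \<le> q" "q - q' \<le> m" "(p - p') + (q - q') \<le> m"
    and cs: "length cs = 2" "set cs \<subseteq> {0, 1, 3}" "leads wedge cs p' q' 0" for p' q' cs
  proof -
    obtain cs' where "set cs' \<subseteq> {0, 1, 3}" "leads (highest 0 m) cs' (p - p') (q - q') 0"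
      using 2(1)[of 0 "q - q'" "p - p'"] h by auto
    then show ?thesis
      using leads_tensor_product[OF cs(3), of "highest 0 m" cs' "p - p'" "q - q'" 0] h cs 2(2)
      by (intro exI[of _ "cs @ cs'"]) auto
  qed
  consider "q > 0" | "q = 0" "p > 0" | "q = 0" "p = 0" by blast
  then show ?case
  proof cases
    case 1
    then show ?thesis using 2 by (intro step[of 0 1 "[0, 3]"]) (auto simp: leads_wedge[simplified])
  next
    case 2
    then show ?thesis using \<open>p + q + s \<le> _\<close> by (intro step[of 1 0 "[1, 3]"]) (auto simp: leads_wedge[simplified])
  next
    case 3
    then show ?thesis by (intro step[of 0 0 "[0, 1]"]) (auto simp: leads_wedge[simplified])
  qed
next
  case (3 k m)
  have step: ?case if h: "p' \<le> p" "s' \<le> s" "s - s' \<le> k" "(p - p') + q + (s - s') \<le> k + m"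
    and cs: "length cs = 1" "set cs \<subseteq> {0, 1, 3}" "leads single cs p' 0 s'" for p' s' cs
  proof -
    obtain cs' where "set cs' \<subseteq> {0, 1, 3}" "leads (highest k m) cs' (p - p') q (s - s')"
      using 3(1)[of "s - s'" q "p - p'"] h 3(3) by auto
    then show ?thesis
      using leads_tensor_product[OF cs(3), of "highest k m" cs' "p - p'" q "s - s'"] h cs
      by (intro exI[of _ "cs @ cs'"]) auto
  qed
  consider "s > 0" | "s = 0" "p > 0" | "s = 0" "p = 0" by blast
  then show ?case
  proof cases
    case 1
    then show ?thesis using 3 by (intro step[of 0 1 "[1]"]) (auto simp: leads_single[simplified])
  next
    case 2
    then show ?thesis using 3 by (intro step[of 1 0 "[3]"]) (auto simp: leads_single[simplified])
  next
    case 3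
    then show ?thesis using \<open>q \<le> m\<close> by (intro step[of 0 0 "[0]"]) (auto simp: leads_single[simplified])
  qed
qed

section \<open>Generators and the defining relation\<close>

definition signature_of :: "nat \<Rightarrow> nat \<Rightarrow> nat \<Rightarrow> nat \<Rightarrow> nat \<Rightarrow> signature" where
  "signature_of k l p q s = ((2 * int k + 3 * int l, int k + 2 * int l), (0, 0, p, q, 0, s))"

abbreviation generators :: "signature set" where
  "generators \<equiv> {sigma1, sigma2, sigma3, sigma4, sigma5, sigma6}"

abbreviation relation :: "(signature multiset \<times> signature multiset) set" where
  "relation \<equiv> {({#sigma2, sigma5#}, {#sigma3, sigma4#})}"

definition generator_mset :: "nat \<Rightarrow> nat \<Rightarrow> nat \<Rightarrow> nat \<Rightarrow> nat \<Rightarrow> nat \<Rightarrow> signature multiset" where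
  "generator_mset n1 n2 n3 n4 n5 n6 =
    replicate_mset n1 sigma1 + replicate_mset n2 sigma2 + replicate_mset n3 sigma3 +
    replicate_mset n4 sigma4 + replicate_mset n5 sigma5 + replicate_mset n6 sigma6"

lemmas sigma_defs = sigma1_def sigma2_def sigma3_def sigma4_def sigma5_def sigma6_def pi1_def pi2_def

lemma generator_msetE:
  assumes "set_mset M \<subseteq> generators"
  obtains n1 n2 n3 n4 n5 n6 where "M = generator_mset n1 n2 n3 n4 n5 n6"
proof -
  have "\<exists>n1 n2 n3 n4 n5 n6. M = generator_mset n1 n2 n3 n4 n5 n6"
    using assms
  proof (induction M)
    case empty
    show ?case by (intro exI[of _ 0]) (simp add: generator_mset_def)
  next
    case (add x M)
    then obtain n1 n2 n3 n4 n5 n6 where M: "M = generator_mset n1 n2 n3 n4 n5 n6" by auto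
    consider "x = sigma1" | "x = sigma2" | "x = sigma3" | "x = sigma4" | "x = sigma5" | "x = sigma6"
      using add.prems by auto
    then show ?case
    proof cases
      case 1
      then have "add_mset x M = generator_mset (Suc n1) n2 n3 n4 n5 n6" by (simp add: M generator_mset_def)
      then show ?thesis by blast
    next
      case 2
      then have "add_mset x M = generator_mset n1 (Suc n2) n3 n4 n5 n6" by (simp add: M generator_mset_def)
      then show ?thesis by blast
    next
      case 3
      then have "add_mset x M = generator_mset n1 n2 (Suc n3) n4 n5 n6" by (simp add: M generator_mset_def)
      then show ?thesis by blast
    next
      case 4
      then have "add_mset x M = generator_mset n1 n2 n3 (Suc n4) n5 n6" by (simp add: M generator_mset_def)
      then show ?thesis by blast
    next
      case 5
      then have "add_mset x M = generator_mset n1 n2 n3 n4 (Suc n5) n6" by (simp add: M generator_mset_def)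
      then show ?thesis by blast
    next
      case 6
      then have "add_mset x M = generator_mset n1 n2 n3 n4 n5 (Suc n6)" by (simp add: M generator_mset_def)
      then show ?thesis by blast
    qed
  qed
  then show ?thesis using that by blast
qed

lemma set_generator_mset: "set_mset (generator_mset n1 n2 n3 n4 n5 n6) \<subseteq> generators"
  by (auto simp: generator_mset_def split: if_splits)

lemma sum_generator_mset:
  "\<Sum>\<^sub># (generator_mset n1 n2 n3 n4 n5 n6) =
    signature_of (n1 + n2 + n3) (n4 + n5 + n6) (n3 + n5) n6 n1"
proof -
  have "\<Sum>\<^sub># (replicate_mset n sigma1) = signature_of n 0 0 0 n"
    "\<Sum>\<^sub># (replicate_mset n sigma2) = signature_of n 0 0 0 0"
    "\<Sum>\<^sub># (replicate_mset n sigma3) = signature_of n 0 n 0 0"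
    "\<Sum>\<^sub># (replicate_mset n sigma4) = signature_of 0 n 0 0 0"
    "\<Sum>\<^sub># (replicate_mset n sigma5) = signature_of 0 n n 0 0"
    "\<Sum>\<^sub># (replicate_mset n sigma6) = signature_of 0 n 0 n 0" for n
    by (induction n; simp add: sigma_defs signature_of_def zero_prod_def)+
  then show ?thesis by (simp add: generator_mset_def signature_of_def)
qed

lemma signature_of_inject:
  "signature_of k l p q s = signature_of k' l' p' q' s' \<longleftrightarrow>
    k = k' \<and> l = l' \<and> p = p' \<and> q = q' \<and> s = s'"
  by (auto simp: signature_of_def)

lemma generated_signatures:
  "{\<Sum>\<^sub># M | M. set_mset M \<subseteq> generators} =
    {signature_of k l p q s | k l p q s. s \<le> k \<and> q \<le> l \<and> p + q + s \<le> k + l}"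
proof (intro equalityI subsetI)
  fix \<sigma> assume "\<sigma> \<in> {\<Sum>\<^sub># M | M. set_mset M \<subseteq> generators}"
  then obtain M where M: "set_mset M \<subseteq> generators" "\<sigma> = \<Sum>\<^sub># M" by blast
  obtain n1 n2 n3 n4 n5 n6 where "M = generator_mset n1 n2 n3 n4 n5 n6" using generator_msetE[OF M(1)] .
  then have "\<sigma> = signature_of (n1 + n2 + n3) (n4 + n5 + n6) (n3 + n5) n6 n1"
    by (simp add: M sum_generator_mset)
  moreover have "n1 \<le> n1 + n2 + n3 \<and> n6 \<le> n4 + n5 + n6 \<and> (n3 + n5) + n6 + n1 \<le> (n1 + n2 + n3) + (n4 + n5 + n6)"
    by simp
  ultimately show "\<sigma> \<in> {signature_of k l p q s | k l p q s. s \<le> k \<and> q \<le> l \<and> p + q + s \<le> k + l}" by blast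
next
  fix \<sigma> assume "\<sigma> \<in> {signature_of k l p q s | k l p q s. s \<le> k \<and> q \<le> l \<and> p + q + s \<le> k + l}"
  then obtain k l p q s where *: "\<sigma> = signature_of k l p q s" "s \<le> k" "q \<le> l" "p + q + s \<le> k + l" by blast
  \<comment> \<open>Both \<open>sigma3\<close> and \<open>sigma5\<close> contribute to \<open>p\<close>; \<open>sigma3\<close> is used as often as the weight permits.\<close>
  define n3 where "n3 = min p (k - s)"
  define n5 where "n5 = p - n3"
  have "s + (k - s - n3) + n3 = k" "(l - q - n5) + n5 + q = l" "n3 + n5 = p"
    using * by (auto simp: n3_def n5_def)
  then have "\<sigma> = \<Sum>\<^sub># (generator_mset s (k - s - n3) n3 (l - q - n5) n5 q)"
    by (simp add: sum_generator_mset *)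
  then show "\<sigma> \<in> {\<Sum>\<^sub># M | M. set_mset M \<subseteq> generators}" using set_generator_mset by blast
qed

lemma cong_exchange:
  "cong_generated relation (generator_mset n1 (n2 + t) n3 n4 (n5 + t) n6)
    (generator_mset n1 n2 (n3 + t) (n4 + t) n5 n6)"
proof (induction t arbitrary: n3 n4)
  case (Suc t)
  have "cong_generated relation ({#sigma2, sigma5#} + generator_mset n1 (n2 + t) n3 n4 (n5 + t) n6)
      ({#sigma3, sigma4#} + generator_mset n1 (n2 + t) n3 n4 (n5 + t) n6)"
    by (intro cong_generated.add cong_generated.base) simp
  also have "{#sigma2, sigma5#} + generator_mset n1 (n2 + t) n3 n4 (n5 + t) n6 =
      generator_mset n1 (n2 + Suc t) n3 n4 (n5 + Suc t) n6"
    by (simp add: generator_mset_def)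
  also have "{#sigma3, sigma4#} + generator_mset n1 (n2 + t) n3 n4 (n5 + t) n6 =
      generator_mset n1 (n2 + t) (Suc n3) (Suc n4) (n5 + t) n6"
    by (simp add: generator_mset_def)
  finally show ?case using Suc[of "Suc n3" "Suc n4"] cong_generated.trans by simp blast
qed (simp add: cong_generated.refl)

lemma relation_defines: "defining_relations generators relation"
  unfolding defining_relations_def
proof (intro allI impI iffI)
  fix M N assume sub: "set_mset M \<subseteq> generators" "set_mset N \<subseteq> generators"
  show "\<Sum>\<^sub># M = \<Sum>\<^sub># N" if "cong_generated relation M N"
    using that by (induction rule: cong_generated.induct) (auto simp: sigma_defs)
  obtain m1 m2 m3 m4 m5 m6 where M: "M = generator_mset m1 m2 m3 m4 m5 m6" using generator_msetE[OF sub(1)] .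
  obtain n1 n2 n3 n4 n5 n6 where N: "N = generator_mset n1 n2 n3 n4 n5 n6" using generator_msetE[OF sub(2)] .
  assume "\<Sum>\<^sub># M = \<Sum>\<^sub># N"
  then have eq: "m1 = n1" "m6 = n6" "m2 + m3 = n2 + n3" "m4 + m5 = n4 + n5" "m3 + m5 = n3 + n5"
    by (simp_all add: M N sum_generator_mset signature_of_inject)
  show "cong_generated relation M N"
  proof (cases "n2 \<le> m2")
    case True
    define t where "t = m2 - n2"
    have "m2 = n2 + t" "n3 = m3 + t" "n4 = m4 + t" "m5 = n5 + t" using True eq by (simp_all add: t_def)
    then show ?thesis unfolding M N eq using cong_exchange by simp
  next
    case False
    define t where "t = n2 - m2"
    have "n2 = m2 + t" "m3 = n3 + t" "m4 = n4 + t" "n5 = m5 + t" using False eq by (simp_all add: t_def)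
    then show ?thesis unfolding M N eq using cong_generated.sym[OF cong_exchange] by simp
  qed
qed

context g2_branching
begin

lemma branching_semigroup_eq:
  assumes homogeneous
  shows "branching_semigroup =
    {signature_of k l p q s | k l p q s. s \<le> k \<and> q \<le> l \<and> p + q + s \<le> k + l}"
proof (intro equalityI subsetI)
  fix \<sigma> assume "\<sigma> \<in> branching_semigroup"
  then show "\<sigma> \<in> {signature_of k l p q s | k l p q s. s \<le> k \<and> q \<le> l \<and> p + q + s \<le> k + l}"
    using branching_semigroup_bound[OF assms] unfolding signature_of_def by blast
next
  fix \<sigma> assume "\<sigma> \<in> {signature_of k l p q s | k l p q s. s \<le> k \<and> q \<le> l \<and> p + q + s \<le> k + l}"
  then obtain k l p q s where *: "\<sigma> = signature_of k l p q s" "s \<le> k" "q \<le> l" "p + q + s \<le> k + l" by blast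
  define \<mu> :: weight where "\<mu> = (2 * int k + 3 * int l, int k + 2 * int l)"
  have \<mu>: "dominant \<mu>" unfolding dominant_def all_node by (simp add: \<mu>_def)
  interpret M: highest_weight_module scale bracket E F H e scaleV "V \<mu>" "act \<mu>" "hv \<mu>" \<mu>
    using \<mu> by (rule highest_weight_module)
  obtain cs where cs: "set cs \<subseteq> {0, 1, 3}" "leads (highest k l) cs p q s"
    using leads_exists[OF *(2-4)] by blast
  note coord = M.coord_transfer[OF \<mu>_def cs(1)]
  have "(\<mu>, (0, 0, p, q, 0, s)) \<in> branching_semigroup"
    by (rule in_branching_semigroup[OF assms \<mu> M.transfer_invariant[OF \<mu>_def cs(1)]])
       (use cs(2) in \<open>auto simp: coord leads_def\<close>)
  then show "\<sigma> \<in> branching_semigroup" by (simp add: * signature_of_def \<mu>_def)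
qed

end

theorem mainTheorem7:
  fixes scale :: "complex \<Rightarrow> 'g::ab_group_add \<Rightarrow> 'g"
    and bracket :: "'g \<Rightarrow> 'g \<Rightarrow> 'g"
    and E F H :: "node \<Rightarrow> 'g"
    and e :: "weight \<Rightarrow> 'g"
    and scaleV :: "complex \<Rightarrow> 'v::ab_group_add \<Rightarrow> 'v"
    and le lt :: "exponents \<Rightarrow> exponents \<Rightarrow> bool"
    and V :: "weight \<Rightarrow> 'v set"
    and act :: "weight \<Rightarrow> 'g \<Rightarrow> 'v \<Rightarrow> 'v"
    and hv :: "weight \<Rightarrow> 'v"
  assumes "g2_branching scale bracket E F H e scaleV le lt V act hv"
    and "monomial_order.homogeneous lt"
  shows "generated_by (g2_branching.branching_semigroup scale bracket H e scaleV le V act hv)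
           {sigma1, sigma2, sigma3, sigma4, sigma5, sigma6} \<and>
         defining_relations {sigma1, sigma2, sigma3, sigma4, sigma5, sigma6}
           {({#sigma2, sigma5#}, {#sigma3, sigma4#})}"
proof
  interpret g2_branching scale bracket E F H e scaleV le lt V act hv by fact
  show "generated_by branching_semigroup generators"
    unfolding generated_by_def branching_semigroup_eq[OF assms(2)] generated_signatures ..
  show "defining_relations generators relation" by (rule relation_defines)
qed

end
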